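(* Let $n\ge3$. For $l=1,2$ let $$V_l(x)=a_{l0}+\sum_{j=1}^{3}\left(\lambda_{lj}e^{i2\pi k_{lj}\cdot x}+\overline{\lambda_{lj}}e^{-i2\pi k_{lj}\cdot x}\right),$$ where $a_{l0}\in\mathbb{R}$, $\lambda_{lj}\in\mathbb{C}\setminus\{0\}$, $k_{lj}\in\mathbb{Z}^n\setminus\{0\}$ for $1\le j\le 3$, and for each $l$ the three vectors $k_{l1},k_{l2},k_{l3}$ are pairwise non-parallel. Let $\overline{H}_l$ be the effective Hamiltonian associated with the Hamiltonian $\frac12|p|^2+V_l(x)$. There are three cases. (1) If $k_{11},k_{12},k_{13}$ are mutually orthogonal, then $\overline{H}_1=\overline{H}_2$ if and only if for $1\le j\le3$, $$k_{1j}\parallel k_{2j}\quad\text{and}\quad|\lambda_{1j}|=|\lambda_{2j}|.$$ (2) If $k_{11}\perp k_{12}$ and $k_{11}\perp k_{13}$, but $k_{12}\not\perp k_{13}$, then $\overline{H}_1=\overline{H}_2$ if and only if $$k_{11}\parallel k_{21},\quad c\,k_{12}=k_{22},\quad c\,k_{13}=k_{23}\quad\text{for some }c\in\mathbb{Q}\setminus\{0\},$$ and for $1\le j\le3$, $$|\lambda_{1j}|=|\lambda_{2j}|.$$ (3) If $k_{11},k_{12},k_{13}$ do not satisfy the hypotheses of (1) and (2) after permutations (that is, neither hypothesis holds for any ordering of the three vectors), then $$\overline{H}_1\equiv\overline{H}_2\quad\Longleftrightarrow\quad V_1(x)=V_2\left(\frac{x}{c}+x_0\right)\ \text{ for all }x\in\mathbb{T}^n,$$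 for some $c\in\mathbb{Q}\setminus\{0\}$ and $x_0\in\mathbb{T}^n$.
   Context: $\mathbb{T}^n=\mathbb{R}^n/\mathbb{Z}^n$ is the flat torus, and $\overline{\lambda}$ denotes the complex conjugate of a complex number $\lambda$. For a continuous $\mathbb{Z}^n$-periodic $V:\mathbb{R}^n\to\mathbb{R}$, the effective Hamiltonian $\overline{H}:\mathbb{R}^n\to\mathbb{R}$ associated with $\frac12|p|^2+V(x)$ is defined as follows: for each $p\in\mathbb{R}^n$, $\overline{H}(p)$ is the unique constant $\mu\in\mathbb{R}$ such that the cell problem $\frac12|p+Dv|^2+V(x)=\mu$ in $\mathbb{T}^n$ has a continuous ($\mathbb{Z}^n$-periodic) viscosity solution $v$. Vectors $u,w$ are parallel ($u\parallel w$) if they are linearly dependent; $u\perp w$ means $u\cdot w=0$. The identity $V_1(x)=V_2(x/c+x_0)$ is understood with $V_1,V_2$ regarded as $\mathbb{Z}^n$-periodic functions on $\mathbb{R}^n$.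
   Formalization: In cases (1) and (2) the criterion also requires a_10 = a_20 and is read up to relabelling the terms of V_2 (their order, and replacing (k, λ) by (-k, conjugate of λ)); without this the printed equivalences fail, e.g. for V_2 = V_1 + 1 or V_2 = V_1 with permuted terms. *)

theory Defs
  imports "HOL-Analysis.Analysis" "HOL-Combinatorics.Permutations"
begin

definition integer_lattice :: "(real ^ 'n) set" where
  "integer_lattice = {k. \<forall>i. k $ i \<in> \<int>}"

text \<open>Functions on the torus are represented by lattice-periodic functions on the whole space.\<close>

definition lattice_periodic :: "(real ^ 'n \<Rightarrow> 'b) \<Rightarrow> bool" where
  "lattice_periodic f \<longleftrightarrow> (\<forall>x. \<forall>m\<in>integer_lattice. f (x + m) = f x)"

text \<open>The library predicate \<open>dependent\<close> speaks about sets, so it regards the pair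
  \<open>u\<close>, \<open>u\<close> with \<open>u \<noteq> 0\<close> as independent; hence dependence of a pair is spelled out here.\<close>

definition parallel :: "'a::real_vector \<Rightarrow> 'a \<Rightarrow> bool" where
  "parallel u w \<longleftrightarrow> (\<exists>a b :: real. (a \<noteq> 0 \<or> b \<noteq> 0) \<and> a *\<^sub>R u + b *\<^sub>R w = 0)"

definition C1_with_gradient ::
    "('a::euclidean_space \<Rightarrow> real) \<Rightarrow> ('a \<Rightarrow> 'a) \<Rightarrow> bool" where
  "C1_with_gradient \<phi> g \<longleftrightarrow>
     (\<forall>x. (\<phi> has_derivative (\<lambda>h. g x \<bullet> h)) (at x)) \<and> continuous_on UNIV g"

text \<open>Viscosity solutions of \<open>F(x, Dv(x)) = 0\<close> on the whole space.\<close>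

definition viscosity_subsolution ::
    "('a::euclidean_space \<Rightarrow> 'a \<Rightarrow> real) \<Rightarrow> ('a \<Rightarrow> real) \<Rightarrow> bool" where
  "viscosity_subsolution F v \<longleftrightarrow>
     (\<forall>\<phi> g x. C1_with_gradient \<phi> g \<and> (\<forall>\<^sub>F y in nhds x. v y - \<phi> y \<le> v x - \<phi> x)
        \<longrightarrow> F x (g x) \<le> 0)"

definition viscosity_supersolution ::
    "('a::euclidean_space \<Rightarrow> 'a \<Rightarrow> real) \<Rightarrow> ('a \<Rightarrow> real) \<Rightarrow> bool" where
  "viscosity_supersolution F v \<longleftrightarrow>
     (\<forall>\<phi> g x. C1_with_gradient \<phi> g \<and> (\<forall>\<^sub>F y in nhds x. v y - \<phi> y \<ge> v x - \<phi> x)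
        \<longrightarrow> F x (g x) \<ge> 0)"

definition viscosity_solution ::
    "('a::euclidean_space \<Rightarrow> 'a \<Rightarrow> real) \<Rightarrow> ('a \<Rightarrow> real) \<Rightarrow> bool" where
  "viscosity_solution F v \<longleftrightarrow>
     continuous_on UNIV v \<and> viscosity_subsolution F v \<and> viscosity_supersolution F v"

definition effective_hamiltonian :: "(real ^ 'n \<Rightarrow> real) \<Rightarrow> real ^ 'n \<Rightarrow> real" where
  "effective_hamiltonian V p =
     (THE \<mu>. \<exists>v. lattice_periodic v \<and>
        viscosity_solution (\<lambda>x q. (norm (p + q))\<^sup>2 / 2 + V x - \<mu>) v)"

text \<open>The three frequencies and coefficients are indexed by 1, 2, 3; values at other
  indices are irrelevant. The sum below is real (lemma \<open>of_real_trig_potential\<close>),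
  so taking its real part loses nothing.\<close>

definition trig_potential ::
    "real \<Rightarrow> (nat \<Rightarrow> complex) \<Rightarrow> (nat \<Rightarrow> real ^ 'n) \<Rightarrow> real ^ 'n \<Rightarrow> real" where
  "trig_potential a lam k x = a + Re (\<Sum>j = 1..3.
     lam j * exp (\<i> * of_real (2 * pi * (k j \<bullet> x))) +
     cnj (lam j) * exp (- \<i> * of_real (2 * pi * (k j \<bullet> x))))"

lemma of_real_trig_potential:
  "complex_of_real (trig_potential a lam k x) = of_real a + (\<Sum>j = 1..3.
     lam j * exp (\<i> * of_real (2 * pi * (k j \<bullet> x))) +
     cnj (lam j) * exp (- \<i> * of_real (2 * pi * (k j \<bullet> x))))"
  by (simp add: trig_potential_def complex_eq_iff exp_eq_polar cis.ctr Re_exp Im_exp algebra_simps)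

definition admissible_data ::
    "(nat \<Rightarrow> complex) \<Rightarrow> (nat \<Rightarrow> real ^ 'n) \<Rightarrow> bool" where
  "admissible_data lam k \<longleftrightarrow>
     (\<forall>j\<in>{1..3}. lam j \<noteq> 0 \<and> k j \<in> integer_lattice - {0}) \<and>
     (\<forall>i\<in>{1..3}. \<forall>j\<in>{1..3}. i \<noteq> j \<longrightarrow> \<not> parallel (k i) (k j))"

text \<open>A potential determines its list of terms only up to the order of the terms and up to
  swapping the two conjugate exponentials inside a term, which replaces \<open>(k, \<lambda>)\<close> by
  \<open>(- k, cnj \<lambda>)\<close>.\<close>

definition relabelling ::
    "(nat \<Rightarrow> complex) \<Rightarrow> (nat \<Rightarrow> real ^ 'n) \<Rightarrow> (nat \<Rightarrow> complex) \<Rightarrow> (nat \<Rightarrow> real ^ 'n) \<Rightarrow> bool" where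
  "relabelling lam k lam' k' \<longleftrightarrow> (\<exists>\<sigma>. \<sigma> permutes {1..3} \<and> (\<forall>j\<in>{1..3}.
     k' j = k (\<sigma> j) \<and> lam' j = lam (\<sigma> j) \<or>
     k' j = - k (\<sigma> j) \<and> lam' j = cnj (lam (\<sigma> j))))"

lemma trig_potential_relabelling:
  fixes k k' :: "nat \<Rightarrow> real ^ 'n"
  assumes "relabelling lam k lam' k'"
  shows "trig_potential a lam' k' = trig_potential a lam k"
proof
  fix x :: "real ^ 'n"
  let ?t = "\<lambda>(l :: complex) (q :: real ^ 'n). l * exp (\<i> * of_real (2 * pi * (q \<bullet> x))) +
     cnj l * exp (- \<i> * of_real (2 * pi * (q \<bullet> x)))"
  from assms obtain \<sigma> where \<sigma>: "\<sigma> permutes {1..3}" and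
    *: "\<forall>j\<in>{1..3}. k' j = k (\<sigma> j) \<and> lam' j = lam (\<sigma> j) \<or>
          k' j = - k (\<sigma> j) \<and> lam' j = cnj (lam (\<sigma> j))"
    unfolding relabelling_def by blast
  have "(\<Sum>j = 1..3. ?t (lam' j) (k' j)) = (\<Sum>j = 1..3. ?t (lam (\<sigma> j)) (k (\<sigma> j)))"
    by (rule sum.cong) (use * in fastforce)+
  also have "\<dots> = (\<Sum>j = 1..3. ?t (lam j) (k j))"
    using sum.permute[OF \<sigma>, of "\<lambda>j. ?t (lam j) (k j)"] by (simp add: o_def)
  finally show "trig_potential a lam' k' x = trig_potential a lam k x"
    by (simp add: trig_potential_def)
qed

definition mutually_orthogonal :: "(nat \<Rightarrow> real ^ 'n) \<Rightarrow> bool" where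
  "mutually_orthogonal k \<longleftrightarrow>
     (\<forall>i\<in>{1..3}. \<forall>j\<in>{1..3}. i \<noteq> j \<longrightarrow> orthogonal (k i) (k j))"

definition first_orthogonal_only :: "(nat \<Rightarrow> real ^ 'n) \<Rightarrow> bool" where
  "first_orthogonal_only k \<longleftrightarrow>
     orthogonal (k 1) (k 2) \<and> orthogonal (k 1) (k 3) \<and> \<not> orthogonal (k 2) (k 3)"

end

theory Submission
  imports Defs "HOL-Complex_Analysis.Great_Picard" "HOL-Real_Asymp.Real_Asymp"
begin

text \<open>Equality of two effective Hamiltonians \<open>H\<close> is exploited in two regimes only: at momenta tending to
infinity, and at momentum zero.

The constant of the cell problem is unique already among bounded solutions (\<open>comparison\<close>), so any
bounded \<open>C\<^sup>1\<close> function \<open>\<phi>\<close> encloses \<open>H p\<close> between the infimum and the supremum of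
\<open>(norm (p + D\<phi>))\<^sup>2 / 2 + V\<close>. Explicit trigonometric \<open>\<phi>\<close> therefore give the expansion of
\<open>H (t *\<^sub>R Q)\<close> as \<open>t\<close> tends to infinity. For a sum of waves \<open>A j * cos (k j \<bullet> x + \<theta> j)\<close> with
mean \<open>a\<close> it reads
\<open>t\<^sup>2 * (norm Q)\<^sup>2 / 2 + a + t powr (- 2) * (\<Sum>j. (A j)\<^sup>2 * (norm (k j))\<^sup>2 / (4 * (Q \<bullet> k j)\<^sup>2)) + O(t powr (- 4))\<close>,
provided that no two non-orthogonal frequencies resonate, that is, have
\<open>\<bar>Q \<bullet> k i\<bar> = \<bar>Q \<bullet> k j\<bar>\<close> (\<open>cell_value_nonresonant\<close>). The poles of the third coefficient, as a function
of \<open>Q\<close>, are the hyperplanes orthogonal to the frequencies, and the strength of a pole determines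
an amplitude. Hence \<open>H\<close> determines the mean, the directions of the frequencies and the amplitudes
(\<open>same_value_directions\<close>).

That coefficient does not see the lengths of the frequencies, but the resonances do. Where exactly
one pair resonates, the coefficient of \<open>t powr (- 2)\<close> is strictly larger than the sum above
(\<open>cell_value_resonant\<close>), so a momentum that is resonant for exactly one pair of one triple must be
resonant for the other triple (\<open>resonance_transfer\<close>). Orthogonal pairs have no resonances, and this
is where the three cases come from. Linearly independent frequencies have arbitrary inner products
with \<open>Q\<close>, and each non-orthogonal pair must be stretched by a common factor
(\<open>equal_ratio_independent\<close>). Coplanar frequencies obey one linear relation, and the claim
becomes elementary but delicate: which proportions of three numbers are detected by degenerate
triangles (\<open>ratio_rigidity_path\<close>, \<open>ratio_rigidity_triangle\<close>).

The phases are seen by \<open>H 0\<close>, which is the maximum of the potential. For independent frequencies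
they are removed by a translation. If \<open>n1 *\<^sub>R k1 + n2 *\<^sub>R k2 + n3 *\<^sub>R k3 = 0\<close> with coprime
integers, then, up to translation, they enter only through
\<open>\<Theta> = n1 * \<theta>1 + n2 * \<theta>2 + n3 * \<theta>3\<close> modulo \<open>2 * pi\<close>, and the maximum of the
potential is a strictly increasing function of \<open>cos \<Theta>\<close> (\<open>phase_cos_le\<close>). So \<open>\<Theta>\<close> is determined
up to sign, and the sign is the reflection of space, absorbed in the sign of the dilation factor.

Conversely, \<open>H\<close> is invariant under translations and dilations of the potential, a negative factor
being allowed because \<open>H\<close> is even (\<open>cell_value_even\<close>), and it is additive over potentials of
orthogonal sets of variables (\<open>cell_value_orthogonal_sum\<close>). A wave that is orthogonal to all others
may thus be dilated separately.\<close>

section \<open>Test functions and viscosity semisolutions\<close>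

lemma C1_with_gradientD:
  assumes "C1_with_gradient \<phi> g"
  shows "(\<phi> has_derivative (\<lambda>h. g x \<bullet> h)) (at x)" "continuous_on UNIV g" "continuous_on UNIV \<phi>"
  using assms unfolding C1_with_gradient_def
  by (auto intro!: continuous_at_imp_continuous_on has_derivative_continuous)

lemma C1_const: "C1_with_gradient (\<lambda>x::'a::euclidean_space. c) (\<lambda>x. 0)"
  using has_derivative_const[of c] unfolding C1_with_gradient_def by (simp add: inner_zero_left[abs_def])

lemma C1_inner: "C1_with_gradient (\<lambda>x::'a::euclidean_space. p \<bullet> x) (\<lambda>x. p)"
  unfolding C1_with_gradient_def by (auto intro!: derivative_eq_intros)

lemma C1_add:
  assumes "C1_with_gradient \<phi> g" "C1_with_gradient \<psi> h"
  shows "C1_with_gradient (\<lambda>x. \<phi> x + \<psi> x) (\<lambda>x. g x + h x)"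
  using assms unfolding C1_with_gradient_def
  by (auto intro!: derivative_eq_intros continuous_intros simp: inner_add_left)

lemma C1_scale:
  assumes "C1_with_gradient \<phi> g"
  shows "C1_with_gradient (\<lambda>x. c * \<phi> x) (\<lambda>x. c *\<^sub>R g x)"
  using assms unfolding C1_with_gradient_def
  by (auto intro!: derivative_eq_intros continuous_intros)

lemma C1_uminus:
  assumes "C1_with_gradient \<phi> g"
  shows "C1_with_gradient (\<lambda>x. - \<phi> x) (\<lambda>x. - g x)"
  using C1_scale[OF assms, of "-1"] by simp

lemma C1_diff:
  assumes "C1_with_gradient \<phi> g" "C1_with_gradient \<psi> h"
  shows "C1_with_gradient (\<lambda>x. \<phi> x - \<psi> x) (\<lambda>x. g x - h x)"
  using C1_add[OF assms(1) C1_uminus[OF assms(2)]] by simp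

lemma C1_mult:
  assumes "C1_with_gradient \<phi> g" "C1_with_gradient \<psi> h"
  shows "C1_with_gradient (\<lambda>x. \<phi> x * \<psi> x) (\<lambda>x. \<phi> x *\<^sub>R h x + \<psi> x *\<^sub>R g x)"
  unfolding C1_with_gradient_def
proof (intro conjI allI)
  fix x
  show "((\<lambda>x. \<phi> x * \<psi> x) has_derivative (\<lambda>k. (\<phi> x *\<^sub>R h x + \<psi> x *\<^sub>R g x) \<bullet> k)) (at x)"
    by (rule has_derivative_eq_rhs[OF has_derivative_mult[OF C1_with_gradientD(1)[OF assms(1)]
          C1_with_gradientD(1)[OF assms(2)]]]) (simp add: inner_add_left mult.commute)
  show "continuous_on UNIV (\<lambda>x. \<phi> x *\<^sub>R h x + \<psi> x *\<^sub>R g x)"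
    using assms by (intro continuous_intros C1_with_gradientD)
qed

lemma C1_compose:
  assumes "C1_with_gradient \<phi> g" and f: "\<And>t. (f has_real_derivative f' t) (at t)" "continuous_on UNIV f'"
  shows "C1_with_gradient (\<lambda>x. f (\<phi> x)) (\<lambda>x. f' (\<phi> x) *\<^sub>R g x)"
  unfolding C1_with_gradient_def
proof (intro conjI allI)
  fix x
  have "(f has_derivative (\<lambda>k. f' (\<phi> x) * k)) (at (\<phi> x))"
    using f(1) by (simp add: has_field_derivative_def)
  from has_derivative_compose[OF C1_with_gradientD(1)[OF assms(1), of x] this]
  show "((\<lambda>x. f (\<phi> x)) has_derivative (\<lambda>k. (f' (\<phi> x) *\<^sub>R g x) \<bullet> k)) (at x)" by simp
  show "continuous_on UNIV (\<lambda>x. f' (\<phi> x) *\<^sub>R g x)"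
    by (intro continuous_intros C1_with_gradientD(2)[OF assms(1)]
      continuous_on_compose2[OF f(2) C1_with_gradientD(3)[OF assms(1)]]) auto
qed

lemma C1_affine:
  assumes "C1_with_gradient \<phi> g" and A: "linear A" and A': "linear A'"
    and adj: "\<And>x y. A x \<bullet> y = x \<bullet> A' y"
  shows "C1_with_gradient (\<lambda>x. \<phi> (A x + b)) (\<lambda>x. A' (g (A x + b)))"
  unfolding C1_with_gradient_def
proof (intro conjI allI)
  fix x
  have "((\<lambda>x. A x + b) has_derivative A) (at x)"
    using A by (auto intro!: derivative_eq_intros linear_imp_has_derivative)
  from has_derivative_compose[OF this C1_with_gradientD(1)[OF assms(1)]]
  show "((\<lambda>x. \<phi> (A x + b)) has_derivative (\<lambda>k. A' (g (A x + b)) \<bullet> k)) (at x)"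
    by (simp add: adj[symmetric] inner_commute)
  have "continuous_on UNIV (\<lambda>x. g (A x + b))"
    by (rule continuous_on_compose2[OF C1_with_gradientD(2)[OF assms(1)]])
      (auto intro!: continuous_intros linear_continuous_on_compose[OF _ A])
  then show "continuous_on UNIV (\<lambda>x. A' (g (A x + b)))"
    using linear_continuous_on_compose[OF _ A'] by blast
qed

lemma C1_sqdist: "C1_with_gradient (\<lambda>x::'a::euclidean_space. (norm (x - z))\<^sup>2) (\<lambda>x. 2 *\<^sub>R (x - z))"
  unfolding C1_with_gradient_def power2_norm_eq_inner
  by (auto intro!: derivative_eq_intros continuous_intros simp: inner_commute algebra_simps)

lemma C1_smooth_dist:
  assumes "\<eta> > 0"
  shows "C1_with_gradient (\<lambda>x::'a::euclidean_space. sqrt ((norm (x - z))\<^sup>2 + \<eta>))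
    (\<lambda>x. (1 / sqrt ((norm (x - z))\<^sup>2 + \<eta>)) *\<^sub>R (x - z))"
proof -
  have pos: "(norm (x - z))\<^sup>2 + \<eta> > 0" for x :: 'a
    using assms by (simp add: add_nonneg_pos)
  have d: "((\<lambda>x. (norm (x - z))\<^sup>2) has_derivative (\<lambda>h. (2 *\<^sub>R (x - z)) \<bullet> h)) (at x)" for x :: 'a
    by (rule C1_with_gradientD(1)[OF C1_sqdist])
  show ?thesis
    unfolding C1_with_gradient_def
  proof (intro conjI allI)
    fix x :: 'a
    show "((\<lambda>x. sqrt ((norm (x - z))\<^sup>2 + \<eta>)) has_derivative
        (\<lambda>h. ((1 / sqrt ((norm (x - z))\<^sup>2 + \<eta>)) *\<^sub>R (x - z)) \<bullet> h)) (at x)"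
      by (rule has_derivative_eq_rhs[OF has_derivative_compose[OF has_derivative_add[OF d has_derivative_const]
            DERIV_real_sqrt[OF pos[of x], unfolded has_field_derivative_def]]])
        (simp add: fun_eq_iff inner_diff_left divide_simps del: scaleR_diff_right) 
    show "continuous_on UNIV (\<lambda>x. (1 / sqrt ((norm (x - z))\<^sup>2 + \<eta>)) *\<^sub>R (x - z))"
      using pos by (intro continuous_intros) (metis less_irrefl real_sqrt_eq_zero_cancel_iff)
  qed
qed

lemma gradient_eq_at_touching:
  assumes "C1_with_gradient \<phi> g" "C1_with_gradient \<psi> h"
    and "\<forall>\<^sub>F y in nhds x. \<phi> y - \<psi> y \<le> \<phi> x - \<psi> x"
  shows "g x = h x"
proof -
  have d: "((\<lambda>y. \<phi> y - \<psi> y) has_derivative (\<lambda>k. (g x - h x) \<bullet> k)) (at x)"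
    using C1_with_gradientD(1)[OF C1_diff[OF assms(1,2)]] .
  obtain e where "e > 0" "\<And>y. dist y x < e \<Longrightarrow> \<phi> y - \<psi> y \<le> \<phi> x - \<psi> x"
    using assms(3) unfolding eventually_nhds_metric by blast
  then have "(\<lambda>k. (g x - h x) \<bullet> k) = (\<lambda>k. 0)"
    using differential_zero_maxmin[of x "ball x e" "\<lambda>y. \<phi> y - \<psi> y", OF _ _ d]
    by (auto simp: dist_commute)
  then have "(g x - h x) \<bullet> (g x - h x) = 0" by metis
  then show ?thesis by simp
qed

lemma subsolutionD:
  assumes "viscosity_subsolution F v" "C1_with_gradient \<phi> g"
    "\<forall>\<^sub>F y in nhds x. v y - \<phi> y \<le> v x - \<phi> x"
  shows "F x (g x) \<le> 0"
  using assms unfolding viscosity_subsolution_def by blast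

lemma supersolutionD:
  assumes "viscosity_supersolution F v" "C1_with_gradient \<phi> g"
    "\<forall>\<^sub>F y in nhds x. v y - \<phi> y \<ge> v x - \<phi> x"
  shows "F x (g x) \<ge> 0"
  using assms unfolding viscosity_supersolution_def by blast

text \<open>Statements about supersolutions are deduced from those about subsolutions by this reflection.\<close>

lemma supersolution_iff_subsolution_uminus:
  "viscosity_supersolution F v \<longleftrightarrow> viscosity_subsolution (\<lambda>x q. - F x (- q)) (\<lambda>x. - v x)"
proof
  assume L: "viscosity_supersolution F v"
  show "viscosity_subsolution (\<lambda>x q. - F x (- q)) (\<lambda>x. - v x)"
    unfolding viscosity_subsolution_def
  proof (intro allI impI, elim conjE)
    fix \<phi> g x
    assume "C1_with_gradient \<phi> g" "\<forall>\<^sub>F y in nhds x. - v y - \<phi> y \<le> - v x - \<phi> x"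
    then show "- F x (- g x) \<le> 0"
      using supersolutionD[OF L C1_uminus, of \<phi> g x] by (simp add: algebra_simps)
  qed
next
  assume R: "viscosity_subsolution (\<lambda>x q. - F x (- q)) (\<lambda>x. - v x)"
  show "viscosity_supersolution F v"
    unfolding viscosity_supersolution_def
  proof (intro allI impI, elim conjE)
    fix \<phi> g x
    assume "C1_with_gradient \<phi> g" "\<forall>\<^sub>F y in nhds x. v y - \<phi> y \<ge> v x - \<phi> x"
    then show "F x (g x) \<ge> 0"
      using subsolutionD[OF R C1_uminus, of \<phi> g x] by (simp add: algebra_simps)
  qed
qed

lemma subsolution_of_C1:
  assumes "C1_with_gradient v h" "\<And>x. F x (h x) \<le> 0"
  shows "viscosity_subsolution F v"
  unfolding viscosity_subsolution_def
  using gradient_eq_at_touching[OF assms(1)] assms(2) by metis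

lemma supersolution_of_C1:
  assumes "C1_with_gradient v h" "\<And>x. F x (h x) \<ge> 0"
  shows "viscosity_supersolution F v"
  unfolding supersolution_iff_subsolution_uminus
  using assms by (intro subsolution_of_C1[OF C1_uminus]) auto

section \<open>Gradient bounds and stability\<close>

text \<open>The cone \<open>M' * norm (z - x) + L * (norm (z - x))\<^sup>2\<close> with \<open>M' > M\<close>, smoothed at its vertex, is a barrier:
away from \<open>x\<close> its gradient is longer than \<open>M\<close>, so it cannot touch \<open>v\<close> from above there, and
\<open>L = D / R\<^sup>2\<close> is large enough to keep the point of touching off the boundary of the ball.\<close>

lemma cone_bound:
  fixes v :: "'a::euclidean_space \<Rightarrow> real"
  assumes cont: "continuous_on UNIV v" and R: "R > 0" and M: "M \<ge> 0"
    and grad: "\<And>\<phi> g y. C1_with_gradient \<phi> g \<Longrightarrow> y \<in> ball x R \<Longrightarrow>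
      \<forall>\<^sub>F z in nhds y. v z - \<phi> z \<le> v y - \<phi> y \<Longrightarrow> norm (g y) \<le> M"
    and osc: "\<And>y. y \<in> cball x R \<Longrightarrow> v y - v x \<le> D"
    and y: "y \<in> cball x R"
  shows "v y - v x \<le> M * norm (y - x) + D / R\<^sup>2 * (norm (y - x))\<^sup>2"
proof (rule ccontr)
  define L where "L = D / R\<^sup>2"
  have D0: "D \<ge> 0" using osc[of x] R by simp
  have L0: "L \<ge> 0" unfolding L_def using D0 by simp
  assume "\<not> ?thesis"
  then have gap: "v y - v x - M * norm (y - x) - L * (norm (y - x))\<^sup>2 > 0" by (simp add: L_def)
  \<comment> \<open>If the estimate fails, there is room for a slope \<open>M'\<close> above \<open>M\<close> and a remaining gap \<open>\<delta>\<close>.\<close>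
  define e where "e = (v y - v x - M * norm (y - x) - L * (norm (y - x))\<^sup>2) / (2 * (norm (y - x) + 1))"
  define M' where "M' = M + e"
  define \<delta> where "\<delta> = v y - v x - M' * norm (y - x) - L * (norm (y - x))\<^sup>2"
  have e: "e > 0" unfolding e_def using gap by (intro divide_pos_pos) (auto simp: add_nonneg_pos)
  have "2 * (norm (y - x) + 1) * e = v y - v x - M * norm (y - x) - L * (norm (y - x))\<^sup>2"
    unfolding e_def by (smt (verit) nonzero_mult_div_cancel_left norm_ge_zero times_divide_eq_right)
  then have "\<delta> = (norm (y - x) + 2) * e" unfolding \<delta>_def M'_def by (simp add: algebra_simps)
  then have \<delta>: "\<delta> > 0" using e by (simp add: add_nonneg_pos)
  have M': "M' > 0" "M' > M" using M e by (auto simp: M'_def)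
  have "isCont v x" using cont continuous_on_eq_continuous_at by blast
  then obtain r where r: "r > 0" "\<And>z. dist z x < r \<Longrightarrow> \<bar>v z - v x\<bar> < \<delta> / 2"
    using \<delta> unfolding continuous_at_eps_delta dist_real_def by (metis half_gt_zero)
  \<comment> \<open>The smoothing \<open>\<eta>\<close> costs at most \<open>\<delta> / 2\<close>, and at distance \<open>r\<close> from the vertex it does not bring the slope down to \<open>M\<close>.\<close>
  define \<eta> where "\<eta> = min (\<delta> / (2 * M')) ((M' - M) * r / (2 * (M + 1)))"
  have \<eta>: "\<eta> > 0" using \<delta> M' M r by (auto simp: \<eta>_def)
  have \<eta>1: "M' * \<eta> \<le> \<delta> / 2"
  proof -
    have "M' * \<eta> \<le> M' * (\<delta> / (2 * M'))" using M' by (intro mult_left_mono) (auto simp: \<eta>_def)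
    then show ?thesis using M' by simp
  qed
  have \<eta>2: "M * \<eta> < (M' - M) * r"
  proof -
    have "M * \<eta> \<le> (M + 1) * ((M' - M) * r / (2 * (M + 1)))"
      using M \<eta> by (intro mult_mono) (auto simp: \<eta>_def)
    also have "\<dots> = (M' - M) * r / 2"
    proof -
      have "M + 1 \<noteq> 0" using M by simp
      then show ?thesis by (simp add: divide_simps)
    qed
    also have "\<dots> < (M' - M) * r" using M' r by simp
    finally show ?thesis .
  qed
  define \<phi> where "\<phi> = (\<lambda>z. M' * sqrt ((norm (z - x))\<^sup>2 + \<eta>\<^sup>2) + L * (norm (z - x))\<^sup>2)"
  define g where "g = (\<lambda>z. M' *\<^sub>R ((1 / sqrt ((norm (z - x))\<^sup>2 + \<eta>\<^sup>2)) *\<^sub>R (z - x)) + L *\<^sub>R (2 *\<^sub>R (z - x)))"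
  have C1: "C1_with_gradient \<phi> g"
    unfolding \<phi>_def g_def using \<eta>
    by (intro C1_add C1_scale C1_smooth_dist C1_sqdist) auto
  have "continuous_on (cball x R) (\<lambda>z. v z - \<phi> z)"
    using cont C1_with_gradientD(3)[OF C1] by (auto intro!: continuous_intros elim: continuous_on_subset)
  then obtain z where z: "z \<in> cball x R" "\<And>w. w \<in> cball x R \<Longrightarrow> v w - \<phi> w \<le> v z - \<phi> z"
    using continuous_attains_sup[of "cball x R" "\<lambda>z. v z - \<phi> z"] R by auto
  have sq1: "sqrt ((norm (w - x))\<^sup>2 + \<eta>\<^sup>2) \<le> norm (w - x) + \<eta>" for w
    using sqrt_sum_squares_le_sum[of "norm (w - x)" \<eta>] \<eta> by simp
  have sq2: "norm (w - x) \<le> sqrt ((norm (w - x))\<^sup>2 + \<eta>\<^sup>2)" for w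
    by simp
  have "\<phi> y \<le> M' * norm (y - x) + M' * \<eta> + L * (norm (y - x))\<^sup>2"
    using mult_left_mono[OF sq1[of y], of M'] M' by (simp add: \<phi>_def algebra_simps)
  then have "v y - \<phi> y \<ge> v x + \<delta> / 2"
    using \<eta>1 \<delta>_def by linarith
  then have big: "v z - \<phi> z \<ge> v x + \<delta> / 2" using z(2)[OF y] by linarith
  have \<phi>low: "\<phi> w \<ge> M' * norm (w - x) + L * (norm (w - x))\<^sup>2" for w
    using mult_left_mono[OF sq2[of w], of M'] M' by (simp add: \<phi>_def)
  have \<phi>0: "\<phi> z \<ge> 0" using \<phi>low[of z] M' L0 by (smt (verit) mult_nonneg_nonneg norm_ge_zero zero_le_power2)
  have far: "norm (z - x) \<ge> r"
  proof (rule ccontr)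
    assume "\<not> ?thesis"
    then have "\<bar>v z - v x\<bar> < \<delta> / 2" using r(2)[of z] by (simp add: dist_norm)
    then show False using big \<phi>0 by linarith
  qed
  have inside: "z \<in> ball x R"
  proof (rule ccontr)
    assume "\<not> ?thesis"
    then have n: "norm (z - x) = R" using z(1) by (auto simp: dist_norm norm_minus_commute)
    have "\<phi> z \<ge> M' * R + D" using \<phi>low[of z] R unfolding n by (simp add: L_def)
    moreover have "M' * R > 0" using M' R by simp
    ultimately show False using osc[OF z(1)] big \<delta> by linarith
  qed
  have "\<forall>\<^sub>F w in nhds z. v w - \<phi> w \<le> v z - \<phi> z"
  proof (rule eventually_nhds_in_open[THEN eventually_mono])
    show "open (ball x R)" "z \<in> ball x R" using inside by auto
  qed (use z(2) in auto)
  from grad[OF C1 inside this] have le: "norm (g z) \<le> M" .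
  define s where "s = sqrt ((norm (z - x))\<^sup>2 + \<eta>\<^sup>2)"
  have s: "s > 0" unfolding s_def using \<eta> by (simp add: add_nonneg_pos)
  have "g z = (M' / s + 2 * L) *\<^sub>R (z - x)"
    unfolding g_def s_def by (simp add: scaleR_add_left)
  then have "norm (g z) = (M' / s + 2 * L) * norm (z - x)"
    using M' s L0 by simp
  also have "\<dots> \<ge> M' / s * norm (z - x)"
    using L0 by (simp add: distrib_right)
  finally have "M' * norm (z - x) / s \<le> M" using le by simp
  then have "M' * norm (z - x) \<le> M * s" using s by (simp add: pos_divide_le_eq)
  also have "\<dots> \<le> M * norm (z - x) + M * \<eta>"
    using mult_left_mono[OF sq1[of z] M] by (simp add: s_def algebra_simps)
  finally have "(M' - M) * norm (z - x) \<le> M * \<eta>" by (simp add: algebra_simps)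
  moreover have "(M' - M) * r \<le> (M' - M) * norm (z - x)"
    using M' far by (intro mult_left_mono) auto
  ultimately show False using \<eta>2 by linarith
qed

text \<open>For a bounded function the quadratic term of the cone estimate disappears as the radius tends to infinity.\<close>

lemma lipschitz_of_gradient_bound:
  fixes v :: "'a::euclidean_space \<Rightarrow> real"
  assumes cont: "continuous_on UNIV v" and bd: "bounded (range v)" and M: "M \<ge> 0"
    and grad: "\<And>\<phi> g y. C1_with_gradient \<phi> g \<Longrightarrow>
      \<forall>\<^sub>F z in nhds y. v z - \<phi> z \<le> v y - \<phi> y \<Longrightarrow> norm (g y) \<le> M"
  shows "\<bar>v y - v x\<bar> \<le> M * norm (y - x)"
proof -
  obtain B where B: "\<And>z. \<bar>v z\<bar> \<le> B" using bd by (auto simp: bounded_iff)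
  have "v b - v a \<le> M * norm (b - a)" for a b
  proof (rule tendsto_lowerbound)
    show "((\<lambda>R. M * norm (b - a) + 2 * B / R\<^sup>2 * (norm (b - a))\<^sup>2) \<longlongrightarrow> M * norm (b - a)) at_top"
      by real_asymp
    show "\<forall>\<^sub>F R in at_top. v b - v a \<le> M * norm (b - a) + 2 * B / R\<^sup>2 * (norm (b - a))\<^sup>2"
      using eventually_gt_at_top[of 0] eventually_ge_at_top[of "norm (b - a)"]
    proof eventually_elim
      case (elim R)
      have *: "v y - v a \<le> 2 * B" for y using B[of y] B[of a] by (simp add: abs_le_iff)
      show ?case
        by (rule cone_bound[OF cont _ M, of R]) (use elim grad * in \<open>auto simp: dist_norm norm_minus_commute\<close>)
    qed
  qed simp
  from this[of y x] this[of x y] show ?thesis by (simp add: norm_minus_commute abs_le_iff)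
qed

text \<open>Adding \<open>(norm (y - x))\<^sup>2\<close> to a test function makes the touching strict, so an approximation \<open>v\<close> of \<open>w\<close> is
touched close to \<open>x\<close>. The approximation may depend on \<open>x\<close>; this covers suprema of families as
well as uniform limits. The error \<open>K * dist y x\<close> is the one made by a discount term when the functions are Lipschitz.\<close>

lemma subsolution_stable:
  fixes w :: "'a::euclidean_space \<Rightarrow> real"
  assumes contF: "continuous_on UNIV (\<lambda>(x, q). F x q)" and K: "K \<ge> 0"
    and approx: "\<And>x \<delta>. \<delta> > 0 \<Longrightarrow> \<exists>v F'. continuous_on UNIV v \<and> viscosity_subsolution F' v \<and>
       w x - \<delta> \<le> v x \<and> (\<forall>y. v y \<le> w y + \<delta>) \<and> (\<forall>y q. F y q \<le> F' y q + \<delta> + K * dist y x)"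
  shows "viscosity_subsolution F w"
  unfolding viscosity_subsolution_def
proof (intro allI impI, elim conjE)
  fix \<phi> g x
  assume C1: "C1_with_gradient \<phi> g" and touch: "\<forall>\<^sub>F y in nhds x. w y - \<phi> y \<le> w x - \<phi> x"
  show "F x (g x) \<le> 0"
  proof (rule ccontr)
    assume "\<not> ?thesis"
    then have pos: "F x (g x) > 0" by simp
    define \<kappa> where "\<kappa> = F x (g x) / 3"
    have \<kappa>: "\<kappa> > 0" using pos by (simp add: \<kappa>_def)
    obtain r where r: "r > 0" "\<And>y. dist y x < r \<Longrightarrow> w y - \<phi> y \<le> w x - \<phi> x"
      using touch unfolding eventually_nhds_metric by blast
    have "continuous_on UNIV (\<lambda>y. g y + 2 *\<^sub>R (y - x))"
      using C1_with_gradientD(2)[OF C1] by (intro continuous_intros)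
    from continuous_on_compose2[OF contF continuous_on_Pair[OF continuous_on_id this]]
    have "isCont (\<lambda>y. F y (g y + 2 *\<^sub>R (y - x))) x"
      by (simp add: continuous_on_eq_continuous_at)
    then obtain d where d: "d > 0"
      "\<And>y. dist y x < d \<Longrightarrow> \<bar>F y (g y + 2 *\<^sub>R (y - x)) - F x (g x)\<bar> < \<kappa>"
      using \<kappa> unfolding continuous_at_eps_delta dist_real_def by fastforce
    define \<rho> where "\<rho> = min (min (r / 2) (d / 2)) (min 1 (\<kappa> / (2 * (K + 1))))"
    define \<delta> where "\<delta> = min (\<rho>\<^sup>2 / 4) (\<kappa> / 4)"
    have \<rho>: "\<rho> > 0" "\<rho> < r" "\<rho> < d" "K * \<rho> \<le> \<kappa> / 2"
    proof -
      show "\<rho> > 0" "\<rho> < r" "\<rho> < d" using r d \<kappa> K by (auto simp: \<rho>_def)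
      have "K * \<rho> \<le> (K + 1) * (\<kappa> / (2 * (K + 1)))" using K r d \<kappa> by (intro mult_mono) (auto simp: \<rho>_def)
      also have "\<dots> = \<kappa> / 2" using K by (simp add: divide_simps)
      finally show "K * \<rho> \<le> \<kappa> / 2" .
    qed
    have \<delta>: "\<delta> > 0" "\<delta> \<le> \<kappa> / 4" "4 * \<delta> \<le> \<rho>\<^sup>2" using \<rho> \<kappa> by (auto simp: \<delta>_def)
    from approx[OF \<delta>(1), of x] obtain v F' where v: "continuous_on UNIV v" "viscosity_subsolution F' v"
       "w x - \<delta> \<le> v x" "\<And>y. v y \<le> w y + \<delta>" "\<And>y q. F y q \<le> F' y q + \<delta> + K * dist y x"
      by blast
    define \<psi> where "\<psi> = (\<lambda>y. \<phi> y + (norm (y - x))\<^sup>2)"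
    define h where "h = (\<lambda>y. g y + 2 *\<^sub>R (y - x))"
    have C1': "C1_with_gradient \<psi> h" unfolding \<psi>_def h_def by (intro C1_add C1 C1_sqdist)
    have "continuous_on (cball x \<rho>) (\<lambda>z. v z - \<psi> z)"
      using v(1) C1_with_gradientD(3)[OF C1'] by (auto intro!: continuous_intros elim: continuous_on_subset)
    then obtain y where y: "y \<in> cball x \<rho>" "\<And>z. z \<in> cball x \<rho> \<Longrightarrow> v z - \<psi> z \<le> v y - \<psi> y"
      using continuous_attains_sup[of "cball x \<rho>" "\<lambda>z. v z - \<psi> z"] \<rho> by auto
    have yr: "dist y x < r" "dist y x < d" "dist y x \<le> \<rho>" using y(1) \<rho> by (auto simp: dist_commute)
    have "v x - \<psi> x \<le> v y - \<psi> y" using y(2)[of x] \<rho> by simp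
    then have "w x - \<phi> x - \<delta> \<le> w y + \<delta> - \<phi> y - (norm (y - x))\<^sup>2"
      using v(3) v(4)[of y] by (simp add: \<psi>_def)
    then have "(norm (y - x))\<^sup>2 \<le> 2 * \<delta>" using r(2)[OF yr(1)] by linarith
    also have "\<dots> < \<rho>\<^sup>2" using \<delta> by linarith
    finally have "norm (y - x) < \<rho>" using \<rho>(1) by (simp add: power2_less_imp_less)
    then have yin: "y \<in> ball x \<rho>" by (simp add: dist_norm norm_minus_commute)
    have "\<forall>\<^sub>F z in nhds y. v z - \<psi> z \<le> v y - \<psi> y"
    proof (rule eventually_nhds_in_open[THEN eventually_mono])
      show "open (ball x \<rho>)" "y \<in> ball x \<rho>" using yin by auto
    qed (use y(2) in auto)
    from subsolutionD[OF v(2) C1' this] have "F' y (h y) \<le> 0" .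
    then have "F y (h y) \<le> \<delta> + K * dist y x" using v(5)[of y "h y"] by linarith
    also have "K * dist y x \<le> K * \<rho>" using yr K by (intro mult_left_mono) auto
    finally have "F y (h y) \<le> \<kappa> / 4 + \<kappa> / 2" using \<delta> \<rho> by linarith
    moreover have "F y (h y) > 2 * \<kappa>" using d(2)[OF yr(2)] \<kappa> unfolding h_def \<kappa>_def by linarith
    ultimately show False using \<kappa> by linarith
  qed
qed

lemma supersolution_stable:
  fixes w :: "'a::euclidean_space \<Rightarrow> real"
  assumes contF: "continuous_on UNIV (\<lambda>(x, q). F x q)" and K: "K \<ge> 0"
    and approx: "\<And>x \<delta>. \<delta> > 0 \<Longrightarrow> \<exists>v F'. continuous_on UNIV v \<and> viscosity_supersolution F' v \<and>
       v x \<le> w x + \<delta> \<and> (\<forall>y. w y - \<delta> \<le> v y) \<and> (\<forall>y q. F' y q - \<delta> - K * dist y x \<le> F y q)"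
  shows "viscosity_supersolution F w"
  unfolding supersolution_iff_subsolution_uminus
proof (rule subsolution_stable[OF _ K])
  have "continuous_on UNIV (\<lambda>z. (\<lambda>(x, q). F x q) (fst z, - snd z))"
    by (intro continuous_on_compose2[OF contF] continuous_intros) auto
  then show "continuous_on UNIV (\<lambda>(x, q). - F x (- q))"
    by (simp add: case_prod_unfold continuous_on_minus)
  fix x and \<delta> :: real assume "\<delta> > 0"
  from approx[OF this, of x] obtain v F' where v: "continuous_on UNIV v" "viscosity_supersolution F' v"
       "v x \<le> w x + \<delta>" "\<And>y. w y - \<delta> \<le> v y" "\<And>y q. F' y q - \<delta> - K * dist y x \<le> F y q"
    by blast
  show "\<exists>v F'. continuous_on UNIV v \<and> viscosity_subsolution F' v \<and> - w x - \<delta> \<le> v x \<and>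
      (\<forall>y. v y \<le> - w y + \<delta>) \<and> (\<forall>y q. - F y (- q) \<le> F' y q + \<delta> + K * dist y x)"
  proof (intro exI conjI allI)
    show "continuous_on UNIV (\<lambda>x. - v x)" using v(1) by (intro continuous_intros)
    show "viscosity_subsolution (\<lambda>x q. - F' x (- q)) (\<lambda>x. - v x)"
      using v(2) unfolding supersolution_iff_subsolution_uminus .
    show "- w x - \<delta> \<le> - v x" using v(3) by simp
    show "- v y \<le> - w y + \<delta>" for y using v(4)[of y] by simp
    show "- F y (- q) \<le> - F' y (- q) + \<delta> + K * dist y x" for y q using v(5)[of y "- q"] by linarith
  qed
qed

section \<open>Comparison for the cell problem\<close>

abbreviation cell :: "('a::euclidean_space \<Rightarrow> real) \<Rightarrow> 'a \<Rightarrow> real \<Rightarrow> 'a \<Rightarrow> 'a \<Rightarrow> real" where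
  "cell V p \<mu> \<equiv> (\<lambda>x q. (norm (p + q))\<^sup>2 / 2 + V x - \<mu>)"

text \<open>Bounded and uniformly continuous: the regularity of the potential on which comparison rests.\<close>

definition buc :: "('a::euclidean_space \<Rightarrow> real) \<Rightarrow> bool" where
  "buc V \<longleftrightarrow> bounded (range V) \<and> uniformly_continuous_on UNIV V"

text \<open>Boundedness takes the place of periodicity. The constant remains unique, and bounded functions that
are not periodic become admissible for comparison.\<close>

definition cell_value :: "('a::euclidean_space \<Rightarrow> real) \<Rightarrow> 'a \<Rightarrow> real \<Rightarrow> bool" where
  "cell_value V p \<mu> \<longleftrightarrow> (\<exists>v. bounded (range v) \<and> viscosity_solution (cell V p \<mu>) v)"

lemma bucD:
  assumes "buc V"
  shows "bounded (range V)" "uniformly_continuous_on UNIV V" "continuous_on UNIV V"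
  using assms by (auto simp: buc_def uniformly_continuous_imp_continuous)

lemma buc_boundE:
  assumes "buc V"
  obtains B where "B > 0" "\<And>x. \<bar>V x\<bar> \<le> B"
  using assms unfolding buc_def bounded_pos by auto

lemma continuous_attains_global_sup:
  fixes f :: "'b::euclidean_space \<Rightarrow> real"
  assumes "continuous_on UNIV f" "bounded {z. f z \<ge> f a}"
  obtains z where "\<And>y. f y \<le> f z"
proof -
  have "closed {z. f z \<ge> f a}" using assms(1) by (intro closed_Collect_le) auto
  then have "compact {z. f z \<ge> f a}" using assms(2) compact_eq_bounded_closed by blast
  moreover have "a \<in> {z. f z \<ge> f a}" by simp
  moreover have "continuous_on {z. f z \<ge> f a} f" using assms(1) continuous_on_subset by blast
  ultimately obtain z where "f z \<ge> f a" "\<forall>y\<in>{z. f z \<ge> f a}. f y \<le> f z"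
    using continuous_attains_sup[of "{z. f z \<ge> f a}" f] by blast
  then have "f y \<le> f z" for y by (cases "f y \<ge> f a") auto
  then show ?thesis using that by blast
qed

text \<open>Doubling of variables. At a maximum point of
\<open>v1 x - v2 y - (norm (x - y))\<^sup>2 / (2 * \<eta>) - \<kappa> * sqrt ((norm x)\<^sup>2 + 1)\<close> the two equations are tested with
gradients \<open>q + \<kappa> *\<^sub>R r\<close> and \<open>q\<close>. The last term, whose gradient has length at most \<open>\<kappa>\<close>, provides the
maximum on the non-compact space. The kinetic energy bounds \<open>q\<close> independently of \<open>\<eta>\<close>, so
\<open>norm (x - y) = \<eta> * norm q\<close> is small and the two values of the potential differ little.\<close>

lemma comparison:
  fixes V :: "'a::euclidean_space \<Rightarrow> real"
  assumes V: "buc V"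
    and v1: "continuous_on UNIV v1" "bounded (range v1)" "viscosity_subsolution (cell V p \<mu>1) v1"
    and v2: "continuous_on UNIV v2" "bounded (range v2)" "viscosity_supersolution (cell V p \<mu>2) v2"
  shows "\<mu>2 \<le> \<mu>1"
proof (rule ccontr)
  assume less: "\<not> \<mu>2 \<le> \<mu>1"
  define \<gamma> where "\<gamma> = \<mu>2 - \<mu>1"
  have \<gamma>: "\<gamma> > 0" using less by (simp add: \<gamma>_def)
  obtain B where B: "B > 0" "\<And>x. \<bar>V x\<bar> \<le> B" using buc_boundE[OF V] by blast
  obtain B1 where B1: "\<And>x. \<bar>v1 x\<bar> \<le> B1" using v1(2) by (auto simp: bounded_iff)
  obtain B2 where B2: "\<And>x. \<bar>v2 x\<bar> \<le> B2" using v2(2) by (auto simp: bounded_iff)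
  \<comment> \<open>\<open>P\<close> bounds \<open>norm (p + Dv1)\<close>, and \<open>\<kappa>\<close> is small enough to change the kinetic energy by at most \<open>\<gamma> / 8\<close>.\<close>
  define P where "P = sqrt (2 * (\<bar>\<mu>1\<bar> + B))"
  have P: "P \<ge> 0" using B by (simp add: P_def)
  have P2: "P\<^sup>2 = 2 * \<bar>\<mu>1\<bar> + 2 * B" using B by (simp add: P_def)
  define \<kappa> where "\<kappa> = min 1 (\<gamma> / (8 * (P + 1)))"
  have \<kappa>: "\<kappa> > 0" "\<kappa> \<le> 1" using \<gamma> P by (auto simp: \<kappa>_def)
  have \<kappa>P: "(P + 1) * \<kappa> \<le> \<gamma> / 8"
  proof -
    have "(P + 1) * \<kappa> \<le> (P + 1) * (\<gamma> / (8 * (P + 1)))" using P by (intro mult_left_mono) (auto simp: \<kappa>_def)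
    also have "\<dots> = \<gamma> / 8" using P by (simp add: divide_simps)
    finally show ?thesis .
  qed
  obtain d where d: "d > 0" "\<And>x y. dist y x < d \<Longrightarrow> dist (V y) (V x) < \<gamma> / 4"
    using bucD(2)[OF V, unfolded uniformly_continuous_on_def, rule_format, of "\<gamma> / 4"] \<gamma> by auto
  \<comment> \<open>\<open>L\<close> bounds \<open>q\<close>; then \<open>\<eta>\<close> puts the two points within the distance \<open>d\<close> on which the potential varies by less than \<open>\<gamma> / 4\<close>.\<close>
  define L where "L = P + norm p + 1"
  have L: "L \<ge> 1" using P by (simp add: L_def)
  define \<eta> where "\<eta> = d / (2 * L)"
  have \<eta>: "\<eta> > 0" "\<eta> * L < d" using d L by (auto simp: \<eta>_def)
  define \<Phi> where "\<Phi> = (\<lambda>z::'a \<times> 'a. v1 (fst z) - v2 (snd z) - (1 / (2 * \<eta>)) * (norm (fst z - snd z))\<^sup>2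
      - \<kappa> * sqrt ((norm (fst z - 0))\<^sup>2 + 1))"
  have cont: "continuous_on UNIV \<Phi>"
    unfolding \<Phi>_def
    by (intro continuous_intros continuous_on_compose2[OF v1(1)] continuous_on_compose2[OF v2(1)]) auto
  have bdd: "bounded {z. \<Phi> z \<ge> \<Phi> (0, 0)}"
  proof -
    define C where "C = 2 * B1 + 2 * B2 + 1"
    define R where "R = C / \<kappa> + (1 + 2 * \<eta> * C)"
    have "norm z \<le> R + (C / \<kappa>)" if "\<Phi> z \<ge> \<Phi> (0, 0)" for z
    proof -
      define x y where "x = fst z" and "y = snd z"
      have z: "z = (x, y)" by (simp add: x_def y_def)
      have "v1 0 - v2 0 - \<kappa> \<le> v1 x - v2 y - (1 / (2 * \<eta>)) * (norm (x - y))\<^sup>2 - \<kappa> * sqrt ((norm x)\<^sup>2 + 1)"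
        using that by (simp add: \<Phi>_def z)
      then have *: "(1 / (2 * \<eta>)) * (norm (x - y))\<^sup>2 + \<kappa> * sqrt ((norm x)\<^sup>2 + 1) \<le> C"
        using B1[of x] B1[of 0] B2[of y] B2[of 0] \<kappa> unfolding C_def by (simp add: abs_le_iff)
      have "\<kappa> * norm x \<le> \<kappa> * sqrt ((norm x)\<^sup>2 + 1)" using \<kappa> by (simp add: real_le_rsqrt)
      moreover have "(1 / (2 * \<eta>)) * (norm (x - y))\<^sup>2 \<ge> 0" using \<eta> by simp
      ultimately have "\<kappa> * norm x \<le> C" using * by linarith
      then have nx: "norm x \<le> C / \<kappa>" using \<kappa> by (simp add: field_simps)
      have "\<kappa> * sqrt ((norm x)\<^sup>2 + 1) \<ge> 0" using \<kappa> by simp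
      then have "(1 / (2 * \<eta>)) * (norm (x - y))\<^sup>2 \<le> C" using * by linarith
      then have "(norm (x - y))\<^sup>2 \<le> 2 * \<eta> * C" using \<eta> by (simp add: field_simps)
      moreover have "norm (x - y) \<le> 1 + (norm (x - y))\<^sup>2"
      proof -
        have "0 \<le> (norm (x - y) - 1)\<^sup>2" by simp
        then have "2 * norm (x - y) \<le> 1 + (norm (x - y))\<^sup>2" by (simp add: power2_diff)
        then show ?thesis using norm_ge_zero[of "x - y"] by linarith
      qed
      ultimately have "norm (x - y) \<le> 1 + 2 * \<eta> * C" by linarith
      moreover have "norm y \<le> norm x + norm (x - y)" by (metis norm_minus_commute norm_triangle_sub)
      moreover have "norm z \<le> norm x + norm y" unfolding z by (rule norm_Pair_le)
      ultimately show ?thesis using nx unfolding R_def by linarith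
    qed
    then show ?thesis unfolding bounded_iff by blast
  qed
  obtain z where z: "\<And>y. \<Phi> y \<le> \<Phi> z" using continuous_attains_global_sup[OF cont bdd] by blast
  define x0 y0 where "x0 = fst z" and "y0 = snd z"
  have max: "\<Phi> (x, y) \<le> \<Phi> (x0, y0)" for x y using z by (simp add: x0_def y0_def)
  define q where "q = (1 / \<eta>) *\<^sub>R (x0 - y0)"
  define r where "r = (1 / sqrt ((norm (x0 - 0))\<^sup>2 + 1)) *\<^sub>R (x0 - 0)"
  have nr: "norm r \<le> 1"
  proof -
    have "norm x0 \<le> sqrt ((norm x0)\<^sup>2 + 1)" by (simp add: real_le_rsqrt)
    moreover have "sqrt ((norm x0)\<^sup>2 + 1) > 0" by (simp add: add_nonneg_pos)
    ultimately show ?thesis by (simp add: r_def)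
  qed
  have sub: "(norm (p + (q + \<kappa> *\<^sub>R r)))\<^sup>2 / 2 + V x0 - \<mu>1 \<le> 0"
  proof -
    define \<phi> where "\<phi> = (\<lambda>x. (1 / (2 * \<eta>)) * (norm (x - y0))\<^sup>2 + \<kappa> * sqrt ((norm (x - 0))\<^sup>2 + 1))"
    define g where "g = (\<lambda>x. (1 / (2 * \<eta>)) *\<^sub>R (2 *\<^sub>R (x - y0)) + \<kappa> *\<^sub>R ((1 / sqrt ((norm (x - 0))\<^sup>2 + 1)) *\<^sub>R (x - 0)))"
    have C1: "C1_with_gradient \<phi> g"
      unfolding \<phi>_def g_def by (intro C1_add C1_scale C1_smooth_dist C1_sqdist) auto
    have "\<forall>\<^sub>F x in nhds x0. v1 x - \<phi> x \<le> v1 x0 - \<phi> x0"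
    proof (intro always_eventually allI)
      fix x show "v1 x - \<phi> x \<le> v1 x0 - \<phi> x0"
        using max[of x y0] unfolding \<Phi>_def \<phi>_def fst_conv snd_conv by linarith
    qed
    from subsolutionD[OF v1(3) C1 this] show ?thesis by (simp add: g_def q_def r_def)
  qed
  have sup: "(norm (p + q))\<^sup>2 / 2 + V y0 - \<mu>2 \<ge> 0"
  proof -
    define \<phi> where "\<phi> = (\<lambda>y. - (1 / (2 * \<eta>)) * (norm (y - x0))\<^sup>2)"
    define g where "g = (\<lambda>y. - (1 / (2 * \<eta>)) *\<^sub>R (2 *\<^sub>R (y - x0)))"
    have C1: "C1_with_gradient \<phi> g"
      unfolding \<phi>_def g_def by (intro C1_scale C1_sqdist)
    have "\<forall>\<^sub>F x in nhds y0. v2 x - \<phi> x \<ge> v2 y0 - \<phi> y0"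
    proof (intro always_eventually allI)
      fix y show "v2 y - \<phi> y \<ge> v2 y0 - \<phi> y0"
        using max[of x0 y] unfolding \<Phi>_def \<phi>_def fst_conv snd_conv norm_minus_commute[of x0] by simp
    qed
    from supersolutionD[OF v2(3) C1 this] show ?thesis
      by (simp add: g_def q_def scaleR_diff_right)
  qed
  have "(norm (p + (q + \<kappa> *\<^sub>R r)))\<^sup>2 \<le> P\<^sup>2"
    using sub abs_le_D2[OF B(2)[of x0]] abs_ge_self[of \<mu>1] unfolding P2 by linarith
  then have pq: "norm (p + (q + \<kappa> *\<^sub>R r)) \<le> P" using P by (simp add: power2_le_iff_abs_le)
  have nkr: "norm (\<kappa> *\<^sub>R r) \<le> \<kappa>" using mult_left_mono[OF nr, of \<kappa>] \<kappa> by simp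
  have pq2: "norm (p + q) \<le> norm (p + (q + \<kappa> *\<^sub>R r)) + \<kappa>"
  proof -
    have "p + q = (p + (q + \<kappa> *\<^sub>R r)) - \<kappa> *\<^sub>R r" by simp
    then show ?thesis using norm_triangle_ineq4[of "p + (q + \<kappa> *\<^sub>R r)" "\<kappa> *\<^sub>R r"] nkr by simp
  qed
  have "norm q \<le> norm (p + q) + norm p" by (metis add_diff_cancel_left' norm_triangle_ineq4)
  then have "norm q \<le> L" using pq pq2 \<kappa> unfolding L_def by linarith
  then have "norm (x0 - y0) \<le> \<eta> * L"
    using \<eta> by (simp add: q_def divide_simps mult.commute)
  then have "dist (V y0) (V x0) < \<gamma> / 4" using d(2)[of y0 x0] \<eta> by (simp add: dist_norm norm_minus_commute)
  then have dV: "V y0 - V x0 < \<gamma> / 4" unfolding dist_real_def by linarith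
  define b where "b = norm (p + (q + \<kappa> *\<^sub>R r))"
  have "(norm (p + q))\<^sup>2 \<le> (b + \<kappa>)\<^sup>2" using pq2 unfolding b_def by (intro power_mono) auto
  also have "\<dots> = b\<^sup>2 + 2 * (b * \<kappa>) + \<kappa> * \<kappa>" by (simp add: power2_eq_square algebra_simps)
  also have "b * \<kappa> \<le> P * \<kappa>" using pq \<kappa> unfolding b_def by (intro mult_right_mono) auto
  also have "\<kappa> * \<kappa> \<le> 1 * \<kappa>" using \<kappa> by (intro mult_right_mono) auto
  finally have "(norm (p + q))\<^sup>2 \<le> b\<^sup>2 + 2 * ((P + 1) * \<kappa>)" using \<kappa> by (simp add: algebra_simps)
  then have "(norm (p + q))\<^sup>2 \<le> b\<^sup>2 + \<gamma> / 4" using \<kappa>P by linarith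
  then show False using sub sup dV \<gamma> \<gamma>_def unfolding b_def[symmetric] by linarith
qed

lemma cell_value_unique:
  assumes "buc V" "cell_value V p \<mu>" "cell_value V p \<mu>'"
  shows "\<mu> = \<mu>'"
proof -
  obtain v where v: "continuous_on UNIV v" "bounded (range v)"
    "viscosity_subsolution (cell V p \<mu>) v" "viscosity_supersolution (cell V p \<mu>) v"
    using assms(2) unfolding cell_value_def viscosity_solution_def by blast
  obtain w where w: "continuous_on UNIV w" "bounded (range w)"
    "viscosity_subsolution (cell V p \<mu>') w" "viscosity_supersolution (cell V p \<mu>') w"
    using assms(3) unfolding cell_value_def viscosity_solution_def by blast
  show ?thesis
    using comparison[OF assms(1) v(1,2,3) w(1,2,4)] comparison[OF assms(1) w(1,2,3) v(1,2,4)] by simp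
qed

lemma cell_value_le_subsolution:
  assumes "buc V" "cell_value V p \<mu>"
    "continuous_on UNIV v" "bounded (range v)" "viscosity_subsolution (cell V p \<mu>') v"
  shows "\<mu> \<le> \<mu>'"
proof -
  obtain w where w: "continuous_on UNIV w" "bounded (range w)" "viscosity_supersolution (cell V p \<mu>) w"
    using assms(2) unfolding cell_value_def viscosity_solution_def by blast
  show ?thesis by (rule comparison[OF assms(1,3,4,5) w])
qed

text \<open>All quantitative information about the cell constant comes from this lemma and the next: a test
function that nearly solves the equation is enough, and no solution needs to be known.\<close>

lemma cell_value_le_of_C1:
  assumes "buc V" "cell_value V p \<mu>" "C1_with_gradient \<phi> g" "bounded (range \<phi>)"
    "\<And>x. (norm (p + g x))\<^sup>2 / 2 + V x \<le> c"
  shows "\<mu> \<le> c"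
  using assms by (intro cell_value_le_subsolution[of V p \<mu> \<phi>] subsolution_of_C1[of \<phi> g])
    (auto intro: C1_with_gradientD)

lemma cell_value_ge_of_C1:
  assumes "buc V" "cell_value V p \<mu>" "C1_with_gradient \<phi> g" "bounded (range \<phi>)"
    "\<And>x. (norm (p + g x))\<^sup>2 / 2 + V x \<ge> c"
  shows "\<mu> \<ge> c"
proof -
  have sup: "viscosity_supersolution (cell V p c) \<phi>"
    using assms by (intro supersolution_of_C1[of \<phi> g]) auto
  obtain w where w: "continuous_on UNIV w" "bounded (range w)" "viscosity_subsolution (cell V p \<mu>) w"
    using assms(2) unfolding cell_value_def viscosity_solution_def by blast
  show ?thesis by (rule comparison[OF assms(1) w C1_with_gradientD(3)[OF assms(3)] assms(4) sup])
qed

section \<open>Existence of solutions\<close>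

lemma translate_subsolution:
  assumes "viscosity_subsolution F v"
  shows "viscosity_subsolution (\<lambda>x q. F (x + a) q) (\<lambda>x. v (x + a))"
  unfolding viscosity_subsolution_def
proof (intro allI impI, elim conjE)
  fix \<phi> g x
  assume C1: "C1_with_gradient \<phi> g" and t: "\<forall>\<^sub>F y in nhds x. v (y + a) - \<phi> y \<le> v (x + a) - \<phi> x"
  have C1': "C1_with_gradient (\<lambda>y. \<phi> (y + - a)) (\<lambda>y. g (y + - a))"
    using C1_affine[OF C1, of "\<lambda>x. x" "\<lambda>x. x" "- a"] by (simp add: linear_ident)
  have "\<forall>\<^sub>F y in nhds (x + a). v y - \<phi> (y + - a) \<le> v (x + a) - \<phi> (x + a + - a)"
  proof -
    obtain e where e: "e > 0" "\<And>y. dist y x < e \<Longrightarrow> v (y + a) - \<phi> y \<le> v (x + a) - \<phi> x"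
      using t unfolding eventually_nhds_metric by blast
    have "v y - \<phi> (y + - a) \<le> v (x + a) - \<phi> (x + a + - a)" if "dist y (x + a) < e" for y
      using e(2)[of "y - a"] that by (simp add: dist_norm algebra_simps)
    then show ?thesis using e(1) unfolding eventually_nhds_metric by blast
  qed
  from subsolutionD[OF assms C1' this] show "F (x + a) (g x) \<le> 0" by simp
qed

text \<open>Perron's method. A subsolution \<open>v \<ge> c0\<close> satisfies \<open>(norm (p + Dv))\<^sup>2 \<le> - 2 * (lam * v + V)\<close>, hence is
Lipschitz with a constant independent of \<open>lam\<close>, and so is the supremum \<open>w\<close> of all of them. If \<open>w\<close> were not a
supersolution at \<open>x0\<close>, a test function touching it there from below could be bent down quadratically and
raised by \<open>\<delta>\<close>, and \<open>w\<close> would not be maximal. The family is invariant under all translations that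
preserve \<open>V\<close>, and \<open>w\<close> inherits them.\<close>

lemma discounted_solution_exists:
  fixes V :: "'a::euclidean_space \<Rightarrow> real"
  assumes cV: "continuous_on UNIV V" and B: "\<And>x. \<bar>V x\<bar> \<le> B" and lam: "lam > 0"
  obtains v where
    "\<And>x y. \<bar>v y - v x\<bar> \<le> (norm p + sqrt (4 * B + (norm p)\<^sup>2)) * norm (y - x)"
    "\<And>x. \<bar>lam * v x\<bar> \<le> B + (norm p)\<^sup>2 / 2"
    "viscosity_subsolution (\<lambda>x q. lam * v x + (norm (p + q))\<^sup>2 / 2 + V x) v"
    "viscosity_supersolution (\<lambda>x q. lam * v x + (norm (p + q))\<^sup>2 / 2 + V x) v"
    "\<And>a x. (\<And>y. V (y + a) = V y) \<Longrightarrow> v (x + a) = v x"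
proof -
  define D where "D = (\<lambda>(v::'a \<Rightarrow> real) x q. lam * v x + (norm (p + q))\<^sup>2 / 2 + V x)"
  \<comment> \<open>\<open>c0\<close> is a constant subsolution. The cap \<open>M\<close> is respected by the raised test function, which satisfies the equation with \<open>\<le>\<close> and hence \<open>lam * v \<le> B\<close>.\<close>
  define c0 where "c0 = - (B + (norm p)\<^sup>2 / 2) / lam"
  define M where "M = B / lam"
  define K where "K = norm p + sqrt (4 * B + (norm p)\<^sup>2)"
  define \<F> where "\<F> = {v. continuous_on UNIV v \<and> (\<forall>x. c0 \<le> v x \<and> v x \<le> M) \<and> viscosity_subsolution (D v) v}"
  have B0: "B \<ge> 0" using B[of 0] by linarith
  have K0: "K \<ge> 0" using B0 by (simp add: K_def)
  have lc0: "lam * c0 = - (B + (norm p)\<^sup>2 / 2)" and lM: "lam * M = B" using lam by (simp_all add: c0_def M_def)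
  have c0M: "c0 \<le> M"
  proof -
    have "lam * c0 \<le> lam * M" unfolding lc0 lM using B0 zero_le_power2[of "norm p"] by linarith
    then show ?thesis using lam by simp
  qed
  have c0F: "(\<lambda>x. c0) \<in> \<F>"
  proof -
    have "lam * c0 + (norm (p + 0))\<^sup>2 / 2 + V x \<le> 0" for x using lc0 B[of x] by simp
    then have "viscosity_subsolution (D (\<lambda>x. c0)) (\<lambda>x. c0)"
      by (intro subsolution_of_C1[OF C1_const]) (simp add: D_def)
    then show ?thesis using c0M by (simp add: \<F>_def)
  qed
  have lip: "\<bar>v y - v x\<bar> \<le> K * norm (y - x)" if v: "v \<in> \<F>" for v x y
  proof (rule lipschitz_of_gradient_bound[OF _ _ K0])
    show "continuous_on UNIV v" using v by (simp add: \<F>_def)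
    have "\<bar>v x\<bar> \<le> \<bar>c0\<bar> + \<bar>M\<bar>" for x
    proof -
      have "c0 \<le> v x" "v x \<le> M" using v by (auto simp: \<F>_def)
      then show ?thesis by linarith
    qed
    then show "bounded (range v)" by (auto simp: bounded_iff)
    fix \<phi> g y
    assume "C1_with_gradient \<phi> g" "\<forall>\<^sub>F z in nhds y. v z - \<phi> z \<le> v y - \<phi> y"
    then have "D v y (g y) \<le> 0" using v subsolutionD unfolding \<F>_def by blast
    then have "lam * v y + (norm (p + g y))\<^sup>2 / 2 + V y \<le> 0" by (simp add: D_def)
    moreover have "lam * c0 \<le> lam * v y" using v lam by (simp add: \<F>_def)
    ultimately have "(norm (p + g y))\<^sup>2 \<le> 4 * B + (norm p)\<^sup>2" using lc0 B[of y] by (simp add: abs_le_iff)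
    then have "norm (p + g y) \<le> sqrt (4 * B + (norm p)\<^sup>2)" using real_le_rsqrt by blast
    moreover have "norm (g y) \<le> norm (p + g y) + norm p" by (metis add_diff_cancel_left' norm_triangle_ineq4)
    ultimately show "norm (g y) \<le> K" unfolding K_def by linarith
  qed
  define w where "w = (\<lambda>x. SUP v\<in>\<F>. v x)"
  have bdd: "bdd_above ((\<lambda>v. v x) ` \<F>)" for x by (rule bdd_aboveI[of _ M]) (auto simp: \<F>_def)
  have w_ge: "v x \<le> w x" if "v \<in> \<F>" for v x unfolding w_def by (rule cSUP_upper[OF that bdd])
  have w_le: "w x \<le> c" if "\<And>v. v \<in> \<F> \<Longrightarrow> v x \<le> c" for x c
    unfolding w_def by (rule cSUP_least) (use c0F that in auto)
  have w_approx: "\<exists>v\<in>\<F>. w x - e < v x" if "e > 0" for x e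
  proof (rule ccontr)
    assume "\<not> ?thesis"
    then have "w x \<le> w x - e" by (intro w_le) (auto simp: not_less)
    then show False using that by simp
  qed
  have wbd: "c0 \<le> w x" "w x \<le> M" for x
    using w_ge[OF c0F, of x] by (auto intro!: w_le simp: \<F>_def)
  have wlip1: "w y - w x \<le> K * norm (y - x)" for x y
  proof -
    have "w y \<le> w x + K * norm (y - x)"
    proof (rule w_le)
      fix v assume "v \<in> \<F>"
      then show "v y \<le> w x + K * norm (y - x)" using lip[of v y x] w_ge[of v x] by (simp add: abs_le_iff)
    qed
    then show ?thesis by simp
  qed
  have wlip: "\<bar>w y - w x\<bar> \<le> K * norm (y - x)" for x y
    using wlip1[of y x] wlip1[of x y] by (simp add: norm_minus_commute abs_le_iff)
  have cw: "continuous_on UNIV w"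
  proof (rule lipschitz_on_continuous_on)
    show "K-lipschitz_on UNIV w" using wlip K0 by (auto simp: lipschitz_on_def dist_norm norm_minus_commute)
  qed
  have cD: "continuous_on UNIV (\<lambda>(x, q). D w x q)"
    unfolding D_def case_prod_unfold
    by (intro continuous_intros continuous_on_compose2[OF cw] continuous_on_compose2[OF cV]) auto
  have sub: "viscosity_subsolution (D w) w"
  proof (rule subsolution_stable[OF cD])
    show "2 * lam * K \<ge> 0" using lam K0 by simp
    fix x and \<delta> :: real assume \<delta>: "\<delta> > 0"
    define e where "e = min \<delta> (\<delta> / lam)"
    have e: "e > 0" "e \<le> \<delta>" "lam * e \<le> \<delta>"
      using \<delta> lam mult_left_mono[of e "\<delta> / lam" lam] by (auto simp: e_def)
    obtain v where v: "v \<in> \<F>" "w x - e < v x" using w_approx[OF e(1)] by blast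
    show "\<exists>v F'. continuous_on UNIV v \<and> viscosity_subsolution F' v \<and> w x - \<delta> \<le> v x \<and>
      (\<forall>y. v y \<le> w y + \<delta>) \<and> (\<forall>y q. D w y q \<le> F' y q + \<delta> + 2 * lam * K * dist y x)"
    proof (intro exI conjI allI)
      show "continuous_on UNIV v" "viscosity_subsolution (D v) v" using v(1) by (auto simp: \<F>_def)
      show "w x - \<delta> \<le> v x" using v(2) e(2) by linarith
      show "v y \<le> w y + \<delta>" for y using w_ge[OF v(1), of y] \<delta> by linarith
      fix y q
      have "w y - v y \<le> e + 2 * K * norm (y - x)"
        using wlip[of y x] lip[OF v(1), of y x] v(2) by (simp add: abs_le_iff)
      then have "lam * (w y - v y) \<le> lam * e + lam * (2 * K * norm (y - x))"
        using lam by (simp add: distrib_left[symmetric])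
      then show "D w y q \<le> D v y q + \<delta> + 2 * lam * K * dist y x"
        using e(3) by (simp add: D_def dist_norm algebra_simps)
    qed
  qed
  have sup: "viscosity_supersolution (D w) w"
    unfolding viscosity_supersolution_def
  proof (intro allI impI, elim conjE)
    fix \<phi> g x0
    assume C1: "C1_with_gradient \<phi> g" and touch: "\<forall>\<^sub>F y in nhds x0. w y - \<phi> y \<ge> w x0 - \<phi> x0"
    show "D w x0 (g x0) \<ge> 0"
    proof (rule ccontr)
      assume "\<not> ?thesis"
      then have neg: "D w x0 (g x0) < 0" by simp
      obtain r where r: "r > 0" "\<And>y. dist y x0 < r \<Longrightarrow> w x0 - \<phi> x0 \<le> w y - \<phi> y"
        using touch unfolding eventually_nhds_metric by blast
      \<comment> \<open>The touching function, normalised to \<open>w x0\<close> at \<open>x0\<close> and bent down, lies below \<open>w\<close> by \<open>(norm (y - x0))\<^sup>2\<close>; raised by \<open>\<delta>\<close> it exceeds \<open>w\<close> at most within distance \<open>sqrt \<delta>\<close>.\<close>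
      define \<psi> where "\<psi> = (\<lambda>y. \<phi> y + ((w x0 - \<phi> x0) - (norm (y - x0))\<^sup>2))"
      define h where "h = (\<lambda>y. g y + (0 - 2 *\<^sub>R (y - x0)))"
      have C1': "C1_with_gradient \<psi> h" unfolding \<psi>_def h_def
        by (intro C1_add C1_diff C1_const C1_sqdist C1)
      define G where "G = (\<lambda>y. lam * \<psi> y + (norm (p + h y))\<^sup>2 / 2 + V y)"
      have cG: "continuous_on UNIV G" unfolding G_def
        by (intro continuous_intros C1_with_gradientD[OF C1'] cV) auto
      have G0: "G x0 < 0" using neg by (simp add: G_def \<psi>_def h_def D_def)
      have "isCont G x0" using cG by (simp add: continuous_on_eq_continuous_at)
      then obtain d where d: "d > 0" "\<And>y. dist y x0 < d \<Longrightarrow> \<bar>G y - G x0\<bar> < - G x0 / 2"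
        using G0 unfolding continuous_at_eps_delta dist_real_def by (metis half_gt_zero neg_0_less_iff_less minus_divide_left)
      define \<rho> where "\<rho> = min r d"
      define \<delta> where "\<delta> = min (\<rho>\<^sup>2 / 2) (- G x0 / (2 * lam))"
      have \<rho>: "\<rho> > 0" using r d by (simp add: \<rho>_def)
      have \<delta>: "\<delta> > 0" "\<delta> < \<rho>\<^sup>2" using \<rho> G0 lam zero_less_power2[of \<rho>]
        by (auto simp: \<delta>_def divide_neg_pos intro: min.strict_coboundedI1)
      have \<delta>l: "lam * \<delta> \<le> - G x0 / 2"
      proof -
        have "lam * \<delta> \<le> lam * (- G x0 / (2 * lam))" using lam by (intro mult_left_mono) (auto simp: \<delta>_def)
        then show ?thesis using lam by simp
      qed
      have Dneg: "lam * (\<psi> y + \<delta>) + (norm (p + h y))\<^sup>2 / 2 + V y \<le> 0" if "y \<in> ball x0 \<rho>" for y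
      proof -
        have "dist y x0 < d" using that by (simp add: \<rho>_def dist_commute)
        then have "G y \<le> G x0 / 2" using d(2)[of y] by linarith
        then show ?thesis using \<delta>l by (simp add: G_def algebra_simps)
      qed
      have low: "w y \<ge> \<psi> y + (norm (y - x0))\<^sup>2" if "y \<in> ball x0 \<rho>" for y
        using r(2)[of y] that by (simp add: \<psi>_def \<rho>_def dist_commute)
      define u where "u = (\<lambda>y. if y \<in> ball x0 \<rho> then max (w y) (\<psi> y + \<delta>) else w y)"
      have uw: "w y \<le> u y" for y by (simp add: u_def)
      have u_out: "u y = w y" if "y \<notin> cball x0 (sqrt \<delta>)" for y
      proof (cases "y \<in> ball x0 \<rho>")
        case True
        have "sqrt \<delta> < norm (y - x0)" using that by (simp add: dist_norm norm_minus_commute)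
        then have "\<delta> \<le> (norm (y - x0))\<^sup>2" using \<delta>(1) by (meson less_imp_le real_sqrt_le_iff sqrt_le_D)
        then show ?thesis using low[OF True] by (simp add: u_def)
      qed (auto simp: u_def)
      have sqd: "sqrt \<delta> < \<rho>" using \<delta> \<rho> real_less_lsqrt by simp
      have cu: "continuous_on UNIV u"
      proof -
        have "continuous_on (ball x0 \<rho>) (\<lambda>y. max (w y) (\<psi> y + \<delta>))"
          by (intro continuous_intros continuous_on_subset[OF cw] continuous_on_subset[OF C1_with_gradientD(3)[OF C1']]) auto
        then have "continuous_on (ball x0 \<rho>) u" by (rule continuous_on_eq) (simp add: u_def)
        moreover have "continuous_on (- cball x0 (sqrt \<delta>)) w" by (rule continuous_on_subset[OF cw]) auto
        then have "continuous_on (- cball x0 (sqrt \<delta>)) u" by (rule continuous_on_eq) (simp add: u_out)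
        ultimately have "continuous_on (ball x0 \<rho> \<union> - cball x0 (sqrt \<delta>)) u"
          by (intro continuous_on_open_Un) auto
        moreover have "ball x0 \<rho> \<union> - cball x0 (sqrt \<delta>) = UNIV" using sqd by auto
        ultimately show ?thesis by simp
      qed
      have uM: "u y \<le> M" for y
      proof -
        have "\<psi> y + \<delta> \<le> M" if "y \<in> ball x0 \<rho>"
        proof -
          have "lam * (\<psi> y + \<delta>) \<le> lam * M" using Dneg[OF that] B[of y] zero_le_power2[of "norm (p + h y)"]
            unfolding lM by linarith
          then show ?thesis using lam by simp
        qed
        then show ?thesis using wbd(2)[of y] by (simp add: u_def)
      qed
      have "viscosity_subsolution (D u) u"
        unfolding viscosity_subsolution_def
      proof (intro allI impI, elim conjE)
        fix \<theta> k y
        assume C1\<theta>: "C1_with_gradient \<theta> k" and t: "\<forall>\<^sub>F z in nhds y. u z - \<theta> z \<le> u y - \<theta> y"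
        show "D u y (k y) \<le> 0"
        proof (cases "u y = w y")
          case True
          have "\<forall>\<^sub>F z in nhds y. w z - \<theta> z \<le> w y - \<theta> y"
            using t
          proof eventually_elim
            case (elim z)
            then show ?case using uw[of z] True by linarith
          qed
          from subsolutionD[OF sub C1\<theta> this] show ?thesis by (simp add: D_def True)
        next
          case False
          then have yb: "y \<in> ball x0 \<rho>" and uy: "u y = \<psi> y + \<delta>" by (auto simp: u_def max_def split: if_splits)
          have "\<forall>\<^sub>F z in nhds y. z \<in> ball x0 \<rho>" using yb by (intro eventually_nhds_in_open) auto
          then have "\<forall>\<^sub>F z in nhds y. \<psi> z - \<theta> z \<le> \<psi> y - \<theta> y"
            using t
          proof eventually_elim
            case (elim z)
            then have "\<psi> z + \<delta> \<le> u z" by (simp add: u_def)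
            then show ?case using elim uy by linarith
          qed
          from gradient_eq_at_touching[OF C1' C1\<theta> this] have "k y = h y" by simp
          then show ?thesis using Dneg[OF yb] by (simp add: D_def uy)
        qed
      qed
      then have "u \<in> \<F>" using cu uM uw wbd(1) order_trans unfolding \<F>_def by blast
      then have "u x0 \<le> w x0" by (rule w_ge)
      moreover have "u x0 \<ge> w x0 + \<delta>" using \<rho> by (simp add: u_def \<psi>_def)
      ultimately show False using \<delta> by linarith
    qed
  qed
  have inv1: "w x \<le> w (x + a)" if a: "\<And>y. V (y + a) = V y" for a x
  proof (rule w_le)
    fix v assume v: "v \<in> \<F>"
    have Va: "V (y + - a) = V y" for y using a[of "y + - a"] unfolding add.assoc by simp
    have "viscosity_subsolution (D (\<lambda>y. v (y + - a))) (\<lambda>y. v (y + - a))"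
    proof -
      have "viscosity_subsolution (D v) v" using v by (simp add: \<F>_def)
      from translate_subsolution[OF this, of "- a"] show ?thesis unfolding D_def Va .
    qed
    moreover have "continuous_on UNIV (\<lambda>y. v (y + - a))"
    proof (rule continuous_on_compose2[where g = v and t = UNIV])
      show "continuous_on UNIV v" using v by (simp add: \<F>_def)
    qed (auto intro!: continuous_intros)
    ultimately have "(\<lambda>y. v (y + - a)) \<in> \<F>" using v by (simp add: \<F>_def)
    from w_ge[OF this, of "x + a"] show "v x \<le> w (x + a)" by simp
  qed
  show thesis
  proof (rule that)
    show "\<bar>w y - w x\<bar> \<le> (norm p + sqrt (4 * B + (norm p)\<^sup>2)) * norm (y - x)" for x y
      using wlip by (simp add: K_def)
    fix x
    have "lam * c0 \<le> lam * w x" "lam * w x \<le> lam * M" using wbd lam by auto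
    then show "\<bar>lam * w x\<bar> \<le> B + (norm p)\<^sup>2 / 2" unfolding lc0 lM
      using zero_le_power2[of "norm p"] by (intro abs_leI; linarith)
  next
    show "viscosity_subsolution (\<lambda>x q. lam * w x + (norm (p + q))\<^sup>2 / 2 + V x) w" using sub by (simp add: D_def)
    show "viscosity_supersolution (\<lambda>x q. lam * w x + (norm (p + q))\<^sup>2 / 2 + V x) w" using sup by (simp add: D_def)
    fix a x assume a: "\<And>y. V (y + a) = V y"
    have Va: "V (y + - a) = V y" for y using a[of "y + - a"] unfolding add.assoc by simp
    show "w (x + a) = w x" using inv1[OF a, of x] inv1[OF Va, of "x + a"] by simp
  qed
qed

text \<open>Limit of the discounted solutions, normalised at the origin, as the discount tends to zero. Compactness
comes from the uniform Lipschitz bound and from periods of \<open>V\<close> that move every point into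
one ball. That the limit has every period of \<open>V\<close> matters beyond the lattice: where \<open>V\<close> is
constant along a subspace, so is the solution.\<close>

lemma cell_solution_exists:
  fixes V :: "'a::euclidean_space \<Rightarrow> real"
  assumes V: "buc V" and cocompact: "\<And>x. \<exists>a. (\<forall>y. V (y + a) = V y) \<and> norm (x - a) \<le> R"
  obtains \<mu> v where "bounded (range v)" "viscosity_solution (cell V p \<mu>) v"
    "\<forall>a. (\<forall>y. V (y + a) = V y) \<longrightarrow> (\<forall>x. v (x + a) = v x)"
proof -
  obtain B where B: "B > 0" "\<And>x. \<bar>V x\<bar> \<le> B" using buc_boundE[OF V] by blast
  have cV: "continuous_on UNIV V" by (rule bucD(3)[OF V])
  define K where "K = norm p + sqrt (4 * B + (norm p)\<^sup>2)"
  have K: "K \<ge> 0" using B by (simp add: K_def)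
  have R0: "R \<ge> 0" using cocompact[of 0] norm_ge_zero order_trans by blast
  define lam where "lam n = inverse (real (Suc n))" for n
  have lam: "lam n > 0" for n by (simp add: lam_def)
  have lam0: "lam \<longlonglongrightarrow> 0" unfolding lam_def by (rule LIMSEQ_inverse_real_of_nat)
  have "\<exists>v. (\<forall>x y. \<bar>v y - v x\<bar> \<le> K * norm (y - x)) \<and> (\<forall>x. \<bar>lam n * v x\<bar> \<le> B + (norm p)\<^sup>2 / 2) \<and>
    viscosity_subsolution (\<lambda>x q. lam n * v x + (norm (p + q))\<^sup>2 / 2 + V x) v \<and>
    viscosity_supersolution (\<lambda>x q. lam n * v x + (norm (p + q))\<^sup>2 / 2 + V x) v \<and>
    (\<forall>a x. (\<forall>y. V (y + a) = V y) \<longrightarrow> v (x + a) = v x)" for n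
  proof -
    obtain v where v: "\<And>x y. \<bar>v y - v x\<bar> \<le> (norm p + sqrt (4 * B + (norm p)\<^sup>2)) * norm (y - x)"
      "\<And>x. \<bar>lam n * v x\<bar> \<le> B + (norm p)\<^sup>2 / 2"
      "viscosity_subsolution (\<lambda>x q. lam n * v x + (norm (p + q))\<^sup>2 / 2 + V x) v"
      "viscosity_supersolution (\<lambda>x q. lam n * v x + (norm (p + q))\<^sup>2 / 2 + V x) v"
      "\<And>a x. (\<And>y. V (y + a) = V y) \<Longrightarrow> v (x + a) = v x"
      using discounted_solution_exists[OF cV B(2) lam[of n], where p = p] by blast
    show ?thesis unfolding K_def by (rule exI[of _ v]) (use v in blast)
  qed
  then obtain v where lipv: "\<And>n x y. \<bar>v n y - v n x\<bar> \<le> K * norm (y - x)"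
    and bdv: "\<And>n x. \<bar>lam n * v n x\<bar> \<le> B + (norm p)\<^sup>2 / 2"
    and subv: "\<And>n. viscosity_subsolution (\<lambda>x q. lam n * v n x + (norm (p + q))\<^sup>2 / 2 + V x) (v n)"
    and supv: "\<And>n. viscosity_supersolution (\<lambda>x q. lam n * v n x + (norm (p + q))\<^sup>2 / 2 + V x) (v n)"
    and invv: "\<And>n a x. (\<forall>y. V (y + a) = V y) \<Longrightarrow> v n (x + a) = v n x"
    using choice[of "\<lambda>n v. (\<forall>x y. \<bar>v y - v x\<bar> \<le> K * norm (y - x)) \<and> (\<forall>x. \<bar>lam n * v x\<bar> \<le> B + (norm p)\<^sup>2 / 2) \<and>
    viscosity_subsolution (\<lambda>x q. lam n * v x + (norm (p + q))\<^sup>2 / 2 + V x) v \<and>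
    viscosity_supersolution (\<lambda>x q. lam n * v x + (norm (p + q))\<^sup>2 / 2 + V x) v \<and>
    (\<forall>a x. (\<forall>y. V (y + a) = V y) \<longrightarrow> v (x + a) = v x)"] by blast
  have "\<exists>a. \<forall>x. (\<forall>y. V (y + a x) = V y) \<and> norm (x - a x) \<le> R" by (rule choice) (use cocompact in blast)
  then obtain a where a: "\<And>x y. V (y + a x) = V y" "\<And>x. norm (x - a x) \<le> R" by blast
  have red: "v n x = v n (x - a x)" for n x
    using invv[of "a x" n "x - a x"] a(1) by simp
  define w where "w = (\<lambda>n x. v n x - v n 0)"
  have wbd: "\<bar>w n x\<bar> \<le> K * R" for n x
  proof -
    have "\<bar>v n (x - a x) - v n 0\<bar> \<le> K * norm (x - a x - 0)" by (rule lipv)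
    also have "\<dots> \<le> K * R" using a(2)[of x] K by (intro mult_left_mono) auto
    finally show ?thesis using red[of n x] by (simp add: w_def)
  qed
  \<comment> \<open>A single subsequence has to serve the solutions and their discounted values, so Arzela--Ascoli is applied to the pair.\<close>
  define P where "P = (\<lambda>n x. (w n x, lam n * v n 0))"
  obtain g :: "'a \<Rightarrow> real \<times> real" and k where k: "strict_mono (k :: nat \<Rightarrow> nat)" and
    conv: "\<And>e. 0 < e \<Longrightarrow> \<exists>N. \<forall>n x. n \<ge> N \<and> x \<in> cball 0 R \<longrightarrow> norm (P (k n) x - g x) < e"
  proof (rule Arzela_Ascoli[of "cball 0 R" P "K * R + (B + (norm p)\<^sup>2 / 2)"])
    show "norm (P n x) \<le> K * R + (B + (norm p)\<^sup>2 / 2)" for n x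
      unfolding P_def using norm_Pair_le[of "w n x" "lam n * v n 0"] wbd[of n x] bdv[of n 0]
      unfolding real_norm_def by linarith
    fix x :: 'a and e :: real assume "e > 0"
    show "\<exists>d>0. \<forall>n y. y \<in> cball 0 R \<and> norm (x - y) < d \<longrightarrow> norm (P n x - P n y) < e"
    proof (intro exI conjI allI impI)
      show "e / (K + 1) > 0" using \<open>e > 0\<close> K by simp
      fix n y assume y: "y \<in> cball 0 R \<and> norm (x - y) < e / (K + 1)"
      have "norm (P n x - P n y) \<le> K * norm (x - y)"
        using lipv[of n x y] by (simp add: P_def w_def norm_Pair)
      also have "\<dots> \<le> (K + 1) * norm (x - y)" by (intro mult_right_mono) auto
      also have "\<dots> < (K + 1) * (e / (K + 1))" using y K by (intro mult_strict_left_mono) auto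
      also have "\<dots> = e" using K by (simp add: divide_simps)
      finally show "norm (P n x - P n y) < e" .
    qed
  qed auto
  define u where "u = (\<lambda>x. fst (g (x - a x)))"
  define \<mu> where "\<mu> = - snd (g 0)"
  have nfst: "norm (fst z) \<le> norm z" and nsnd: "norm (snd z) \<le> norm z" for z :: "real \<times> real"
    using norm_fst_le[of "fst z" "snd z"] norm_snd_le[of "snd z" "fst z"] by simp_all
  have uconv: "\<exists>N. \<forall>n\<ge>N. \<forall>x. \<bar>w (k n) x - u x\<bar> < e" if e: "e > 0" for e
  proof -
    obtain N where N: "\<And>n x. n \<ge> N \<Longrightarrow> x \<in> cball 0 R \<Longrightarrow> norm (P (k n) x - g x) < e"
      using conv[OF e] by blast
    have "\<bar>w (k n) x - u x\<bar> < e" if "n \<ge> N" for n x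
    proof -
      have "norm (P (k n) (x - a x) - g (x - a x)) < e" using N[OF that] a(2) by simp
      then have "norm (fst (P (k n) (x - a x) - g (x - a x))) < e" by (rule le_less_trans[OF nfst])
      then show ?thesis using red[of "k n" x] by (simp add: P_def w_def u_def)
    qed
    then show ?thesis by blast
  qed
  have mconv: "(\<lambda>n. lam (k n) * v (k n) 0) \<longlonglongrightarrow> - \<mu>"
  proof (rule LIMSEQ_I)
    fix e :: real assume e: "e > 0"
    obtain N where N: "\<And>n x. n \<ge> N \<Longrightarrow> x \<in> cball 0 R \<Longrightarrow> norm (P (k n) x - g x) < e"
      using conv[OF e] by blast
    show "\<exists>N. \<forall>n\<ge>N. norm (lam (k n) * v (k n) 0 - - \<mu>) < e"
    proof (intro exI allI impI)
      fix n assume "n \<ge> N"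
      then have "norm (P (k n) 0 - g 0) < e" using N R0 by simp
      then have "norm (snd (P (k n) 0 - g 0)) < e" by (rule le_less_trans[OF nsnd])
      then show "norm (lam (k n) * v (k n) 0 - - \<mu>) < e" by (simp add: P_def \<mu>_def)
    qed
  qed
  have ulim: "(\<lambda>n. w (k n) x) \<longlonglongrightarrow> u x" for x
    using uconv by (intro LIMSEQ_I) (metis real_norm_def)
  have cw: "continuous_on UNIV (w n)" for n
  proof (rule lipschitz_on_continuous_on)
    show "K-lipschitz_on UNIV (w n)" using lipv[of n] K
      by (auto simp: lipschitz_on_def dist_norm w_def norm_minus_commute)
  qed
  have cu: "continuous_on UNIV u"
  proof (rule uniform_limit_theorem)
    show "\<forall>\<^sub>F n in sequentially. continuous_on UNIV (w (k n))" using cw by simp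
    show "uniform_limit UNIV (\<lambda>n. w (k n)) u sequentially"
      using uconv unfolding uniform_limit_sequentially_iff dist_real_def by blast
  qed auto
  have bu: "\<bar>u x\<bar> \<le> K * R" for x
    by (rule LIMSEQ_le_const2[OF tendsto_rabs[OF ulim]]) (use wbd in auto)
  have invu: "u (x + b) = u x" if "\<And>y. V (y + b) = V y" for b x
  proof (rule LIMSEQ_unique[OF ulim])
    have "w n (x + b) = w n x" for n using invv[of b n x] that by (simp add: w_def)
    then show "(\<lambda>n. w (k n) (x + b)) \<longlonglongrightarrow> u x" using ulim[of x] by simp
  qed
  define F where "F = cell V p \<mu>"
  define F' where "F' = (\<lambda>n x q. lam n * v n x + (norm (p + q))\<^sup>2 / 2 + V x)"
  have cF: "continuous_on UNIV (\<lambda>(x, q). F x q)"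
    unfolding F_def case_prod_unfold
    by (intro continuous_intros continuous_on_compose2[OF cV]) auto
  have close: "\<exists>n. (\<forall>x. \<bar>w n x - u x\<bar> < \<delta>) \<and> (\<forall>x q. \<bar>F' n x q - F x q\<bar> < \<delta>)" if \<delta>: "\<delta> > 0" for \<delta>
  proof -
    obtain N1 where N1: "\<forall>n\<ge>N1. \<forall>x. \<bar>w (k n) x - u x\<bar> < \<delta>" using uconv[OF \<delta>] by blast
    obtain N2 where N2: "\<And>n. n \<ge> N2 \<Longrightarrow> \<bar>lam (k n) * v (k n) 0 + \<mu>\<bar> < \<delta> / 2"
      using LIMSEQ_D[OF mconv, of "\<delta> / 2"] \<delta> by auto
    have "(\<lambda>n. lam (k n) * (K * R)) \<longlonglongrightarrow> 0 * (K * R)"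
      by (intro tendsto_intros LIMSEQ_subseq_LIMSEQ[OF lam0 k, unfolded o_def])
    then obtain N3 where N3: "\<And>n. n \<ge> N3 \<Longrightarrow> \<bar>lam (k n) * (K * R)\<bar> < \<delta> / 2"
      using LIMSEQ_D[of "\<lambda>n. lam (k n) * (K * R)" 0 "\<delta> / 2"] \<delta> by auto
    define n where "n = max N1 (max N2 N3)"
    have "\<bar>F' (k n) x q - F x q\<bar> < \<delta>" for x q
    proof -
      have "F' (k n) x q - F x q = (lam (k n) * v (k n) 0 + \<mu>) + lam (k n) * w (k n) x"
        by (simp add: F'_def F_def w_def algebra_simps)
      moreover have "\<bar>lam (k n) * w (k n) x\<bar> \<le> \<bar>lam (k n) * (K * R)\<bar>"
        unfolding abs_mult[of "lam (k n)"] using wbd[of "k n" x] K R0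
        by (intro mult_left_mono) (auto simp: abs_mult)
      moreover have "\<bar>lam (k n) * (K * R)\<bar> < \<delta> / 2" "\<bar>lam (k n) * v (k n) 0 + \<mu>\<bar> < \<delta> / 2"
        using N2[of n] N3[of n] by (simp_all add: n_def)
      ultimately show ?thesis by linarith
    qed
    moreover have "\<forall>x. \<bar>w (k n) x - u x\<bar> < \<delta>" using N1 by (simp add: n_def)
    ultimately show ?thesis by blast
  qed
  have shift: "viscosity_subsolution (F' n) (w n)" "viscosity_supersolution (F' n) (w n)" for n
    using subv[of n] supv[of n] unfolding viscosity_subsolution_def viscosity_supersolution_def F'_def w_def
    by simp_all
  have "viscosity_subsolution F u"
  proof (rule subsolution_stable[OF cF order_refl])
    fix x and \<delta> :: real assume "\<delta> > 0"
    from close[OF this] obtain n where n: "\<And>x. \<bar>w n x - u x\<bar> < \<delta>" "\<And>x q. \<bar>F' n x q - F x q\<bar> < \<delta>" by blast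
    show "\<exists>v F'. continuous_on UNIV v \<and> viscosity_subsolution F' v \<and> u x - \<delta> \<le> v x \<and>
      (\<forall>y. v y \<le> u y + \<delta>) \<and> (\<forall>y q. F y q \<le> F' y q + \<delta> + 0 * dist y x)"
    proof (intro exI conjI allI)
      show "continuous_on UNIV (w n)" by (rule cw)
      show "viscosity_subsolution (F' n) (w n)" by (rule shift)
      show "u x - \<delta> \<le> w n x" using n(1)[of x] by linarith
      show "w n y \<le> u y + \<delta>" for y using n(1)[of y] by linarith
      show "F y q \<le> F' n y q + \<delta> + 0 * dist y x" for y q using n(2)[of y q] by simp
    qed
  qed
  moreover have "viscosity_supersolution F u"
  proof (rule supersolution_stable[OF cF order_refl])
    fix x and \<delta> :: real assume "\<delta> > 0"
    from close[OF this] obtain n where n: "\<And>x. \<bar>w n x - u x\<bar> < \<delta>" "\<And>x q. \<bar>F' n x q - F x q\<bar> < \<delta>" by blast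
    show "\<exists>v F'. continuous_on UNIV v \<and> viscosity_supersolution F' v \<and> v x \<le> u x + \<delta> \<and>
      (\<forall>y. u y - \<delta> \<le> v y) \<and> (\<forall>y q. F' y q - \<delta> - 0 * dist y x \<le> F y q)"
    proof (intro exI conjI allI)
      show "continuous_on UNIV (w n)" by (rule cw)
      show "viscosity_supersolution (F' n) (w n)" by (rule shift)
      show "w n x \<le> u x + \<delta>" using n(1)[of x] by linarith
      show "u y - \<delta> \<le> w n y" for y using n(1)[of y] by linarith
      show "F' n y q - \<delta> - 0 * dist y x \<le> F y q" for y q using n(2)[of y q] by simp
    qed
  qed
  ultimately have "viscosity_solution (cell V p \<mu>) u" using cu by (simp add: viscosity_solution_def F_def)
  moreover have "bounded (range u)" using bu by (auto simp: bounded_iff)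
  moreover have "\<forall>a. (\<forall>y. V (y + a) = V y) \<longrightarrow> (\<forall>x. u (x + a) = u x)" using invu by blast
  ultimately show ?thesis using that by blast
qed

section \<open>Symmetries and additivity of the cell constant\<close>

lemma eventually_nhds_compose:
  assumes "isCont f z" "eventually P (nhds (f z))"
  shows "\<forall>\<^sub>F y in nhds z. P (f y)"
  using assms eventually_compose_filterlim unfolding isCont_def tendsto_at_iff_tendsto_nhds by blast

lemma affine_subsolution:
  fixes v :: "'a::euclidean_space \<Rightarrow> real"
  assumes sub: "viscosity_subsolution F v" and c: "c \<noteq> 0"
  shows "viscosity_subsolution (\<lambda>x q. F ((1 / c) *\<^sub>R x + x0) (sgn c *\<^sub>R q)) (\<lambda>x. \<bar>c\<bar> * v ((1 / c) *\<^sub>R x + x0))"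
  unfolding viscosity_subsolution_def
proof (intro allI impI, elim conjE)
  fix \<phi> g x
  assume C1: "C1_with_gradient \<phi> g" and t: "\<forall>\<^sub>F y in nhds x.
    \<bar>c\<bar> * v ((1 / c) *\<^sub>R y + x0) - \<phi> y \<le> \<bar>c\<bar> * v ((1 / c) *\<^sub>R x + x0) - \<phi> x"
  define z where "z = (1 / c) *\<^sub>R x + x0"
  define b where "b = - c *\<^sub>R x0"
  have z: "c *\<^sub>R z + b = x" using c by (simp add: z_def b_def algebra_simps)
  have inv: "(1 / c) *\<^sub>R (c *\<^sub>R y + b) + x0 = y" for y using c by (simp add: b_def algebra_simps)
  define \<psi> where "\<psi> = (\<lambda>y. (1 / \<bar>c\<bar>) * \<phi> (c *\<^sub>R y + b))"
  define h where "h = (\<lambda>y. (1 / \<bar>c\<bar>) *\<^sub>R (c *\<^sub>R g (c *\<^sub>R y + b)))"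
  have C1': "C1_with_gradient \<psi> h"
    unfolding \<psi>_def h_def by (intro C1_scale C1_affine[OF C1]) (auto simp: linear_scaleR)
  have "isCont (\<lambda>y. c *\<^sub>R y + b) z" by (intro continuous_intros)
  from eventually_nhds_compose[OF this, of "\<lambda>y. \<bar>c\<bar> * v ((1 / c) *\<^sub>R y + x0) - \<phi> y \<le> \<bar>c\<bar> * v ((1 / c) *\<^sub>R x + x0) - \<phi> x"] t
  have "\<forall>\<^sub>F y in nhds z. \<bar>c\<bar> * v y - \<phi> (c *\<^sub>R y + b) \<le> \<bar>c\<bar> * v z - \<phi> (c *\<^sub>R z + b)"
    unfolding z inv z_def[symmetric] by simp
  then have "\<forall>\<^sub>F y in nhds z. v y - \<psi> y \<le> v z - \<psi> z"
  proof eventually_elim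
    case (elim y)
    then have "\<bar>c\<bar> * (v y - \<psi> y) \<le> \<bar>c\<bar> * (v z - \<psi> z)" using c by (simp add: \<psi>_def right_diff_distrib)
    then show ?case using c by simp
  qed
  from subsolutionD[OF sub C1' this] have "F z (h z) \<le> 0" .
  moreover have "h z = sgn c *\<^sub>R g x" unfolding h_def z by (simp add: sgn_real_def abs_if)
  ultimately show "F ((1 / c) *\<^sub>R x + x0) (sgn c *\<^sub>R g x) \<le> 0" by (simp add: z_def)
qed

lemma affine_supersolution:
  fixes v :: "'a::euclidean_space \<Rightarrow> real"
  assumes "viscosity_supersolution F v" "c \<noteq> 0"
  shows "viscosity_supersolution (\<lambda>x q. F ((1 / c) *\<^sub>R x + x0) (sgn c *\<^sub>R q)) (\<lambda>x. \<bar>c\<bar> * v ((1 / c) *\<^sub>R x + x0))"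
  using affine_subsolution[OF assms(1)[unfolded supersolution_iff_subsolution_uminus] assms(2), of x0]
  unfolding supersolution_iff_subsolution_uminus by simp

lemma cell_value_affine:
  assumes "cell_value V p \<mu>" and c: "c \<noteq> 0"
  shows "cell_value (\<lambda>x. V ((1 / c) *\<^sub>R x + x0)) (sgn c *\<^sub>R p) \<mu>"
proof -
  obtain v where v: "continuous_on UNIV v" "bounded (range v)"
    "viscosity_subsolution (cell V p \<mu>) v" "viscosity_supersolution (cell V p \<mu>) v"
    using assms(1) unfolding cell_value_def viscosity_solution_def by blast
  define w where "w = (\<lambda>x. \<bar>c\<bar> * v ((1 / c) *\<^sub>R x + x0))"
  have n: "norm (p + sgn c *\<^sub>R q) = norm (sgn c *\<^sub>R p + q)" for q
  proof -
    have "sgn c * sgn c = 1" using c by (simp add: sgn_real_def)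
    then have "p + sgn c *\<^sub>R q = sgn c *\<^sub>R (sgn c *\<^sub>R p + q)" by (simp add: scaleR_add_right)
    then show ?thesis using c by (simp add: sgn_real_def)
  qed
  have "viscosity_subsolution (cell (\<lambda>x. V ((1 / c) *\<^sub>R x + x0)) (sgn c *\<^sub>R p) \<mu>) w"
    "viscosity_supersolution (cell (\<lambda>x. V ((1 / c) *\<^sub>R x + x0)) (sgn c *\<^sub>R p) \<mu>) w"
    using affine_subsolution[OF v(3) c, of x0] affine_supersolution[OF v(4) c, of x0] unfolding w_def n by simp_all
  moreover have "continuous_on UNIV w"
    unfolding w_def by (intro continuous_intros continuous_on_compose2[OF v(1)]) auto
  moreover have "bounded (range w)"
  proof -
    obtain B where "\<And>x. \<bar>v x\<bar> \<le> B" using v(2) by (auto simp: bounded_iff)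
    then have "\<bar>w x\<bar> \<le> \<bar>c\<bar> * B" for x unfolding w_def abs_mult by (simp add: mult_left_mono)
    then show ?thesis by (auto simp: bounded_iff)
  qed
  ultimately show ?thesis unfolding cell_value_def viscosity_solution_def by blast
qed

text \<open>A steep paraboloid centred at \<open>x\<close> touches the subsolution from above near \<open>x\<close>, and the kinetic
energy there is non-negative.\<close>

lemma potential_le_of_subsolution:
  fixes v :: "'a::euclidean_space \<Rightarrow> real"
  assumes cV: "continuous_on UNIV V" and v: "continuous_on UNIV v" "viscosity_subsolution (cell V p \<mu>) v"
  shows "V x \<le> \<mu>"
proof (rule ccontr)
  assume less: "\<not> V x \<le> \<mu>"
  have "isCont V x" using cV by (simp add: continuous_on_eq_continuous_at)
  then obtain r where r: "r > 0" "\<And>y. dist y x < r \<Longrightarrow> \<bar>V y - V x\<bar> < V x - \<mu>"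
    using less unfolding continuous_at_eps_delta dist_real_def by (metis diff_gt_0_iff_gt not_le)
  have "\<exists>y0\<in>cball x r. \<forall>y\<in>cball x r. v y \<le> v y0"
    using r by (intro continuous_attains_sup continuous_on_subset[OF v(1)]) auto
  then obtain y0 where y0: "\<And>y. y \<in> cball x r \<Longrightarrow> v y \<le> v y0" by blast
  define D where "D = v y0 - v x + 1"
  have D: "D \<ge> 1" using y0[of x] r by (simp add: D_def)
  define \<phi> where "\<phi> = (\<lambda>y. (D / r\<^sup>2) * (norm (y - x))\<^sup>2)"
  have C1: "C1_with_gradient \<phi> (\<lambda>y. (D / r\<^sup>2) *\<^sub>R (2 *\<^sub>R (y - x)))"
    unfolding \<phi>_def by (intro C1_scale C1_sqdist)
  have "continuous_on (cball x r) (\<lambda>y. v y - \<phi> y)"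
    using v(1) C1_with_gradientD(3)[OF C1] by (auto intro!: continuous_intros elim: continuous_on_subset)
  then obtain z where z: "z \<in> cball x r" "\<And>y. y \<in> cball x r \<Longrightarrow> v y - \<phi> y \<le> v z - \<phi> z"
    using continuous_attains_sup[of "cball x r" "\<lambda>y. v y - \<phi> y"] r by auto
  have "z \<in> ball x r"
  proof (rule ccontr)
    assume "z \<notin> ball x r"
    then have "norm (z - x) = r" using z(1) by (auto simp: dist_norm norm_minus_commute)
    then have "\<phi> z = D" using r by (simp add: \<phi>_def)
    then show False using z(2)[of x] y0[OF z(1)] r by (simp add: \<phi>_def D_def)
  qed
  then have "\<forall>\<^sub>F y in nhds z. v y - \<phi> y \<le> v z - \<phi> z"
    using z(2) by (intro eventually_mono[OF eventually_nhds_in_open[of "ball x r"]]) auto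
  from subsolutionD[OF v(2) C1 this] have "V z \<le> \<mu>" using zero_le_power2 by (smt (verit) divide_nonneg_nonneg)
  moreover have "\<bar>V z - V x\<bar> < V x - \<mu>" using r(2)[of z] \<open>z \<in> ball x r\<close> by (simp add: dist_commute)
  ultimately show False by linarith
qed

lemma cell_value_ge_potential:
  assumes "buc V" "cell_value V p \<mu>"
  shows "V x \<le> \<mu>"
  using assms potential_le_of_subsolution[OF bucD(3)[OF assms(1)]]
  unfolding cell_value_def viscosity_solution_def by blast

lemma cell_value_zero_le:
  assumes "buc V" "cell_value V 0 \<mu>" "\<And>x. V x \<le> c"
  shows "\<mu> \<le> c"
  by (rule cell_value_le_of_C1[OF assms(1,2) C1_const[of 0]]) (use assms(3) in auto)

text \<open>The kinetic energy is convex and even, so \<open>v\<close> is a subsolution if and only if \<open>u = v + p \<bullet> x\<close> has local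
Lipschitz constant at most \<open>sqrt (2 * (\<mu> - V))\<close>, and this property is shared by \<open>- u\<close>. In detail: if the equation
failed for a test function with gradient \<open>g x\<close>, the cone estimate would bound the slope of \<open>u\<close> at \<open>x\<close> by
some \<open>M < norm (p - g x)\<close>, while the test function forces \<open>u\<close> to grow with slope \<open>norm (p - g x)\<close> in the
direction \<open>p - g x\<close>.\<close>

lemma subsolution_reflect:
  fixes v :: "'a::euclidean_space \<Rightarrow> real"
  assumes cV: "continuous_on UNIV V" and v: "continuous_on UNIV v" "viscosity_subsolution (cell V p \<mu>) v"
  shows "viscosity_subsolution (cell V (- p) \<mu>) (\<lambda>x. - v x)"
  unfolding viscosity_subsolution_def
proof (intro allI impI, elim conjE)
  fix \<phi> g x
  assume C1: "C1_with_gradient \<phi> g" and t: "\<forall>\<^sub>F y in nhds x. - v y - \<phi> y \<le> - v x - \<phi> x"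
  define h where "h = p - g x"
  show "cell V (- p) \<mu> x (g x) \<le> 0"
  proof (rule ccontr)
    assume "\<not> ?thesis"
    then have gt: "(norm h)\<^sup>2 > 2 * (\<mu> - V x)" by (simp add: h_def norm_minus_commute algebra_simps)
    have V0: "V x \<le> \<mu>" by (rule potential_le_of_subsolution[OF cV v])
    \<comment> \<open>\<open>M\<^sup>2\<close> is the midpoint of \<open>2 * (\<mu> - V x)\<close> and \<open>(norm h)\<^sup>2\<close>: above the admissible slopes near \<open>x\<close>, below the slope of the test function.\<close>
    define M where "M = sqrt (((norm h)\<^sup>2 + 2 * (\<mu> - V x)) / 2)"
    have M2: "M\<^sup>2 = ((norm h)\<^sup>2 + 2 * (\<mu> - V x)) / 2" and M0: "M \<ge> 0"
      unfolding M_def using V0 by simp_all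
    have M1: "2 * (\<mu> - V x) < M\<^sup>2" unfolding M2 using gt by argo
    have M1': "M\<^sup>2 < (norm h)\<^sup>2" unfolding M2 using gt by argo
    have Mh: "M < norm h" using M1' by (simp add: power2_less_imp_less)
    have "isCont V x" using cV by (simp add: continuous_on_eq_continuous_at)
    then obtain R where R: "R > 0" "\<And>y. dist y x < R \<Longrightarrow> \<bar>V y - V x\<bar> < (M\<^sup>2 - 2 * (\<mu> - V x)) / 2"
      using M1 unfolding continuous_at_eps_delta dist_real_def by (metis diff_gt_0_iff_gt half_gt_zero)
    define u where "u = (\<lambda>y. v y + p \<bullet> y)"
    have cu: "continuous_on UNIV u" unfolding u_def by (intro continuous_intros v(1))
    have "\<exists>y0\<in>cball x R. \<forall>y\<in>cball x R. u y \<le> u y0"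
      using R by (intro continuous_attains_sup continuous_on_subset[OF cu]) auto
    then obtain y0 where y0: "\<And>y. y \<in> cball x R \<Longrightarrow> u y \<le> u y0" by blast
    define L where "L = (u y0 - u x) / R\<^sup>2"
    have cone: "u y - u x \<le> M * norm (y - x) + L * (norm (y - x))\<^sup>2" if "y \<in> cball x R" for y
      unfolding L_def
    proof (rule cone_bound[OF cu R(1) M0 _ _ that])
      show "u y - u x \<le> u y0 - u x" if "y \<in> cball x R" for y using y0[OF that] by simp
      fix \<psi> k y
      assume C1': "C1_with_gradient \<psi> k" and y: "y \<in> ball x R" and t': "\<forall>\<^sub>F z in nhds y. u z - \<psi> z \<le> u y - \<psi> y"
      have "\<forall>\<^sub>F z in nhds y. v z - (\<psi> z - p \<bullet> z) \<le> v y - (\<psi> y - p \<bullet> y)"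
        using t' by eventually_elim (simp add: u_def)
      from subsolutionD[OF v(2) C1_diff[OF C1' C1_inner] this]
      have "(norm (k y))\<^sup>2 \<le> 2 * (\<mu> - V y)" by simp
      also have "\<dots> \<le> M\<^sup>2"
      proof -
        have "\<bar>V y - V x\<bar> < (M\<^sup>2 - 2 * (\<mu> - V x)) / 2" using R(2)[of y] y by (simp add: dist_commute)
        then show ?thesis by (simp add: abs_if field_simps split: if_splits)
      qed
      finally show "norm (k y) \<le> M" using M0 by (simp add: power2_le_iff_abs_le)
    qed
    obtain \<epsilon> where \<epsilon>: "\<epsilon> > 0" "\<And>y. dist y x < \<epsilon> \<Longrightarrow> - v y - \<phi> y \<le> - v x - \<phi> x"
      using t unfolding eventually_nhds_metric by blast
    define e where "e = (1 / norm h) *\<^sub>R h"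
    have hn: "norm h > 0" using Mh M0 by linarith
    have ne: "norm e = 1" using hn by (simp add: e_def)
    have he: "h \<bullet> e = norm h" using hn by (simp add: e_def power2_norm_eq_inner[symmetric] power2_eq_square)
    define f where "f = (\<lambda>s. s * (p \<bullet> e) - (\<phi> (x + s *\<^sub>R e) - \<phi> x))"
    have "((\<lambda>s. x + s *\<^sub>R e) has_derivative (\<lambda>k. k *\<^sub>R e)) (at 0)" by (auto intro!: derivative_eq_intros)
    from has_derivative_compose[OF this, of \<phi> "\<lambda>k. g x \<bullet> k"] C1_with_gradientD(1)[OF C1, of x]
    have "((\<lambda>s. \<phi> (x + s *\<^sub>R e)) has_real_derivative (g x \<bullet> e)) (at 0)"
      by (simp add: has_field_derivative_def mult_commute_abs)
    then have "(f has_real_derivative norm h) (at 0)"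
      unfolding f_def using he by (auto intro!: derivative_eq_intros simp: inner_diff_left h_def)
    then have lim: "((\<lambda>s. f s / s) \<longlongrightarrow> norm h) (at_right 0)"
      unfolding DERIV_def by (simp add: f_def filterlim_at_split)
    have le: "\<forall>\<^sub>F s in at_right 0. f s / s \<le> M + L * s"
    proof -
      have "f s / s \<le> M + L * s" if s: "0 < s" "s < min \<epsilon> R" for s
      proof -
        have d: "dist (x + s *\<^sub>R e) x = s" "norm ((x + s *\<^sub>R e) - x) = s" using s ne by (simp_all add: dist_norm)
        have "v (x + s *\<^sub>R e) - v x \<ge> - (\<phi> (x + s *\<^sub>R e) - \<phi> x)" using \<epsilon>(2)[of "x + s *\<^sub>R e"] s d by simp
        then have "f s \<le> u (x + s *\<^sub>R e) - u x" by (simp add: f_def u_def inner_add_right)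
        also have "\<dots> \<le> M * s + L * s\<^sup>2"
          using cone[of "x + s *\<^sub>R e"] s d by (simp add: dist_commute)
        finally show ?thesis using s by (simp add: field_simps power2_eq_square)
      qed
      then show ?thesis using \<epsilon>(1) R(1) unfolding eventually_at_right_field
        by (intro exI[of _ "min \<epsilon> R"]) auto
    qed
    have "((\<lambda>s. M + L * s) \<longlongrightarrow> M + L * 0) (at_right 0)" by (intro tendsto_intros)
    from tendsto_le[OF _ this lim le] have "norm h \<le> M" by simp
    then show False using Mh by simp
  qed
qed

text \<open>The constant is the least one that admits a bounded subsolution, and subsolutions can be reflected.\<close>

lemma cell_value_even:
  assumes V: "buc V" and "cell_value V p \<mu>" "cell_value V (- p) \<mu>'"
  shows "\<mu> = \<mu>'"
proof -
  have "\<mu>2 \<le> \<mu>1" if q: "cell_value V q \<mu>1" "cell_value V (- q) \<mu>2" for q \<mu>1 \<mu>2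
  proof -
    obtain v where v: "continuous_on UNIV v" "bounded (range v)" "viscosity_subsolution (cell V q \<mu>1) v"
      using q(1) unfolding cell_value_def viscosity_solution_def by blast
    have bd: "bounded (range (\<lambda>x. - v x))" using v(2) bounded_uminus[of "range v"] by (simp add: image_image)
    show ?thesis
      by (rule cell_value_le_subsolution[OF V q(2) continuous_on_minus[OF v(1)] bd
            subsolution_reflect[OF bucD(3)[OF V] v(1,3)]])
  qed
  from this[OF assms(2,3)] this[of "- p" \<mu>' \<mu>] assms(2,3) show ?thesis by simp
qed

text \<open>A factor \<open>c < 0\<close> turns the momentum \<open>p\<close> into \<open>- p\<close>, which evenness of the cell constant repairs.\<close>

lemma cell_value_dilation:
  assumes V1: "buc V1" and c: "c \<noteq> 0" and eq: "\<And>x. V1 x = V2 ((1 / c) *\<^sub>R x + x0)"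
    and cv: "cell_value V1 p \<mu>1" "cell_value V2 p \<mu>2"
  shows "\<mu>1 = \<mu>2"
proof -
  have *: "cell_value V1 (sgn c *\<^sub>R p) \<mu>2"
  proof -
    have "V1 = (\<lambda>x. V2 ((1 / c) *\<^sub>R x + x0))" by (rule ext) (rule eq)
    then show ?thesis using cell_value_affine[OF cv(2) c, of x0] by simp
  qed
  show ?thesis
  proof (cases "c > 0")
    case True
    then show ?thesis using * cell_value_unique[OF V1 cv(1)] by simp
  next
    case False
    then show ?thesis using * c cell_value_even[OF V1 cv(1)] by simp
  qed
qed

text \<open>At the points \<open>x + P (y - x)\<close> the invariances give \<open>v1\<close> the value \<open>v1 y\<close> and \<open>v2\<close> the value \<open>v2 x\<close>, so the test function,
composed with this map, tests \<open>v1\<close> alone.\<close>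

lemma touching_split:
  fixes v1 v2 :: "'a::euclidean_space \<Rightarrow> real"
  assumes P: "linear P" "\<And>x y. P x \<bullet> y = x \<bullet> P y"
    and inv: "\<And>x z. v1 (x + (z - P z)) = v1 x" "\<And>x z. v2 (x + P z) = v2 x"
    and C1: "C1_with_gradient \<phi> g" and t: "\<forall>\<^sub>F y in nhds x. (v1 y + v2 y) - \<phi> y \<le> (v1 x + v2 x) - \<phi> x"
  obtains \<psi> h where "C1_with_gradient \<psi> h" "h x = P (g x)" "\<forall>\<^sub>F y in nhds x. v1 y - \<psi> y \<le> v1 x - \<psi> x"
proof
  show "C1_with_gradient (\<lambda>y. \<phi> (P y + (x - P x))) (\<lambda>y. P (g (P y + (x - P x))))"
    by (rule C1_affine[OF C1 P(1,1,2)])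
  show "P (g (P x + (x - P x))) = P (g x)" by simp
  have "isCont (\<lambda>y. P y + (x - P x)) x"
    using linear_continuous_at P(1) linear_conv_bounded_linear by (intro continuous_intros) blast
  from eventually_nhds_compose[OF this, of "\<lambda>y. (v1 y + v2 y) - \<phi> y \<le> (v1 x + v2 x) - \<phi> x"] t
  have "\<forall>\<^sub>F y in nhds x. (v1 (P y + (x - P x)) + v2 (P y + (x - P x))) - \<phi> (P y + (x - P x)) \<le> (v1 x + v2 x) - \<phi> x"
    by simp
  then show "\<forall>\<^sub>F y in nhds x. v1 y - \<phi> (P y + (x - P x)) \<le> v1 x - \<phi> (P x + (x - P x))"
  proof eventually_elim
    case (elim y)
    have lin: "P (y - x) = P y - P x" using P(1) by (rule linear_diff)
    have "v1 (P y + (x - P x)) = v1 y"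
      using inv(1)[of "P y + (x - P x)" "y - x"] lin by (simp add: algebra_simps)
    moreover have "v2 (P y + (x - P x)) = v2 x"
      using inv(2)[of x "y - x"] lin by (simp add: algebra_simps)
    ultimately show ?case using elim by simp
  qed
qed

lemma cell_subsolution_sum:
  fixes v1 v2 :: "'a::euclidean_space \<Rightarrow> real"
  assumes P: "linear P" "\<And>x y. P x \<bullet> y = x \<bullet> P y" "\<And>x. P (P x) = P x"
    and inv: "\<And>x z. v1 (x + (z - P z)) = v1 x" "\<And>x z. v2 (x + P z) = v2 x"
  shows "viscosity_subsolution (cell W1 (P p) \<mu>1) v1 \<Longrightarrow> viscosity_subsolution (cell W2 (p - P p) \<mu>2) v2 \<Longrightarrow>
      viscosity_subsolution (cell (\<lambda>x. W1 x + W2 x) p (\<mu>1 + \<mu>2)) (\<lambda>x. v1 x + v2 x)"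
    and "viscosity_supersolution (cell W1 (P p) \<mu>1) v1 \<Longrightarrow> viscosity_supersolution (cell W2 (p - P p) \<mu>2) v2 \<Longrightarrow>
      viscosity_supersolution (cell (\<lambda>x. W1 x + W2 x) p (\<mu>1 + \<mu>2)) (\<lambda>x. v1 x + v2 x)"
proof -
  define Q where "Q = (\<lambda>x. x - P x)"
  have Q: "linear Q" "\<And>x y. Q x \<bullet> y = x \<bullet> Q y"
    using P(1,2) by (auto simp: Q_def inner_diff_left inner_diff_right intro!: linear_compose_sub linear_ident)
  have QP: "z - Q z = P z" for z by (simp add: Q_def)
  have pyth: "(norm (P p + P q))\<^sup>2 + (norm (Q p + Q q))\<^sup>2 = (norm (p + q))\<^sup>2" for q
  proof -
    have "P p + P q = P (p + q)" "Q p + Q q = Q (p + q)" using P(1) Q(1) by (simp_all add: linear_add)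
    moreover have "P (p + q) \<bullet> Q (p + q) = 0" by (simp add: Q_def inner_diff_right P)
    moreover have "p + q = P (p + q) + Q (p + q)" by (simp add: Q_def)
    ultimately show ?thesis by (metis norm_add_Pythagorean orthogonal_def)
  qed
  { assume s: "viscosity_subsolution (cell W1 (P p) \<mu>1) v1" "viscosity_subsolution (cell W2 (p - P p) \<mu>2) v2"
    show "viscosity_subsolution (cell (\<lambda>x. W1 x + W2 x) p (\<mu>1 + \<mu>2)) (\<lambda>x. v1 x + v2 x)"
      unfolding viscosity_subsolution_def
    proof (intro allI impI, elim conjE)
      fix \<phi> g x
      assume C1: "C1_with_gradient \<phi> g" and t: "\<forall>\<^sub>F y in nhds x. (v1 y + v2 y) - \<phi> y \<le> (v1 x + v2 x) - \<phi> x"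
      obtain \<psi> h where 1: "C1_with_gradient \<psi> h" "h x = P (g x)" "\<forall>\<^sub>F y in nhds x. v1 y - \<psi> y \<le> v1 x - \<psi> x"
        using touching_split[OF P(1,2) inv C1 t] by blast
      have t': "\<forall>\<^sub>F y in nhds x. (v2 y + v1 y) - \<phi> y \<le> (v2 x + v1 x) - \<phi> x"
        using t by (simp add: add.commute)
      obtain \<psi>' h' where 2: "C1_with_gradient \<psi>' h'" "h' x = Q (g x)" "\<forall>\<^sub>F y in nhds x. v2 y - \<psi>' y \<le> v2 x - \<psi>' x"
        using touching_split[OF Q, of v2 v1 \<phi> g x] inv C1 t' unfolding QP unfolding Q_def by blast
      show "cell (\<lambda>x. W1 x + W2 x) p (\<mu>1 + \<mu>2) x (g x) \<le> 0"
        using subsolutionD[OF s(1) 1(1,3)] subsolutionD[OF s(2) 2(1,3)] pyth[of "g x"]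
        unfolding 1(2) 2(2) Q_def by simp
    qed }
  { assume s: "viscosity_supersolution (cell W1 (P p) \<mu>1) v1" "viscosity_supersolution (cell W2 (p - P p) \<mu>2) v2"
    show "viscosity_supersolution (cell (\<lambda>x. W1 x + W2 x) p (\<mu>1 + \<mu>2)) (\<lambda>x. v1 x + v2 x)"
      unfolding viscosity_supersolution_def
    proof (intro allI impI, elim conjE)
      fix \<phi> g x
      assume C1: "C1_with_gradient \<phi> g" and t: "\<forall>\<^sub>F y in nhds x. (v1 y + v2 y) - \<phi> y \<ge> (v1 x + v2 x) - \<phi> x"
      have ninv: "\<And>x z. - v1 (x + (z - P z)) = - v1 x" "\<And>x z. - v2 (x + P z) = - v2 x" using inv by auto
      have t1: "\<forall>\<^sub>F y in nhds x. (- v1 y + - v2 y) - - \<phi> y \<le> (- v1 x + - v2 x) - - \<phi> x"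
        using t by eventually_elim simp
      obtain \<psi> h where 1: "C1_with_gradient \<psi> h" "h x = P (- g x)" "\<forall>\<^sub>F y in nhds x. - v1 y - \<psi> y \<le> - v1 x - \<psi> x"
        using touching_split[OF P(1,2) ninv C1_uminus[OF C1] t1] by blast
      have t2: "\<forall>\<^sub>F y in nhds x. (- v2 y + - v1 y) - - \<phi> y \<le> (- v2 x + - v1 x) - - \<phi> x"
        using t by eventually_elim simp
      obtain \<psi>' h' where 2: "C1_with_gradient \<psi>' h'" "h' x = Q (- g x)" "\<forall>\<^sub>F y in nhds x. - v2 y - \<psi>' y \<le> - v2 x - \<psi>' x"
        using touching_split[OF Q, of "\<lambda>x. - v2 x" "\<lambda>x. - v1 x" "\<lambda>x. - \<phi> x" "\<lambda>x. - g x" x] ninv C1_uminus[OF C1] t2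
        unfolding QP unfolding Q_def by blast
      have e1: "\<forall>\<^sub>F y in nhds x. v1 y - - \<psi> y \<ge> v1 x - - \<psi> x" using 1(3) by eventually_elim simp
      have e2: "\<forall>\<^sub>F y in nhds x. v2 y - - \<psi>' y \<ge> v2 x - - \<psi>' x" using 2(3) by eventually_elim simp
      have n: "- P (- g x) = P (g x)" "- Q (- g x) = Q (g x)" using P(1) Q(1) by (simp_all add: linear_neg)
      show "cell (\<lambda>x. W1 x + W2 x) p (\<mu>1 + \<mu>2) x (g x) \<ge> 0"
        using supersolutionD[OF s(1) C1_uminus[OF 1(1)] e1] supersolutionD[OF s(2) C1_uminus[OF 2(1)] e2] pyth[of "g x"]
        unfolding 1(2) 2(2) n unfolding Q_def by simp
    qed }
qed

text \<open>The solutions supplied by \<open>cell_solution_exists\<close> depend only on the variables of their own potential.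
By Pythagoras, their sum solves the problem for the sum of the potentials.\<close>

lemma cell_value_orthogonal_sum:
  fixes W1 W2 :: "'a::euclidean_space \<Rightarrow> real"
  assumes P: "linear P" "\<And>x y. P x \<bullet> y = x \<bullet> P y" "\<And>x. P (P x) = P x"
    and W: "buc W1" "buc W2" "buc (\<lambda>x. W1 x + W2 x)"
    and inv: "\<And>x z. W1 (x + (z - P z)) = W1 x" "\<And>x z. W2 (x + P z) = W2 x"
    and cocompact: "\<And>x. \<exists>a. (\<forall>y. W1 (y + a) = W1 y) \<and> norm (x - a) \<le> R"
      "\<And>x. \<exists>a. (\<forall>y. W2 (y + a) = W2 y) \<and> norm (x - a) \<le> R"
    and cv: "cell_value W1 (P p) \<mu>1" "cell_value W2 (p - P p) \<mu>2" "cell_value (\<lambda>x. W1 x + W2 x) p \<mu>"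
  shows "\<mu> = \<mu>1 + \<mu>2"
proof -
  obtain \<nu>1 v1 where v1: "bounded (range v1)" "viscosity_solution (cell W1 (P p) \<nu>1) v1"
    "\<forall>a. (\<forall>y. W1 (y + a) = W1 y) \<longrightarrow> (\<forall>x. v1 (x + a) = v1 x)"
    by (rule cell_solution_exists[OF W(1) cocompact(1), where p = "P p"]) (rule that)
  obtain \<nu>2 v2 where v2: "bounded (range v2)" "viscosity_solution (cell W2 (p - P p) \<nu>2) v2"
    "\<forall>a. (\<forall>y. W2 (y + a) = W2 y) \<longrightarrow> (\<forall>x. v2 (x + a) = v2 x)"
    by (rule cell_solution_exists[OF W(2) cocompact(2), where p = "p - P p"]) (rule that)
  have "cell_value W1 (P p) \<nu>1" using v1(1,2) unfolding cell_value_def by blast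
  then have \<nu>1: "\<nu>1 = \<mu>1" using cell_value_unique[OF W(1) _ cv(1)] by blast
  have "cell_value W2 (p - P p) \<nu>2" using v2(1,2) unfolding cell_value_def by blast
  then have \<nu>2: "\<nu>2 = \<mu>2" using cell_value_unique[OF W(2) _ cv(2)] by blast
  have inv1: "v1 (x + (z - P z)) = v1 x" for x z using v1(3) inv(1) by blast
  have inv2: "v2 (x + P z) = v2 x" for x z using v2(3) inv(2) by blast
  have "viscosity_solution (cell (\<lambda>x. W1 x + W2 x) p (\<nu>1 + \<nu>2)) (\<lambda>x. v1 x + v2 x)"
    using v1(2) v2(2) cell_subsolution_sum[of P v1 v2, OF P inv1 inv2] unfolding viscosity_solution_def
    by (intro conjI continuous_on_add) simp_all
  moreover have "bounded (range (\<lambda>x. v1 x + v2 x))" using v1(1) v2(1) by (rule bounded_plus_comp)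
  ultimately have "cell_value (\<lambda>x. W1 x + W2 x) p (\<nu>1 + \<nu>2)" unfolding cell_value_def by blast
  then show ?thesis using cell_value_unique[OF W(3) cv(3)] \<nu>1 \<nu>2 by simp
qed

section \<open>Expansion at large momentum\<close>

text \<open>Bounded gradients keep the remainders of the expansion uniform in space.\<close>

definition tame :: "('a::euclidean_space \<Rightarrow> real) \<Rightarrow> ('a \<Rightarrow> 'a) \<Rightarrow> bool" where
  "tame \<phi> g \<longleftrightarrow> C1_with_gradient \<phi> g \<and> bounded (range \<phi>) \<and> bounded (range g)"

lemma tame_scale:
  assumes "tame \<phi> g"
  shows "tame (\<lambda>x. c * \<phi> x) (\<lambda>x. c *\<^sub>R g x)"
  using assms C1_scale[of \<phi> g c] bounded_scaling[of "range g" c] bounded_scaling[of "range \<phi>" c]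
  by (simp add: tame_def image_image)

lemma tame_add:
  assumes "tame \<phi> g" "tame \<psi> h"
  shows "tame (\<lambda>x. \<phi> x + \<psi> x) (\<lambda>x. g x + h x)"
  using assms by (simp add: tame_def C1_add bounded_plus_comp)

lemma tame_sum:
  assumes "\<And>i. i \<in> I \<Longrightarrow> tame (\<phi> i) (g i)"
  shows "tame (\<lambda>x. \<Sum>i\<in>I. \<phi> i x) (\<lambda>x. \<Sum>i\<in>I. g i x)"
  using assms
proof (induction I rule: infinite_finite_induct)
  case (insert i I)
  then show ?case using tame_add[of "\<phi> i" "g i"] by simp
qed (auto simp: tame_def C1_const image_constant_conv)

lemma bounded_range_scaleR:
  fixes f :: "'b \<Rightarrow> real" and g :: "'b \<Rightarrow> 'c::real_normed_vector"
  assumes "bounded (range f)" "bounded (range g)"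
  shows "bounded (range (\<lambda>x. f x *\<^sub>R g x))"
proof -
  obtain B C where B: "\<And>x. \<bar>f x\<bar> \<le> B" and C: "\<And>x. norm (g x) \<le> C"
    using assms by (auto simp: bounded_iff)
  have "norm (f x *\<^sub>R g x) \<le> B * C" for x
    using mult_mono[OF B[of x] C[of x]] B[of x] by simp
  then show ?thesis by (auto simp: bounded_iff)
qed

lemma tame_mult:
  assumes "tame \<phi> g" "tame \<psi> h"
  shows "tame (\<lambda>x. \<phi> x * \<psi> x) (\<lambda>x. \<phi> x *\<^sub>R h x + \<psi> x *\<^sub>R g x)"
  using assms C1_mult[of \<phi> g \<psi> h] bounded_range_scaleR[of \<phi> \<psi>]
  by (simp add: tame_def bounded_plus_comp bounded_range_scaleR)

lemma tame_wave:
  assumes f: "\<And>t. (f has_real_derivative f' t) (at t)" "continuous_on UNIV f'"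
    and bd: "bounded (range f)" "bounded (range f')"
  shows "tame (\<lambda>x. f (k \<bullet> x + b)) (\<lambda>x. f' (k \<bullet> x + b) *\<^sub>R k)"
proof -
  have "C1_with_gradient (\<lambda>x. f (k \<bullet> x + b)) (\<lambda>x. f' (k \<bullet> x + b) *\<^sub>R (k + 0))"
    by (rule C1_compose[OF C1_add[OF C1_inner C1_const] f])
  moreover have "bounded (range (\<lambda>x. f (k \<bullet> x + b)))" by (rule bounded_subset[OF bd(1)]) auto
  moreover have "bounded (range (\<lambda>x. f' (k \<bullet> x + b)))" by (rule bounded_subset[OF bd(2)]) auto
  ultimately show ?thesis
    using bounded_range_scaleR[of "\<lambda>x. f' (k \<bullet> x + b)" "\<lambda>x. k"] by (simp add: tame_def image_constant_conv)
qed

lemma bounded_range_sin_cos: "bounded (range (sin :: real \<Rightarrow> real))" "bounded (range (cos :: real \<Rightarrow> real))"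
  by (auto simp: bounded_iff intro!: exI[of _ 1])

lemma tame_sin: "tame (\<lambda>x. sin (k \<bullet> x + b)) (\<lambda>x. cos (k \<bullet> x + b) *\<^sub>R k)"
  by (rule tame_wave) (auto intro!: derivative_eq_intros continuous_intros simp: bounded_range_sin_cos)

text \<open>The test function \<open>\<Phi> / t + \<Psi> / t^3\<close> at momentum \<open>t *\<^sub>R Q\<close>. In the Hamiltonian the terms of order
\<open>t^0\<close> add up to the constant \<open>a\<close> by the choice of \<open>\<Phi>\<close>, those of order \<open>t powr (- 2)\<close> are
\<open>Q \<bullet> H x + (norm (G x))\<^sup>2 / 2\<close>, and the remaining ones are \<open>O(t powr (- 4))\<close>.\<close>

lemma cell_value_asymptotic_bounds:
  fixes V :: "'a::euclidean_space \<Rightarrow> real"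
  assumes V: "buc V" and \<Phi>: "tame \<Phi> G" and \<Psi>: "tame \<Psi> H" and first: "\<And>x. Q \<bullet> G x + V x = a"
  obtains C where
    "\<And>t \<mu> c. t \<ge> 1 \<Longrightarrow> cell_value V (t *\<^sub>R Q) \<mu> \<Longrightarrow> (\<And>x. Q \<bullet> H x + (norm (G x))\<^sup>2 / 2 \<le> c) \<Longrightarrow>
      t\<^sup>2 * (\<mu> - t\<^sup>2 * (norm Q)\<^sup>2 / 2 - a) \<le> c + C / t\<^sup>2"
    "\<And>t \<mu> c. t \<ge> 1 \<Longrightarrow> cell_value V (t *\<^sub>R Q) \<mu> \<Longrightarrow> (\<And>x. c \<le> Q \<bullet> H x + (norm (G x))\<^sup>2 / 2) \<Longrightarrow>
      c - C / t\<^sup>2 \<le> t\<^sup>2 * (\<mu> - t\<^sup>2 * (norm Q)\<^sup>2 / 2 - a)"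
proof -
  obtain BG where BG: "\<And>x. norm (G x) \<le> BG" using \<Phi> by (auto simp: tame_def bounded_iff)
  obtain BH where BH: "\<And>x. norm (H x) \<le> BH" using \<Psi> by (auto simp: tame_def bounded_iff)
  have B0: "BG \<ge> 0" "BH \<ge> 0" using BG[of 0] BH[of 0] norm_ge_zero order_trans by blast+
  define C where "C = BG * BH + BH\<^sup>2 / 2"
  define E where "E = (\<lambda>x. Q \<bullet> H x + (norm (G x))\<^sup>2 / 2)"
  define \<phi> where "\<phi> = (\<lambda>t x. (1 / t) * \<Phi> x + (1 / t^3) * \<Psi> x)"
  define g where "g = (\<lambda>t x. (1 / t) *\<^sub>R G x + (1 / t^3) *\<^sub>R H x)"
  have tame: "tame (\<phi> t) (g t)" for t
    unfolding \<phi>_def g_def by (intro tame_add tame_scale \<Phi> \<Psi>)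
  have key: "\<bar>(norm (t *\<^sub>R Q + g t x))\<^sup>2 / 2 + V x - (t\<^sup>2 * (norm Q)\<^sup>2 / 2 + a + E x / t\<^sup>2)\<bar> \<le> C / t^4"
    if t: "t \<ge> 1" for t x
  proof -
    have t0: "t \<noteq> 0" using t by simp
    have "(norm (t *\<^sub>R Q + g t x))\<^sup>2 / 2 = t\<^sup>2 * (norm Q)\<^sup>2 / 2 + Q \<bullet> G x + (Q \<bullet> H x) / t\<^sup>2
        + (norm (G x))\<^sup>2 / 2 / t\<^sup>2 + (G x \<bullet> H x) / t^4 + (norm (H x))\<^sup>2 / 2 / t^6"
      unfolding power2_norm_eq_inner g_def using t0
      by (simp add: inner_add_left inner_add_right inner_commute field_simps power2_eq_square eval_nat_numeral)
    then have "(norm (t *\<^sub>R Q + g t x))\<^sup>2 / 2 + V x - (t\<^sup>2 * (norm Q)\<^sup>2 / 2 + a + E x / t\<^sup>2)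
        = (G x \<bullet> H x) / t^4 + (norm (H x))\<^sup>2 / 2 / t^6"
      using first[of x] by (simp add: E_def add_divide_distrib)
    moreover have "\<bar>(G x \<bullet> H x) / t^4\<bar> \<le> BG * BH / t^4"
    proof -
      have "\<bar>G x \<bullet> H x\<bar> \<le> norm (G x) * norm (H x)" by (rule Cauchy_Schwarz_ineq2)
      also have "\<dots> \<le> BG * BH" using BG BH B0 by (intro mult_mono) auto
      finally show ?thesis using t by (simp add: divide_right_mono)
    qed
    moreover have "\<bar>(norm (H x))\<^sup>2 / 2 / t^6\<bar> \<le> BH\<^sup>2 / 2 / t^4"
    proof -
      have "(norm (H x))\<^sup>2 / 2 / t^6 \<le> BH\<^sup>2 / 2 / t^4"
        using t BH[of x] by (intro frac_le power_mono power_increasing divide_right_mono) auto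
      then show ?thesis using t by simp
    qed
    ultimately show ?thesis using abs_triangle_ineq[of "(G x \<bullet> H x) / t^4" "(norm (H x))\<^sup>2 / 2 / t^6"]
      by (simp add: C_def add_divide_distrib)
  qed
  have up: "t\<^sup>2 * (\<mu> - t\<^sup>2 * (norm Q)\<^sup>2 / 2 - a) \<le> c + C / t\<^sup>2"
    if t: "t \<ge> 1" and cv: "cell_value V (t *\<^sub>R Q) \<mu>" and c: "\<And>x. E x \<le> c" for t \<mu> c
  proof -
    have "(norm (t *\<^sub>R Q + g t x))\<^sup>2 / 2 + V x \<le> t\<^sup>2 * (norm Q)\<^sup>2 / 2 + a + c / t\<^sup>2 + C / t^4" for x
      using key[OF t, of x] divide_right_mono[OF c[of x], of "t\<^sup>2"] unfolding abs_le_iff by auto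
    then have "\<mu> \<le> t\<^sup>2 * (norm Q)\<^sup>2 / 2 + a + c / t\<^sup>2 + C / t^4"
      using tame[of t] by (intro cell_value_le_of_C1[OF V cv, of "\<phi> t" "g t"]) (auto simp: tame_def)
    then have "t\<^sup>2 * (\<mu> - t\<^sup>2 * (norm Q)\<^sup>2 / 2 - a) \<le> t\<^sup>2 * (c / t\<^sup>2 + C / t^4)"
      by (intro mult_left_mono) auto
    also have "\<dots> = c + C / t\<^sup>2" using t by (simp add: field_simps eval_nat_numeral)
    finally show ?thesis .
  qed
  have low: "c - C / t\<^sup>2 \<le> t\<^sup>2 * (\<mu> - t\<^sup>2 * (norm Q)\<^sup>2 / 2 - a)"
    if t: "t \<ge> 1" and cv: "cell_value V (t *\<^sub>R Q) \<mu>" and c: "\<And>x. c \<le> E x" for t \<mu> c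
  proof -
    have "(norm (t *\<^sub>R Q + g t x))\<^sup>2 / 2 + V x \<ge> t\<^sup>2 * (norm Q)\<^sup>2 / 2 + a + c / t\<^sup>2 - C / t^4" for x
      using key[OF t, of x] divide_right_mono[OF c[of x], of "t\<^sup>2"] unfolding abs_le_iff by auto
    then have "\<mu> \<ge> t\<^sup>2 * (norm Q)\<^sup>2 / 2 + a + c / t\<^sup>2 - C / t^4"
      using tame[of t] by (intro cell_value_ge_of_C1[OF V cv, of "\<phi> t" "g t"]) (auto simp: tame_def)
    then have "t\<^sup>2 * (\<mu> - t\<^sup>2 * (norm Q)\<^sup>2 / 2 - a) \<ge> t\<^sup>2 * (c / t\<^sup>2 - C / t^4)"
      by (intro mult_left_mono) auto
    moreover have "t\<^sup>2 * (c / t\<^sup>2 - C / t^4) = c - C / t\<^sup>2" using t by (simp add: field_simps eval_nat_numeral)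
    ultimately show ?thesis by simp
  qed
  show thesis by (rule that[of C]) (use up low in \<open>auto simp: E_def\<close>)
qed

text \<open>The polynomial \<open>c\<^sup>2 + 2 * c - 1 / 2\<close> has its only zero in \<open>{-1..1}\<close> at \<open>sqrt (3 / 2) - 1 > 1 / 10\<close>. For
\<open>c < 1 / 10\<close> the square therefore contributes at least \<open>2 * b\<close>, against a loss of at most \<open>b\<close>; this
is what the factor 800 is for.\<close>

lemma resonance_gap:
  fixes b M c :: real
  assumes b: "b > 0" and M: "M > 0" and c: "-1 \<le> c"
  shows "b / 10 \<le> b * c + (800 * b / M) * M * ((c\<^sup>2 + 2 * c - 1 / 2) / 4)\<^sup>2 / 2"
proof (cases "c \<ge> 1 / 10")
  case True
  have "b * (1 / 10) \<le> b * c" using True b by (intro mult_left_mono) auto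
  moreover have "(800 * b / M) * M * ((c\<^sup>2 + 2 * c - 1 / 2) / 4)\<^sup>2 / 2 \<ge> 0" using b M by simp
  ultimately show ?thesis by linarith
next
  case False
  have "(c + 1)\<^sup>2 \<le> (11 / 10)\<^sup>2" using False c by (intro power_mono) auto
  then have "29 / 100 \<le> 1 / 2 - 2 * c - c\<^sup>2" by (simp add: power2_eq_square algebra_simps)
  then have "(29 / 100)\<^sup>2 \<le> (1 / 2 - 2 * c - c\<^sup>2)\<^sup>2" by (intro power_mono) auto
  also have "\<dots> = (c\<^sup>2 + 2 * c - 1 / 2)\<^sup>2" by (simp add: power2_eq_square algebra_simps)
  finally have "8 / 100 \<le> (c\<^sup>2 + 2 * c - 1 / 2)\<^sup>2" by (simp add: power2_eq_square)
  then have "b * 25 * (8 / 100) \<le> b * 25 * (c\<^sup>2 + 2 * c - 1 / 2)\<^sup>2" using b by (intro mult_left_mono) auto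
  moreover have "(800 * b / M) * M * ((c\<^sup>2 + 2 * c - 1 / 2) / 4)\<^sup>2 / 2 = b * 25 * (c\<^sup>2 + 2 * c - 1 / 2)\<^sup>2"
    using M by (simp add: power_divide)
  moreover have "b * (-1) \<le> b * c" using c b by (intro mult_left_mono) auto
  ultimately show ?thesis using b by linarith
qed

definition cos_potential :: "real \<Rightarrow> 'i set \<Rightarrow> ('i \<Rightarrow> real) \<Rightarrow> ('i \<Rightarrow> 'a::euclidean_space) \<Rightarrow> ('i \<Rightarrow> real) \<Rightarrow> 'a \<Rightarrow> real" where
  "cos_potential a I A k \<theta> x = a + (\<Sum>j\<in>I. A j * cos (k j \<bullet> x + \<theta> j))"

lemma tame_cos: "tame (\<lambda>x. cos (k \<bullet> x + b)) (\<lambda>x. (- sin (k \<bullet> x + b)) *\<^sub>R k)"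
proof (rule tame_wave)
  show "bounded (range (\<lambda>x. - sin x :: real))" using bounded_uminus[of "range sin"] bounded_range_sin_cos by (simp add: image_image)
qed (auto intro!: derivative_eq_intros continuous_intros simp: bounded_range_sin_cos)

lemma buc_of_tame:
  assumes "tame \<phi> g"
  shows "buc \<phi>"
proof -
  obtain B where B: "\<And>x. norm (g x) \<le> B" using assms by (auto simp: tame_def bounded_iff)
  have B0: "B \<ge> 0" using B[of 0] norm_ge_zero order_trans by blast
  have "norm (\<phi> y - \<phi> x) \<le> B * norm (y - x)" for x y
  proof (rule differentiable_bound[of UNIV \<phi> "\<lambda>x h. g x \<bullet> h"])
    show "(\<phi> has_derivative (\<lambda>h. g x \<bullet> h)) (at x within UNIV)" for x
      using assms C1_with_gradientD(1) by (auto simp: tame_def)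
    show "onorm (\<lambda>h. g x \<bullet> h) \<le> B" for x
    proof (rule onorm_bound[OF B0])
      fix h show "norm (g x \<bullet> h) \<le> B * norm h"
        using Cauchy_Schwarz_ineq2[of "g x" h] mult_right_mono[OF B[of x], of "norm h"] by simp
    qed
  qed auto
  then have "B-lipschitz_on UNIV \<phi>" using B0 by (auto simp: lipschitz_on_def dist_norm)
  then have "uniformly_continuous_on UNIV \<phi>" by (rule lipschitz_on_uniformly_continuous)
  then show ?thesis using assms by (auto simp: buc_def tame_def)
qed

lemma buc_cos_potential: "buc (cos_potential a I A k \<theta>)"
proof -
  have "tame (\<lambda>x. (a * cos (0 \<bullet> x + 0)) + (\<Sum>j\<in>I. A j * cos (k j \<bullet> x + \<theta> j)))
     (\<lambda>x. a *\<^sub>R ((- sin (0 \<bullet> x + 0)) *\<^sub>R 0) + (\<Sum>j\<in>I. A j *\<^sub>R ((- sin (k j \<bullet> x + \<theta> j)) *\<^sub>R k j)))"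
    by (intro tame_add tame_scale tame_sum tame_cos)
  from buc_of_tame[OF this] show ?thesis by (simp add: cos_potential_def[abs_def])
qed

text \<open>\<open>\<Phi>\<close> integrates the potential along \<open>Q\<close>. The square of its gradient consists of waves with the frequencies
\<open>k i + k j\<close> and \<open>k i - k j\<close>, and \<open>\<Psi>\<close> integrates these along \<open>Q\<close> in turn, except for the resonant ones, whose frequency is
orthogonal to \<open>Q\<close>. Division by zero yielding zero, the same formula for \<open>\<Psi>\<close> simply omits these waves,
and exactly they survive in the last equation.\<close>

lemma cos_potential_correctors:
  fixes k :: "'i \<Rightarrow> 'a::euclidean_space" and Q :: 'a and A \<theta> :: "'i \<Rightarrow> real"
  assumes Q: "\<And>j. j \<in> I \<Longrightarrow> Q \<bullet> k j \<noteq> 0"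
  defines "q \<equiv> \<lambda>j. Q \<bullet> k j" and "\<tau> \<equiv> \<lambda>x j. k j \<bullet> x + \<theta> j"
  defines "G \<equiv> \<lambda>x. - (\<Sum>j\<in>I. (A j / q j * cos (\<tau> x j)) *\<^sub>R k j)"
  defines "B \<equiv> \<lambda>i j. A i * A j * (k i \<bullet> k j) / (q i * q j)"
  obtains \<Phi> \<Psi> H where "tame \<Phi> G" "tame \<Psi> H"
    "\<And>x. Q \<bullet> G x + cos_potential a I A k \<theta> x = a"
    "\<And>x. Q \<bullet> H x + (norm (G x))\<^sup>2 / 2 = (\<Sum>i\<in>I. \<Sum>j\<in>I. B i j / 4 *
       ((if q i + q j = 0 then cos (\<tau> x i + \<tau> x j) else 0) + (if q i - q j = 0 then cos (\<tau> x i - \<tau> x j) else 0)))"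
proof -
  define \<Phi> where "\<Phi> = (\<lambda>x. \<Sum>j\<in>I. (- A j / q j) * sin (k j \<bullet> x + \<theta> j))"
  have "tame \<Phi> (\<lambda>x. \<Sum>j\<in>I. (- A j / q j) *\<^sub>R (cos (k j \<bullet> x + \<theta> j) *\<^sub>R k j))"
    unfolding \<Phi>_def by (intro tame_sum tame_scale tame_sin)
  then have 1: "tame \<Phi> G" by (simp add: G_def \<tau>_def sum_negf)
  have "Q \<bullet> G x = - (\<Sum>j\<in>I. A j / q j * cos (\<tau> x j) * q j)" for x
    unfolding G_def inner_minus_right inner_sum_right by (simp add: q_def)
  also have "\<dots> x = - (\<Sum>j\<in>I. A j * cos (\<tau> x j))" for x
    using Q by (intro arg_cong[of _ _ uminus] sum.cong) (auto simp: q_def)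
  finally have 2: "Q \<bullet> G x + cos_potential a I A k \<theta> x = a" for x by (simp add: cos_potential_def \<tau>_def)
  define H where "H = (\<lambda>x. \<Sum>i\<in>I. \<Sum>j\<in>I. (- B i j / 4) *\<^sub>R
     ((1 / (q i + q j)) *\<^sub>R (cos ((k i + k j) \<bullet> x + (\<theta> i + \<theta> j)) *\<^sub>R (k i + k j)) +
      (1 / (q i - q j)) *\<^sub>R (cos ((k i - k j) \<bullet> x + (\<theta> i - \<theta> j)) *\<^sub>R (k i - k j))))"
  define \<Psi> where "\<Psi> = (\<lambda>x. \<Sum>i\<in>I. \<Sum>j\<in>I. (- B i j / 4) *
     ((1 / (q i + q j)) * sin ((k i + k j) \<bullet> x + (\<theta> i + \<theta> j)) +
      (1 / (q i - q j)) * sin ((k i - k j) \<bullet> x + (\<theta> i - \<theta> j))))"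
  have 3: "tame \<Psi> H" unfolding \<Psi>_def H_def by (intro tame_sum tame_scale tame_add tame_sin)
  have arg: "(k i + k j) \<bullet> x + (\<theta> i + \<theta> j) = \<tau> x i + \<tau> x j" "(k i - k j) \<bullet> x + (\<theta> i - \<theta> j) = \<tau> x i - \<tau> x j" for i j x
    by (simp_all add: \<tau>_def inner_add_left inner_diff_left)
  have Qk: "Q \<bullet> (k i + k j) = q i + q j" "Q \<bullet> (k i - k j) = q i - q j" for i j
    by (simp_all add: q_def inner_add_right inner_diff_right)
  have QH: "Q \<bullet> H x = (\<Sum>i\<in>I. \<Sum>j\<in>I. (- B i j / 4) *
     ((if q i + q j = 0 then 0 else cos (\<tau> x i + \<tau> x j)) + (if q i - q j = 0 then 0 else cos (\<tau> x i - \<tau> x j))))" for x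
    unfolding H_def inner_sum_right inner_scaleR_right inner_add_right[of Q "(1 / (_ + _)) *\<^sub>R _"] arg Qk
    by (intro sum.cong refl) simp
  have nG: "(norm (G x))\<^sup>2 / 2 = (\<Sum>i\<in>I. \<Sum>j\<in>I. B i j / 4 * (cos (\<tau> x i + \<tau> x j) + cos (\<tau> x i - \<tau> x j)))" for x
  proof -
    have "(norm (G x))\<^sup>2 = (\<Sum>i\<in>I. \<Sum>j\<in>I. (A i / q i * cos (\<tau> x i)) * (A j / q j * cos (\<tau> x j)) * (k i \<bullet> k j))"
    proof -
      define u where "u = (\<lambda>i. A i / q i * cos (\<tau> x i))"
      have "(norm (G x))\<^sup>2 = (\<Sum>i\<in>I. u i *\<^sub>R k i) \<bullet> (\<Sum>j\<in>I. u j *\<^sub>R k j)"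
        by (simp add: G_def u_def power2_norm_eq_inner)
      also have "\<dots> = (\<Sum>i\<in>I. (u i *\<^sub>R k i) \<bullet> (\<Sum>j\<in>I. u j *\<^sub>R k j))" by (rule inner_sum_left)
      also have "\<dots> = (\<Sum>i\<in>I. \<Sum>j\<in>I. (u i *\<^sub>R k i) \<bullet> (u j *\<^sub>R k j))" by (simp only: inner_sum_right)
      also have "\<dots> = (\<Sum>i\<in>I. \<Sum>j\<in>I. u i * u j * (k i \<bullet> k j))"
        by (intro sum.cong refl) simp
      finally show ?thesis unfolding u_def .
    qed
    also have "\<dots> / 2 = (\<Sum>i\<in>I. \<Sum>j\<in>I. (A i / q i * cos (\<tau> x i)) * (A j / q j * cos (\<tau> x j)) * (k i \<bullet> k j) / 2)"
      by (simp add: sum_divide_distrib)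
    also have "\<dots> = (\<Sum>i\<in>I. \<Sum>j\<in>I. B i j / 4 * (cos (\<tau> x i + \<tau> x j) + cos (\<tau> x i - \<tau> x j)))"
      by (intro sum.cong refl) (simp add: B_def cos_add cos_diff mult_ac)
    finally show ?thesis .
  qed
  have 4: "Q \<bullet> H x + (norm (G x))\<^sup>2 / 2 = (\<Sum>i\<in>I. \<Sum>j\<in>I. B i j / 4 *
       ((if q i + q j = 0 then cos (\<tau> x i + \<tau> x j) else 0) + (if q i - q j = 0 then cos (\<tau> x i - \<tau> x j) else 0)))" for x
    unfolding QH nG sum.distrib[symmetric] by (intro sum.cong refl) (auto simp: algebra_simps)
  show thesis by (rule that[OF 1 3 2 4])
qed

text \<open>The coefficient of \<open>t powr (- 2)\<close> at momentum \<open>t *\<^sub>R Q\<close> in the absence of resonances.\<close>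

definition second_coeff :: "'i set \<Rightarrow> ('i \<Rightarrow> real) \<Rightarrow> ('i \<Rightarrow> 'a::euclidean_space) \<Rightarrow> 'a \<Rightarrow> real" where
  "second_coeff I A k Q = (\<Sum>j\<in>I. (A j)\<^sup>2 * (norm (k j))\<^sup>2 / (4 * (Q \<bullet> k j)\<^sup>2))"

lemma resonant_term_diagonal:
  fixes q :: real
  assumes "q \<noteq> 0"
  shows "A * A * (k \<bullet> k) / (q * q) / 4 * ((if q + q = 0 then cos (s + s) else 0) + (if q - q = 0 then cos (s - s) else 0))
    = A\<^sup>2 * (norm k)\<^sup>2 / (4 * q\<^sup>2)"
  using assms by (simp add: dot_square_norm power2_eq_square mult_ac)

text \<open>Only the diagonal of the double sum survives, and it does not depend on the point.\<close>

lemma cell_value_nonresonant: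
  fixes k :: "'i \<Rightarrow> 'a::euclidean_space"
  assumes fin: "finite I" and Q: "\<And>j. j \<in> I \<Longrightarrow> Q \<bullet> k j \<noteq> 0"
    and nonres: "\<And>i j. i \<in> I \<Longrightarrow> j \<in> I \<Longrightarrow> i \<noteq> j \<Longrightarrow> k i \<bullet> k j \<noteq> 0 \<Longrightarrow> \<bar>Q \<bullet> k i\<bar> \<noteq> \<bar>Q \<bullet> k j\<bar>"
  obtains C where "\<And>t \<mu>. t \<ge> 1 \<Longrightarrow> cell_value (cos_potential a I A k \<theta>) (t *\<^sub>R Q) \<mu> \<Longrightarrow>
     \<bar>t\<^sup>2 * (\<mu> - t\<^sup>2 * (norm Q)\<^sup>2 / 2 - a) - second_coeff I A k Q\<bar> \<le> C / t\<^sup>2"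
proof -
  obtain \<Phi> \<Psi> H where tame: "tame \<Phi> (\<lambda>x. - (\<Sum>j\<in>I. (A j / (Q \<bullet> k j) * cos (k j \<bullet> x + \<theta> j)) *\<^sub>R k j))" "tame \<Psi> H" and
    first: "\<And>x. Q \<bullet> - (\<Sum>j\<in>I. (A j / (Q \<bullet> k j) * cos (k j \<bullet> x + \<theta> j)) *\<^sub>R k j) + cos_potential a I A k \<theta> x = a" and
    E: "\<And>x. Q \<bullet> H x + (norm (- (\<Sum>j\<in>I. (A j / (Q \<bullet> k j) * cos (k j \<bullet> x + \<theta> j)) *\<^sub>R k j)))\<^sup>2 / 2 =
      (\<Sum>i\<in>I. \<Sum>j\<in>I. A i * A j * (k i \<bullet> k j) / ((Q \<bullet> k i) * (Q \<bullet> k j)) / 4 *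
       ((if Q \<bullet> k i + Q \<bullet> k j = 0 then cos ((k i \<bullet> x + \<theta> i) + (k j \<bullet> x + \<theta> j)) else 0)
        + (if Q \<bullet> k i - Q \<bullet> k j = 0 then cos ((k i \<bullet> x + \<theta> i) - (k j \<bullet> x + \<theta> j)) else 0)))"
    by (rule cos_potential_correctors[of I Q k A \<theta> a]) (use Q in blast)+
  have E': "(\<Sum>i\<in>I. \<Sum>j\<in>I. A i * A j * (k i \<bullet> k j) / ((Q \<bullet> k i) * (Q \<bullet> k j)) / 4 *
       ((if Q \<bullet> k i + Q \<bullet> k j = 0 then cos ((k i \<bullet> x + \<theta> i) + (k j \<bullet> x + \<theta> j)) else 0)
        + (if Q \<bullet> k i - Q \<bullet> k j = 0 then cos ((k i \<bullet> x + \<theta> i) - (k j \<bullet> x + \<theta> j)) else 0))) = second_coeff I A k Q"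
    (is "(\<Sum>i\<in>I. \<Sum>j\<in>I. ?T i j) = _") for x
  proof -
    have "?T i j = (if j = i then (A j)\<^sup>2 * (norm (k j))\<^sup>2 / (4 * (Q \<bullet> k j)\<^sup>2) else 0)" if "i \<in> I" "j \<in> I" for i j
    proof (cases "j = i")
      case True
      show ?thesis unfolding True by (subst resonant_term_diagonal[OF Q[OF that(1)]]) simp
    next
      case False
      then have "k i \<bullet> k j = 0 \<or> \<bar>Q \<bullet> k i\<bar> \<noteq> \<bar>Q \<bullet> k j\<bar>" using nonres[OF that] by blast
      then show ?thesis using False by (auto simp: abs_if split: if_splits)
    qed
    then have "(\<Sum>i\<in>I. \<Sum>j\<in>I. ?T i j) = (\<Sum>i\<in>I. \<Sum>j\<in>I. if j = i then (A j)\<^sup>2 * (norm (k j))\<^sup>2 / (4 * (Q \<bullet> k j)\<^sup>2) else 0)"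
      by (intro sum.cong refl)
    then show ?thesis using fin by (simp add: second_coeff_def sum.delta)
  qed
  obtain C where
    C: "\<And>t \<mu> c. t \<ge> 1 \<Longrightarrow> cell_value (cos_potential a I A k \<theta>) (t *\<^sub>R Q) \<mu> \<Longrightarrow>
      (\<And>x. Q \<bullet> H x + (norm (- (\<Sum>j\<in>I. (A j / (Q \<bullet> k j) * cos (k j \<bullet> x + \<theta> j)) *\<^sub>R k j)))\<^sup>2 / 2 \<le> c) \<Longrightarrow>
      t\<^sup>2 * (\<mu> - t\<^sup>2 * (norm Q)\<^sup>2 / 2 - a) \<le> c + C / t\<^sup>2"
    "\<And>t \<mu> c. t \<ge> 1 \<Longrightarrow> cell_value (cos_potential a I A k \<theta>) (t *\<^sub>R Q) \<mu> \<Longrightarrow>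
      (\<And>x. c \<le> Q \<bullet> H x + (norm (- (\<Sum>j\<in>I. (A j / (Q \<bullet> k j) * cos (k j \<bullet> x + \<theta> j)) *\<^sub>R k j)))\<^sup>2 / 2) \<Longrightarrow>
      c - C / t\<^sup>2 \<le> t\<^sup>2 * (\<mu> - t\<^sup>2 * (norm Q)\<^sup>2 / 2 - a)"
    by (rule cell_value_asymptotic_bounds[OF buc_cos_potential tame first]) blast
  show thesis
  proof (rule that)
    fix t \<mu> assume t: "t \<ge> 1" "cell_value (cos_potential a I A k \<theta>) (t *\<^sub>R Q) \<mu>"
    show "\<bar>t\<^sup>2 * (\<mu> - t\<^sup>2 * (norm Q)\<^sup>2 / 2 - a) - second_coeff I A k Q\<bar> \<le> C / t\<^sup>2"
      using C(1)[OF t, of "second_coeff I A k Q"] C(2)[OF t, of "second_coeff I A k Q"]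
      unfolding E E' abs_le_iff by simp
  qed
qed

text \<open>A surviving wave \<open>b * cos (m \<bullet> x + \<beta>)\<close> with \<open>Q \<bullet> m = 0\<close> cannot be integrated along \<open>Q\<close>, but it can be
lifted above its mean. Since \<open>Q \<bullet> m = 0\<close>, adding \<open>s * f (m \<bullet> x + \<beta>)\<close> to \<open>\<Phi>\<close> leaves the first order
unchanged. At second order it adds \<open>s\<^sup>2 * (norm m)\<^sup>2 * h\<^sup>2 / 2\<close> with \<open>h = f'\<close>, and a cross term
\<open>s * h * (m \<bullet> G x)\<close>, which oscillates along \<open>Q\<close> and is cancelled by an addition to \<open>\<Psi>\<close>.
With \<open>f u = sin u / 2 + sin (2 * u) / 16\<close> the function \<open>h\<close> vanishes only where the wave is
positive, so a large \<open>s\<close> lifts the sum above \<open>c\<close> everywhere.\<close>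

lemma resonant_correctors:
  fixes k :: "'i \<Rightarrow> 'a::euclidean_space" and m Q :: 'a and A \<theta> :: "'i \<Rightarrow> real"
  assumes Q: "\<And>j. j \<in> I \<Longrightarrow> Q \<bullet> k j \<noteq> 0" and m: "m \<noteq> 0" "Q \<bullet> m = 0" and b: "b > 0"
  defines "G \<equiv> \<lambda>x. - (\<Sum>j\<in>I. (A j / (Q \<bullet> k j) * cos (k j \<bullet> x + \<theta> j)) *\<^sub>R k j)"
  assumes tame: "tame \<Phi> G" "tame \<Psi> H"
    and E: "\<And>x. Q \<bullet> H x + (norm (G x))\<^sup>2 / 2 = c + b * cos (m \<bullet> x + \<beta>)"
  obtains \<Phi>' G' \<Psi>' H' where "tame \<Phi>' G'" "tame \<Psi>' H'" "\<And>x. Q \<bullet> G' x = Q \<bullet> G x"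
    "\<And>x. c + b / 10 \<le> Q \<bullet> H' x + (norm (G' x))\<^sup>2 / 2"
proof -
  define M where "M = (norm m)\<^sup>2"
  have M: "M > 0" using m by (simp add: M_def)
  define s where "s = sqrt (800 * b / M)"
  have s2: "s\<^sup>2 = 800 * b / M" using b M by (simp add: s_def)
  define f h h' where "f = (\<lambda>u::real. sin u / 2 + sin (2 * u) / 16)" and "h = (\<lambda>u::real. cos u / 2 + cos (2 * u) / 8)"
    and "h' = (\<lambda>u::real. - sin u / 2 - sin (2 * u) / 4)"
  have df: "(f has_real_derivative h t) (at t)" "(h has_real_derivative h' t) (at t)" for t
    unfolding f_def h_def h'_def by (auto intro!: derivative_eq_intros)
  have cont: "continuous_on UNIV h" "continuous_on UNIV h'"
    unfolding h_def h'_def by (intro continuous_intros; simp)+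
  have "\<bar>f u\<bar> \<le> 1" "\<bar>h u\<bar> \<le> 1" "\<bar>h' u\<bar> \<le> 1" for u
    using sin_le_one[of u] sin_ge_minus_one[of u] cos_le_one[of u] cos_ge_minus_one[of u]
      sin_le_one[of "2 * u"] sin_ge_minus_one[of "2 * u"] cos_le_one[of "2 * u"] cos_ge_minus_one[of "2 * u"]
    unfolding f_def h_def h'_def by (intro abs_leI; linarith)+
  then have bd: "bounded (range f)" "bounded (range h)" "bounded (range h')"
    unfolding bounded_iff by (auto intro!: exI[of _ 1])
  have th: "tame (\<lambda>x. f (m \<bullet> x + \<beta>)) (\<lambda>x. h (m \<bullet> x + \<beta>) *\<^sub>R m)"
    "tame (\<lambda>x. h (m \<bullet> x + \<beta>)) (\<lambda>x. h' (m \<bullet> x + \<beta>) *\<^sub>R m)"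
    by (rule tame_wave; use df cont bd in auto)+
  \<comment> \<open>The coefficients \<open>w\<close> are chosen so that the derivative along \<open>Q\<close> of the added term of \<open>\<Psi>\<close> is the negative of the cross term.\<close>
  define w where "w = (\<lambda>j. s * A j * (k j \<bullet> m) / (Q \<bullet> k j)\<^sup>2)"
  define G' where "G' = (\<lambda>x. G x + s *\<^sub>R (h (m \<bullet> x + \<beta>) *\<^sub>R m))"
  define H' where "H' = (\<lambda>x. H x + (\<Sum>j\<in>I. w j *\<^sub>R (h (m \<bullet> x + \<beta>) *\<^sub>R (cos (k j \<bullet> x + \<theta> j) *\<^sub>R k j)
      + sin (k j \<bullet> x + \<theta> j) *\<^sub>R (h' (m \<bullet> x + \<beta>) *\<^sub>R m))))"
  have t1: "tame (\<lambda>x. \<Phi> x + s * f (m \<bullet> x + \<beta>)) G'"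
    unfolding G'_def by (intro tame_add tame_scale tame th)
  have t2: "tame (\<lambda>x. \<Psi> x + (\<Sum>j\<in>I. w j * (h (m \<bullet> x + \<beta>) * sin (k j \<bullet> x + \<theta> j)))) H'"
    unfolding H'_def by (intro tame_add tame_sum tame_scale tame tame_mult th tame_sin)
  have QG: "Q \<bullet> G' x = Q \<bullet> G x" for x by (simp add: G'_def inner_add_right m)
  have "c + b / 10 \<le> Q \<bullet> H' x + (norm (G' x))\<^sup>2 / 2" for x
  proof -
    define u where "u = m \<bullet> x + \<beta>"
    have mG: "m \<bullet> G x = - (\<Sum>j\<in>I. A j / (Q \<bullet> k j) * cos (k j \<bullet> x + \<theta> j) * (k j \<bullet> m))"
      unfolding G_def by (simp add: inner_sum_right inner_commute)
    have "Q \<bullet> H' x = Q \<bullet> H x + (\<Sum>j\<in>I. w j * (h u * (cos (k j \<bullet> x + \<theta> j) * (Q \<bullet> k j))))"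
      unfolding H'_def u_def by (simp add: inner_add_right inner_sum_right m mult.assoc)
    also have "(\<Sum>j\<in>I. w j * (h u * (cos (k j \<bullet> x + \<theta> j) * (Q \<bullet> k j)))) =
        (\<Sum>j\<in>I. s * h u * (A j / (Q \<bullet> k j) * cos (k j \<bullet> x + \<theta> j) * (k j \<bullet> m)))"
      using Q by (intro sum.cong refl) (auto simp: w_def power2_eq_square)
    also have "\<dots> = - (s * h u * (m \<bullet> G x))" by (simp add: mG sum_distrib_left)
    finally have QH: "Q \<bullet> H' x = Q \<bullet> H x - s * h u * (m \<bullet> G x)" by simp
    have nG: "(norm (G' x))\<^sup>2 = (norm (G x))\<^sup>2 + 2 * (s * h u * (m \<bullet> G x)) + s\<^sup>2 * M * (h u)\<^sup>2"
      unfolding G'_def M_def u_def[symmetric] power2_norm_eq_inner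
      by (simp add: inner_add_left inner_add_right inner_commute power2_eq_square)
    have hc: "h u = ((cos u)\<^sup>2 + 2 * cos u - 1 / 2) / 4"
      unfolding h_def cos_double_cos by (simp add: field_simps)
    have "Q \<bullet> H' x + (norm (G' x))\<^sup>2 / 2 = (Q \<bullet> H x + (norm (G x))\<^sup>2 / 2) + s\<^sup>2 * M * (h u)\<^sup>2 / 2"
      unfolding QH nG by (simp add: field_simps)
    also have "\<dots> = c + (b * cos u + (800 * b / M) * M * (((cos u)\<^sup>2 + 2 * cos u - 1 / 2) / 4)\<^sup>2 / 2)"
      unfolding E u_def[symmetric] s2 hc by simp
    also have "\<dots> \<ge> c + b / 10" using resonance_gap[OF b M, of "cos u"] by simp
    finally show ?thesis .
  qed
  with t1 t2 QG show thesis by (rule that)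
qed

text \<open>The entries \<open>(i0, j0)\<close> and \<open>(j0, i0)\<close> of the double sum survive next to the diagonal and form a single
wave, to which \<open>resonant_correctors\<close> applies.\<close>

lemma cell_value_resonant:
  fixes k :: "'i \<Rightarrow> 'a::euclidean_space"
  assumes fin: "finite I" and Q: "\<And>j. j \<in> I \<Longrightarrow> Q \<bullet> k j \<noteq> 0" and A: "\<And>j. j \<in> I \<Longrightarrow> A j \<noteq> 0"
    and ij: "i0 \<in> I" "j0 \<in> I" "i0 \<noteq> j0" "k i0 \<bullet> k j0 \<noteq> 0" "\<bar>Q \<bullet> k i0\<bar> = \<bar>Q \<bullet> k j0\<bar>" "\<not> parallel (k i0) (k j0)"
    and single: "\<And>i j. i \<in> I \<Longrightarrow> j \<in> I \<Longrightarrow> i \<noteq> j \<Longrightarrow> k i \<bullet> k j \<noteq> 0 \<Longrightarrow> \<bar>Q \<bullet> k i\<bar> = \<bar>Q \<bullet> k j\<bar> \<Longrightarrow> {i, j} = {i0, j0}"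
  obtains C \<delta> where "\<delta> > 0" "\<And>t \<mu>. t \<ge> 1 \<Longrightarrow> cell_value (cos_potential a I A k \<theta>) (t *\<^sub>R Q) \<mu> \<Longrightarrow>
     second_coeff I A k Q + \<delta> - C / t\<^sup>2 \<le> t\<^sup>2 * (\<mu> - t\<^sup>2 * (norm Q)\<^sup>2 / 2 - a)"
proof -
  define G where "G = (\<lambda>x. - (\<Sum>j\<in>I. (A j / (Q \<bullet> k j) * cos (k j \<bullet> x + \<theta> j)) *\<^sub>R k j))"
  define T where "T = (\<lambda>x i j. A i * A j * (k i \<bullet> k j) / ((Q \<bullet> k i) * (Q \<bullet> k j)) / 4 *
       ((if Q \<bullet> k i + Q \<bullet> k j = 0 then cos ((k i \<bullet> x + \<theta> i) + (k j \<bullet> x + \<theta> j)) else 0)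
        + (if Q \<bullet> k i - Q \<bullet> k j = 0 then cos ((k i \<bullet> x + \<theta> i) - (k j \<bullet> x + \<theta> j)) else 0)))"
  obtain \<Phi> \<Psi> H where tame: "tame \<Phi> G" "tame \<Psi> H" and
    first: "\<And>x. Q \<bullet> G x + cos_potential a I A k \<theta> x = a" and
    E: "\<And>x. Q \<bullet> H x + (norm (G x))\<^sup>2 / 2 = (\<Sum>i\<in>I. \<Sum>j\<in>I. T x i j)"
    unfolding G_def T_def by (rule cos_potential_correctors[of I Q k A \<theta> a]) (use Q in blast)+
  define \<sigma> where "\<sigma> = (if Q \<bullet> k i0 = Q \<bullet> k j0 then 1 else - 1 :: real)"
  have \<sigma>: "Q \<bullet> k i0 = \<sigma> * (Q \<bullet> k j0)" "\<sigma> = 1 \<or> \<sigma> = - 1" using ij(5) by (auto simp: \<sigma>_def abs_if split: if_splits)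
  have q0: "Q \<bullet> k i0 \<noteq> 0" "Q \<bullet> k j0 \<noteq> 0" using Q ij by auto
  define B where "B = A i0 * A j0 * (k i0 \<bullet> k j0) / ((Q \<bullet> k i0) * (Q \<bullet> k j0))"
  have B0: "B \<noteq> 0" using A[OF ij(1)] A[OF ij(2)] ij(4) q0 by (simp add: B_def)
  \<comment> \<open>\<open>m\<close> is the one of \<open>k i0 - k j0\<close> and \<open>k i0 + k j0\<close> that is orthogonal to \<open>Q\<close>.\<close>
  define m where "m = k i0 - \<sigma> *\<^sub>R k j0"
  define \<beta> where "\<beta> = \<theta> i0 - \<sigma> * \<theta> j0"
  have Qm: "Q \<bullet> m = 0" by (simp add: m_def inner_diff_right \<sigma>(1))
  have m0: "m \<noteq> 0"
  proof
    assume "m = 0"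
    then have "1 *\<^sub>R k i0 + (- \<sigma>) *\<^sub>R k j0 = 0" by (simp add: m_def)
    then show False using ij(6) unfolding parallel_def by (metis zero_neq_one)
  qed
  have arg: "m \<bullet> x + \<beta> = (k i0 \<bullet> x + \<theta> i0) - \<sigma> * (k j0 \<bullet> x + \<theta> j0)" for x
    by (simp add: m_def \<beta>_def inner_diff_left algebra_simps)
  have T1: "T x i0 j0 = B / 4 * cos (m \<bullet> x + \<beta>)" for x
    using \<sigma>(2)
  proof
    assume s: "\<sigma> = 1"
    have "m \<bullet> x + \<beta> = (k i0 \<bullet> x + \<theta> i0) - (k j0 \<bullet> x + \<theta> j0)" by (simp add: arg s)
    then show ?thesis using \<sigma>(1) s q0 by (simp add: T_def B_def)
  next
    assume s: "\<sigma> = - 1"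
    have "m \<bullet> x + \<beta> = (k i0 \<bullet> x + \<theta> i0) + (k j0 \<bullet> x + \<theta> j0)" unfolding arg s by simp
    then show ?thesis using \<sigma>(1) s q0 by (simp add: T_def B_def)
  qed
  have T2: "T x j0 i0 = B / 4 * cos (m \<bullet> x + \<beta>)" for x
  proof -
    have "T x j0 i0 = T x i0 j0"
      unfolding T_def using cos_minus[of "(k i0 \<bullet> x + \<theta> i0) - (k j0 \<bullet> x + \<theta> j0)"]
      by (auto simp: add.commute mult.commute inner_commute mult.left_commute)
    then show ?thesis using T1 by simp
  qed
  have E': "(\<Sum>i\<in>I. \<Sum>j\<in>I. T x i j) = second_coeff I A k Q + B / 2 * cos (m \<bullet> x + \<beta>)" for x
  proof -
    define d where "d = (\<lambda>j. (A j)\<^sup>2 * (norm (k j))\<^sup>2 / (4 * (Q \<bullet> k j)\<^sup>2))"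
    define r where "r = B / 4 * cos (m \<bullet> x + \<beta>)"
    have "T x i j = (if j = i then d j else 0) + ((if i = i0 then if j = j0 then r else 0 else 0)
        + (if i = j0 then if j = i0 then r else 0 else 0))" if "i \<in> I" "j \<in> I" for i j
    proof (cases "j = i")
      case True
      show ?thesis unfolding True T_def d_def
        by (subst resonant_term_diagonal[OF Q[OF that(1)]]) (use ij(3) in auto)
    next
      case False
      show ?thesis
      proof (cases "{i, j} = {i0, j0}")
        case True
        then consider "i = i0" "j = j0" | "i = j0" "j = i0" by (auto simp: doubleton_eq_iff)
        then show ?thesis using False ij(3) T1[of x] T2[of x] by cases (auto simp: r_def)
      next
        case neq: False
        then have "k i \<bullet> k j = 0 \<or> \<bar>Q \<bullet> k i\<bar> \<noteq> \<bar>Q \<bullet> k j\<bar>" using single[OF that] False by blast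
        then have "T x i j = 0" unfolding T_def by (auto simp: abs_if split: if_splits)
        then show ?thesis using False neq by auto
      qed
    qed
    then have "(\<Sum>i\<in>I. \<Sum>j\<in>I. T x i j) = (\<Sum>i\<in>I. \<Sum>j\<in>I. (if j = i then d j else 0) + ((if i = i0 then if j = j0 then r else 0 else 0)
        + (if i = j0 then if j = i0 then r else 0 else 0)))"
      by (intro sum.cong refl)
    also have "\<dots> = (\<Sum>i\<in>I. d i + ((if i = i0 then r else 0) + (if i = j0 then r else 0)))"
    proof (intro sum.cong refl)
      fix i assume i: "i \<in> I"
      have e1: "(\<Sum>j\<in>I. if i = i0 then if j = j0 then r else 0 else 0) = (if i = i0 then r else 0)"
        using fin ij by (simp add: sum.delta)
      have e2: "(\<Sum>j\<in>I. if i = j0 then if j = i0 then r else 0 else 0) = (if i = j0 then r else 0)"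
        using fin ij by (simp add: sum.delta)
      have e3: "(\<Sum>j\<in>I. if j = i then d j else 0) = d i" using fin i by (simp add: sum.delta)
      show "(\<Sum>j\<in>I. (if j = i then d j else 0) + ((if i = i0 then if j = j0 then r else 0 else 0)
        + (if i = j0 then if j = i0 then r else 0 else 0))) = d i + ((if i = i0 then r else 0) + (if i = j0 then r else 0))"
        unfolding sum.distrib e1 e2 e3 ..
    qed
    also have "\<dots> = second_coeff I A k Q + 2 * r"
      unfolding sum.distrib second_coeff_def d_def using fin ij by (simp add: sum.delta)
    finally show ?thesis by (simp add: r_def)
  qed
  define b where "b = \<bar>B\<bar> / 2"
  have b: "b > 0" using B0 by (simp add: b_def)
  \<comment> \<open>A shift by \<open>pi\<close> makes the amplitude of the surviving wave positive.\<close>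
  define \<beta>' where "\<beta>' = (if B > 0 then \<beta> else \<beta> + pi)"
  have "B / 2 * cos (m \<bullet> x + \<beta>) = b * cos (m \<bullet> x + \<beta>')" for x
    using B0 cos_add[of "m \<bullet> x + \<beta>" pi] by (simp add: b_def \<beta>'_def add.assoc)
  then have E2: "Q \<bullet> H x + (norm (G x))\<^sup>2 / 2 = second_coeff I A k Q + b * cos (m \<bullet> x + \<beta>')" for x
    unfolding E E' by simp
  obtain \<Phi>' G' \<Psi>' H' where 1: "tame \<Phi>' G'" "tame \<Psi>' H'" "\<And>x. Q \<bullet> G' x = Q \<bullet> G x"
    "\<And>x. second_coeff I A k Q + b / 10 \<le> Q \<bullet> H' x + (norm (G' x))\<^sup>2 / 2"
    by (rule resonant_correctors[OF Q m0 Qm b tame[unfolded G_def] E2[unfolded G_def]]) (auto simp: G_def)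
  have first': "Q \<bullet> G' x + cos_potential a I A k \<theta> x = a" for x using first[of x] 1(3) by simp
  obtain C where C: "\<And>t \<mu> c. t \<ge> 1 \<Longrightarrow> cell_value (cos_potential a I A k \<theta>) (t *\<^sub>R Q) \<mu> \<Longrightarrow>
      (\<And>x. c \<le> Q \<bullet> H' x + (norm (G' x))\<^sup>2 / 2) \<Longrightarrow>
      c - C / t\<^sup>2 \<le> t\<^sup>2 * (\<mu> - t\<^sup>2 * (norm Q)\<^sup>2 / 2 - a)"
    by (rule cell_value_asymptotic_bounds[OF buc_cos_potential 1(1,2) first']) blast
  show thesis
    by (rule that[of "b / 10" C]) (use b C 1(4) in auto)
qed

section \<open>Directions and amplitudes\<close>

text \<open>Equality of effective Hamiltonians, including the existence of the constant at every momentum.\<close>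

definition same_value :: "('a::euclidean_space \<Rightarrow> real) \<Rightarrow> ('a \<Rightarrow> real) \<Rightarrow> bool" where
  "same_value V W \<longleftrightarrow> (\<forall>p. \<exists>\<mu>. cell_value V p \<mu> \<and> cell_value W p \<mu>)"

lemma parallel_iff_scaleR:
  assumes "u \<noteq> 0"
  shows "parallel u w \<longleftrightarrow> (\<exists>c. w = c *\<^sub>R u)"
proof
  assume "parallel u w"
  then obtain a b where ab: "a \<noteq> 0 \<or> b \<noteq> 0" "a *\<^sub>R u + b *\<^sub>R w = 0" unfolding parallel_def by blast
  then have "b \<noteq> 0" using assms by auto
  have "b *\<^sub>R w = - a *\<^sub>R u" using ab(2) by (simp add: eq_neg_iff_add_eq_0 add.commute)
  then have "(1 / b) *\<^sub>R (b *\<^sub>R w) = (1 / b) *\<^sub>R (- a *\<^sub>R u)" by simp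
  then show "\<exists>c. w = c *\<^sub>R u" using \<open>b \<noteq> 0\<close> by (intro exI[of _ "- a / b"]) simp
next
  assume "\<exists>c. w = c *\<^sub>R u"
  then obtain c where "w = c *\<^sub>R u" by blast
  then have "c *\<^sub>R u + (-1) *\<^sub>R w = 0" by simp
  then show "parallel u w" unfolding parallel_def by - (rule exI[of _ c], rule exI[of _ "-1"], simp)
qed

lemma parallel_sym:
  fixes u w :: "'a::real_vector"
  assumes "parallel u w"
  shows "parallel w u"
proof -
  obtain a b where "a \<noteq> 0 \<or> b \<noteq> 0" "a *\<^sub>R u + b *\<^sub>R w = 0" using assms unfolding parallel_def by blast
  then have "(b \<noteq> 0 \<or> a \<noteq> 0) \<and> b *\<^sub>R w + a *\<^sub>R u = 0" by (simp add: disj_commute add.commute)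
  then show ?thesis unfolding parallel_def by blast
qed

lemma parallel_common:
  assumes "parallel u w" "parallel u' w" "w \<noteq> 0"
  shows "parallel u u'"
proof -
  obtain c where c: "u = c *\<^sub>R w" using parallel_sym[OF assms(1)] parallel_iff_scaleR[OF assms(3)] by blast
  obtain c' where c': "u' = c' *\<^sub>R w" using parallel_sym[OF assms(2)] parallel_iff_scaleR[OF assms(3)] by blast
  show ?thesis
  proof (cases "c = 0")
    case True
    then have "1 *\<^sub>R u + 0 *\<^sub>R u' = 0" using c by simp
    then show ?thesis unfolding parallel_def by - (rule exI[of _ 1], rule exI[of _ 0], simp)
  next
    case False
    have "c' *\<^sub>R u + (- c) *\<^sub>R u' = 0" using c c' by (simp add: mult.commute)
    then show ?thesis using False unfolding parallel_def by - (rule exI[of _ c'], rule exI[of _ "- c"], simp)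
  qed
qed

lemma quadratic_growth_zero:
  fixes \<alpha> \<gamma> C :: real
  assumes "\<And>t. t \<ge> 1 \<Longrightarrow> \<bar>t\<^sup>2 * \<alpha> - \<gamma>\<bar> \<le> C / t\<^sup>2"
  shows "\<alpha> = 0" "\<gamma> = 0"
proof -
  have ev: "\<forall>\<^sub>F t::real in at_top. 1 \<le> t" by (rule eventually_ge_at_top)
  have "((\<lambda>t::real. (C / t\<^sup>2 + \<bar>\<gamma>\<bar>) / t\<^sup>2) \<longlongrightarrow> 0) at_top" by real_asymp
  moreover have "\<forall>\<^sub>F t::real in at_top. \<bar>\<alpha>\<bar> \<le> (C / t\<^sup>2 + \<bar>\<gamma>\<bar>) / t\<^sup>2"
    using ev
  proof eventually_elim
    case (elim t)
    have "t\<^sup>2 * \<bar>\<alpha>\<bar> = \<bar>(t\<^sup>2 * \<alpha> - \<gamma>) + \<gamma>\<bar>" by (simp add: abs_mult)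
    also have "\<dots> \<le> C / t\<^sup>2 + \<bar>\<gamma>\<bar>" using assms[OF elim] abs_triangle_ineq[of "t\<^sup>2 * \<alpha> - \<gamma>" \<gamma>] by linarith
    finally show ?case using elim by (simp add: pos_le_divide_eq mult.commute)
  qed
  ultimately have "\<bar>\<alpha>\<bar> \<le> 0" by (intro tendsto_lowerbound) auto
  then show \<alpha>: "\<alpha> = 0" by simp
  have "((\<lambda>t::real. C / t\<^sup>2) \<longlongrightarrow> 0) at_top" by real_asymp
  moreover have "\<forall>\<^sub>F t::real in at_top. \<bar>\<gamma>\<bar> \<le> C / t\<^sup>2"
    using ev by eventually_elim (use assms \<alpha> in fastforce)
  ultimately have "\<bar>\<gamma>\<bar> \<le> 0" by (intro tendsto_lowerbound) auto
  then show "\<gamma> = 0" by simp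
qed

text \<open>An orthogonal pair is exempt: its waves in the second order carry the factor \<open>k i \<bullet> k j = 0\<close>.\<close>

definition nonresonant :: "'i set \<Rightarrow> ('i \<Rightarrow> 'a::euclidean_space) \<Rightarrow> 'a \<Rightarrow> bool" where
  "nonresonant I k Q \<longleftrightarrow> (\<forall>j\<in>I. Q \<bullet> k j \<noteq> 0) \<and>
    (\<forall>i\<in>I. \<forall>j\<in>I. i \<noteq> j \<longrightarrow> k i \<bullet> k j \<noteq> 0 \<longrightarrow> \<bar>Q \<bullet> k i\<bar> \<noteq> \<bar>Q \<bullet> k j\<bar>)"

lemma nrD:
  assumes "nonresonant I k Q"
  shows "\<And>j. j \<in> I \<Longrightarrow> Q \<bullet> k j \<noteq> 0"
    "\<And>i j. i \<in> I \<Longrightarrow> j \<in> I \<Longrightarrow> i \<noteq> j \<Longrightarrow> k i \<bullet> k j \<noteq> 0 \<Longrightarrow> \<bar>Q \<bullet> k i\<bar> \<noteq> \<bar>Q \<bullet> k j\<bar>"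
  using assms by (auto simp: nonresonant_def)

text \<open>The expansions of both sides hold along the same ray, and a quantity \<open>t\<^sup>2 * \<alpha> - \<gamma>\<close> that
tends to zero has \<open>\<alpha> = \<gamma> = 0\<close>.\<close>

lemma same_value_second_coeff:
  assumes fin: "finite I" and same: "same_value (cos_potential a1 I A1 k1 \<theta>1) (cos_potential a2 I A2 k2 \<theta>2)"
    and nr: "nonresonant I k1 Q" "nonresonant I k2 Q"
  shows "a1 = a2" "second_coeff I A1 k1 Q = second_coeff I A2 k2 Q"
proof -
  obtain C1 where C1: "\<And>t \<mu>. t \<ge> 1 \<Longrightarrow> cell_value (cos_potential a1 I A1 k1 \<theta>1) (t *\<^sub>R Q) \<mu> \<Longrightarrow>
     \<bar>t\<^sup>2 * (\<mu> - t\<^sup>2 * (norm Q)\<^sup>2 / 2 - a1) - second_coeff I A1 k1 Q\<bar> \<le> C1 / t\<^sup>2"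
    by (rule cell_value_nonresonant[of I Q k1 a1 A1 \<theta>1, OF fin nrD[OF nr(1)]]) blast+
  obtain C2 where C2: "\<And>t \<mu>. t \<ge> 1 \<Longrightarrow> cell_value (cos_potential a2 I A2 k2 \<theta>2) (t *\<^sub>R Q) \<mu> \<Longrightarrow>
     \<bar>t\<^sup>2 * (\<mu> - t\<^sup>2 * (norm Q)\<^sup>2 / 2 - a2) - second_coeff I A2 k2 Q\<bar> \<le> C2 / t\<^sup>2"
    by (rule cell_value_nonresonant[of I Q k2 a2 A2 \<theta>2, OF fin nrD[OF nr(2)]]) blast+
  have key: "\<bar>t\<^sup>2 * (a1 - a2) - (second_coeff I A2 k2 Q - second_coeff I A1 k1 Q)\<bar> \<le> (C1 + C2) / t\<^sup>2" if t: "t \<ge> 1" for t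
  proof -
    obtain \<mu> where \<mu>: "cell_value (cos_potential a1 I A1 k1 \<theta>1) (t *\<^sub>R Q) \<mu>" "cell_value (cos_potential a2 I A2 k2 \<theta>2) (t *\<^sub>R Q) \<mu>"
      using same unfolding same_value_def by blast
    define X where "X = t\<^sup>2 * (\<mu> - t\<^sup>2 * (norm Q)\<^sup>2 / 2)"
    have e: "t\<^sup>2 * (\<mu> - t\<^sup>2 * (norm Q)\<^sup>2 / 2 - a) = X - t\<^sup>2 * a" for a unfolding X_def by (simp add: algebra_simps)
    show ?thesis
      using C1[OF t \<mu>(1)] C2[OF t \<mu>(2)] unfolding e add_divide_distrib right_diff_distrib abs_le_iff by linarith
  qed
  show "a1 = a2" "second_coeff I A1 k1 Q = second_coeff I A2 k2 Q"
    using quadratic_growth_zero[OF key] by simp_all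
qed

text \<open>Otherwise the coefficient of \<open>t powr (- 2)\<close> would be the plain sum on one side and strictly larger on the other.\<close>

lemma resonance_transfer:
  assumes fin: "finite I" and same: "same_value (cos_potential a I A k1 \<theta>1) (cos_potential a I A k2 \<theta>2)"
    and coeff: "second_coeff I A k1 Q = second_coeff I A k2 Q" and A: "\<And>j. j \<in> I \<Longrightarrow> A j \<noteq> 0"
    and Q: "\<And>j. j \<in> I \<Longrightarrow> Q \<bullet> k1 j \<noteq> 0" "\<And>j. j \<in> I \<Longrightarrow> Q \<bullet> k2 j \<noteq> 0"
    and ij: "i0 \<in> I" "j0 \<in> I" "i0 \<noteq> j0" "k1 i0 \<bullet> k1 j0 \<noteq> 0" "\<bar>Q \<bullet> k1 i0\<bar> = \<bar>Q \<bullet> k1 j0\<bar>" "\<not> parallel (k1 i0) (k1 j0)"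
    and single: "\<And>i j. i \<in> I \<Longrightarrow> j \<in> I \<Longrightarrow> i \<noteq> j \<Longrightarrow> k1 i \<bullet> k1 j \<noteq> 0 \<Longrightarrow> \<bar>Q \<bullet> k1 i\<bar> = \<bar>Q \<bullet> k1 j\<bar> \<Longrightarrow> {i, j} = {i0, j0}"
  shows "\<exists>i\<in>I. \<exists>j\<in>I. i \<noteq> j \<and> k2 i \<bullet> k2 j \<noteq> 0 \<and> \<bar>Q \<bullet> k2 i\<bar> = \<bar>Q \<bullet> k2 j\<bar>"
proof (rule ccontr)
  assume n: "\<not> ?thesis"
  obtain C1 \<delta> where \<delta>: "\<delta> > 0" and C1: "\<And>t \<mu>. t \<ge> 1 \<Longrightarrow> cell_value (cos_potential a I A k1 \<theta>1) (t *\<^sub>R Q) \<mu> \<Longrightarrow>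
     second_coeff I A k1 Q + \<delta> - C1 / t\<^sup>2 \<le> t\<^sup>2 * (\<mu> - t\<^sup>2 * (norm Q)\<^sup>2 / 2 - a)"
    by (rule cell_value_resonant[of I Q k1 A i0 j0 a \<theta>1, OF fin Q(1) A ij single]) blast+
  obtain C2 where C2: "\<And>t \<mu>. t \<ge> 1 \<Longrightarrow> cell_value (cos_potential a I A k2 \<theta>2) (t *\<^sub>R Q) \<mu> \<Longrightarrow>
     \<bar>t\<^sup>2 * (\<mu> - t\<^sup>2 * (norm Q)\<^sup>2 / 2 - a) - second_coeff I A k2 Q\<bar> \<le> C2 / t\<^sup>2"
    by (rule cell_value_nonresonant[of I Q k2 a A \<theta>2, OF fin Q(2)]) (use n in blast)+
  have "\<delta> \<le> (C1 + C2) / t\<^sup>2" if t: "t \<ge> 1" for t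
  proof -
    obtain \<mu> where \<mu>: "cell_value (cos_potential a I A k1 \<theta>1) (t *\<^sub>R Q) \<mu>" "cell_value (cos_potential a I A k2 \<theta>2) (t *\<^sub>R Q) \<mu>"
      using same unfolding same_value_def by blast
    show ?thesis
      using C1[OF t \<mu>(1)] C2[OF t \<mu>(2)] unfolding coeff add_divide_distrib abs_le_iff by linarith
  qed
  then have "\<forall>\<^sub>F t::real in at_top. \<delta> \<le> (C1 + C2) / t\<^sup>2"
    by (intro eventually_mono[OF eventually_ge_at_top[of 1]])
  moreover have "((\<lambda>t::real. (C1 + C2) / t\<^sup>2) \<longlongrightarrow> 0) at_top" by real_asymp
  ultimately have "\<delta> \<le> 0" by (intro tendsto_lowerbound) auto
  then show False using \<delta> by simp
qed

lemma exists_off_hyperplanes: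
  fixes S :: "'a::euclidean_space set"
  assumes "finite S" "0 \<notin> S"
  shows "\<exists>w. \<forall>m\<in>S. w \<bullet> m \<noteq> 0"
  using assms
proof (induction S rule: finite_induct)
  case (insert m S)
  then obtain w where w: "\<forall>m\<in>S. w \<bullet> m \<noteq> 0" by auto
  have m: "m \<noteq> 0" using insert by auto
  define bad where "bad = (\<lambda>n. - (w \<bullet> n) / (m \<bullet> n)) ` insert m S"
  have "finite bad" unfolding bad_def using insert by simp
  then have "infinite (UNIV - insert 0 bad :: real set)" using infinite_UNIV_char_0 by (simp add: Diff_infinite_finite)
  then obtain s where s: "s \<noteq> 0" "s \<notin> bad" using infinite_imp_nonempty by blast
  have "(w + s *\<^sub>R m) \<bullet> n \<noteq> 0" if n: "n \<in> insert m S" for n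
  proof (cases "m \<bullet> n = 0")
    case True
    then have "n \<in> S" using n m by auto
    then show ?thesis using w True by (simp add: inner_add_left)
  next
    case False
    have "s \<noteq> - (w \<bullet> n) / (m \<bullet> n)" using s(2) n unfolding bad_def by blast
    then have "s * (m \<bullet> n) \<noteq> - (w \<bullet> n)" using False by (metis nonzero_mult_div_cancel_right)
    then show ?thesis by (simp add: inner_add_left add_eq_0_iff)
  qed
  then show ?case by blast
qed simp

lemma exists_in_hyperplane_off_hyperplanes:
  fixes S :: "'a::euclidean_space set"
  assumes fin: "finite S" and k: "k \<noteq> 0" and np: "\<And>m. m \<in> S \<Longrightarrow> \<not> parallel k m"
  shows "\<exists>Q. Q \<bullet> k = 0 \<and> (\<forall>m\<in>S. Q \<bullet> m \<noteq> 0)"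
proof -
  define pr where "pr = (\<lambda>m. m - ((m \<bullet> k) / (k \<bullet> k)) *\<^sub>R k)"
  have "0 \<notin> pr ` S"
  proof
    assume "0 \<in> pr ` S"
    then obtain m where m: "m \<in> S" "pr m = 0" by force
    then have "m = ((m \<bullet> k) / (k \<bullet> k)) *\<^sub>R k" by (simp add: pr_def)
    then show False using np[OF m(1)] parallel_iff_scaleR[OF k] by blast
  qed
  then obtain w where w: "\<And>m. m \<in> S \<Longrightarrow> w \<bullet> pr m \<noteq> 0" using exists_off_hyperplanes[of "pr ` S"] fin by auto
  have "pr w \<bullet> k = 0" using k by (simp add: pr_def inner_diff_left)
  moreover have "pr w \<bullet> m = w \<bullet> pr m" for m by (simp add: pr_def inner_diff_left inner_diff_right inner_commute)
  ultimately show ?thesis using w by (intro exI[of _ "pr w"]) simp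
qed

text \<open>Approaching the hyperplane orthogonal to \<open>u\<close> along \<open>u\<close> itself, only the terms with frequency parallel to \<open>u\<close>
blow up; measured in terms of \<open>u\<close>, the length of that frequency cancels.\<close>

lemma second_coeff_pole:
  fixes k :: "'i \<Rightarrow> 'a::euclidean_space"
  assumes u: "u \<noteq> 0" "Q \<bullet> u = 0" and k0: "\<And>j. j \<in> I \<Longrightarrow> k j \<noteq> 0"
    and Q: "\<And>j. j \<in> I \<Longrightarrow> \<not> parallel u (k j) \<Longrightarrow> Q \<bullet> k j \<noteq> 0"
  shows "((\<lambda>s. s\<^sup>2 * second_coeff I A k (Q + s *\<^sub>R u)) \<longlongrightarrow>
     (\<Sum>j\<in>I. if parallel u (k j) then (A j)\<^sup>2 / (4 * (norm u)\<^sup>2) else 0)) (at 0)"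
  unfolding second_coeff_def sum_distrib_left
proof (rule tendsto_sum)
  fix j assume j: "j \<in> I"
  show "((\<lambda>s. s\<^sup>2 * ((A j)\<^sup>2 * (norm (k j))\<^sup>2 / (4 * ((Q + s *\<^sub>R u) \<bullet> k j)\<^sup>2))) \<longlongrightarrow>
     (if parallel u (k j) then (A j)\<^sup>2 / (4 * (norm u)\<^sup>2) else 0)) (at 0)"
  proof (cases "parallel u (k j)")
    case True
    then obtain c where c: "k j = c *\<^sub>R u" using parallel_iff_scaleR[OF u(1)] by blast
    have c0: "c \<noteq> 0" using c k0[OF j] by auto
    have n0: "norm u \<noteq> 0" using u(1) by simp
    have "s\<^sup>2 * ((A j)\<^sup>2 * (norm (k j))\<^sup>2 / (4 * ((Q + s *\<^sub>R u) \<bullet> k j)\<^sup>2)) = (A j)\<^sup>2 / (4 * (norm u)\<^sup>2)" if "s \<noteq> 0" for s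
    proof -
      have "(Q + s *\<^sub>R u) \<bullet> k j = s * c * (norm u)\<^sup>2"
        unfolding c power2_norm_eq_inner by (simp add: inner_add_left u(2))
      moreover have "(norm (k j))\<^sup>2 = c\<^sup>2 * (norm u)\<^sup>2" unfolding c by (simp add: power_mult_distrib)
      ultimately show ?thesis using that c0 n0 by (simp add: power_mult_distrib power2_eq_square)
    qed
    then have "\<forall>\<^sub>F s in at 0. (A j)\<^sup>2 / (4 * (norm u)\<^sup>2) = s\<^sup>2 * ((A j)\<^sup>2 * (norm (k j))\<^sup>2 / (4 * ((Q + s *\<^sub>R u) \<bullet> k j)\<^sup>2))"
      by (auto simp: eventually_at_filter)
    then show ?thesis using True by (auto intro: Lim_transform_eventually[OF tendsto_const])
  next
    case False
    have "((\<lambda>s. s\<^sup>2 * ((A j)\<^sup>2 * (norm (k j))\<^sup>2 / (4 * ((Q + s *\<^sub>R u) \<bullet> k j)\<^sup>2))) \<longlongrightarrow>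
      0\<^sup>2 * ((A j)\<^sup>2 * (norm (k j))\<^sup>2 / (4 * ((Q + 0 *\<^sub>R u) \<bullet> k j)\<^sup>2))) (at 0)"
      using Q[OF j False] by (intro tendsto_intros) simp
    then show ?thesis using False by simp
  qed
qed

lemma eventually_inner_neq_0:
  fixes Q u m :: "'a::euclidean_space"
  assumes "Q \<bullet> m \<noteq> 0 \<or> u \<bullet> m \<noteq> 0"
  shows "\<forall>\<^sub>F s in at 0. (Q + s *\<^sub>R u) \<bullet> m \<noteq> 0"
proof (cases "Q \<bullet> m = 0")
  case True
  then show ?thesis using assms by (auto simp: inner_add_left eventually_at_filter)
next
  case False
  have "((\<lambda>s. (Q + s *\<^sub>R u) \<bullet> m) \<longlongrightarrow> (Q + 0 *\<^sub>R u) \<bullet> m) (at 0)" by (intro tendsto_intros)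
  then show ?thesis by (rule tendsto_imp_eventually_ne) (use False in simp)
qed

lemma abs_inner_neq_iff: "\<bar>Q \<bullet> u\<bar> \<noteq> \<bar>Q \<bullet> w\<bar> \<longleftrightarrow> Q \<bullet> (u - w) \<noteq> 0 \<and> Q \<bullet> (u + w) \<noteq> 0"
  unfolding inner_diff_right inner_add_right abs_eq_iff by (simp add: eq_neg_iff_add_eq_0)

lemma nonparallel_sum_diff:
  assumes "\<not> parallel u w"
  shows "u + w \<noteq> 0" "u - w \<noteq> 0"
proof -
  have "parallel u w" if "u + w = 0"
    unfolding parallel_def using that by (intro exI[of _ 1]) simp
  moreover have "parallel u w" if "u - w = 0"
    unfolding parallel_def using that by - (rule exI[of _ 1], rule exI[of _ "-1"], simp)
  ultimately show "u + w \<noteq> 0" "u - w \<noteq> 0" using assms by blast+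
qed

definition frequencies :: "'i set \<Rightarrow> ('i \<Rightarrow> 'a::euclidean_space) \<Rightarrow> bool" where
  "frequencies I k \<longleftrightarrow> (\<forall>i\<in>I. k i \<noteq> 0) \<and> (\<forall>i\<in>I. \<forall>j\<in>I. i \<noteq> j \<longrightarrow> \<not> parallel (k i) (k j))"

text \<open>A momentum outside the finitely many hyperplanes orthogonal to these vectors has no resonances.\<close>

definition resonance_vectors :: "'i set \<Rightarrow> ('i \<Rightarrow> 'a::euclidean_space) \<Rightarrow> 'a set" where
  "resonance_vectors I k = k ` I \<union> (\<lambda>(i, j). k i - k j) ` {(i, j) \<in> I \<times> I. i \<noteq> j} \<union> (\<lambda>(i, j). k i + k j) ` {(i, j) \<in> I \<times> I. i \<noteq> j}"

lemma finite_resonance_vectors: "finite I \<Longrightarrow> finite (resonance_vectors I k)"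
proof -
  assume "finite I"
  then have "finite (I \<times> I)" by simp
  then have "finite {(i, j) \<in> I \<times> I. i \<noteq> j}" by (rule rev_finite_subset) auto
  with \<open>finite I\<close> show ?thesis unfolding resonance_vectors_def by simp
qed

lemma zero_notin_resonance_vectors:
  assumes f: "frequencies I k"
  shows "0 \<notin> resonance_vectors I k"
proof
  have ne: "k i - k j \<noteq> 0" "k i + k j \<noteq> 0" if "i \<in> I" "j \<in> I" "i \<noteq> j" for i j
    using nonparallel_sum_diff[of "k i" "k j"] f that unfolding frequencies_def by blast+
  assume "0 \<in> resonance_vectors I k"
  then show False
    unfolding resonance_vectors_def
  proof (elim UnE imageE)
    fix i assume "0 = k i" "i \<in> I"
    then show False using f unfolding frequencies_def by metis
  next
    fix z assume z: "0 = (case z of (i, j) \<Rightarrow> k i - k j)" "z \<in> {(i, j) \<in> I \<times> I. i \<noteq> j}"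
    then show False using ne(1)[of "fst z" "snd z"] by (simp add: case_prod_unfold mem_Times_iff)
  next
    fix z assume z: "0 = (case z of (i, j) \<Rightarrow> k i + k j)" "z \<in> {(i, j) \<in> I \<times> I. i \<noteq> j}"
    then show False using ne(2)[of "fst z" "snd z"] by (simp add: case_prod_unfold mem_Times_iff)
  qed
qed

lemma nonresonant_off_hyperplanes:
  assumes "\<And>m. m \<in> resonance_vectors I k \<Longrightarrow> Q \<bullet> m \<noteq> 0"
  shows "nonresonant I k Q"
  unfolding nonresonant_def
proof (intro conjI ballI impI)
  fix i assume i: "i \<in> I"
  then show "Q \<bullet> k i \<noteq> 0" by (intro assms) (simp add: resonance_vectors_def)
  fix j assume j: "j \<in> I" "i \<noteq> j"
  have "(i, j) \<in> {(i, j) \<in> I \<times> I. i \<noteq> j}" using i j by simp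
  then have "(\<lambda>(i, j). k i - k j) (i, j) \<in> resonance_vectors I k" "(\<lambda>(i, j). k i + k j) (i, j) \<in> resonance_vectors I k"
    unfolding resonance_vectors_def by blast+
  then have "k i - k j \<in> resonance_vectors I k" "k i + k j \<in> resonance_vectors I k" by simp_all
  then show "\<bar>Q \<bullet> k i\<bar> \<noteq> \<bar>Q \<bullet> k j\<bar>" using assms unfolding abs_inner_neq_iff by simp
qed

text \<open>Both second coefficients agree off finitely many hyperplanes, so they have the same poles with the same
strengths, and no two frequencies of one family share a pole.\<close>

lemma same_value_directions:
  fixes k1 k2 :: "'i \<Rightarrow> 'a::euclidean_space"
  assumes fin: "finite I" and same: "same_value (cos_potential a1 I A1 k1 \<theta>1) (cos_potential a2 I A2 k2 \<theta>2)"
    and k1: "frequencies I k1" and k2: "frequencies I k2"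
    and A: "\<And>i. i \<in> I \<Longrightarrow> A1 i > 0" "\<And>i. i \<in> I \<Longrightarrow> A2 i > 0"
  shows "a1 = a2 \<and> (\<exists>f. inj_on f I \<and> f ` I \<subseteq> I \<and> (\<forall>i\<in>I. parallel (k1 i) (k2 (f i)) \<and> A1 i = A2 (f i)))"
proof -
  define S where "S = resonance_vectors I k1 \<union> resonance_vectors I k2"
  have S: "finite S" "0 \<notin> S"
    using finite_resonance_vectors[OF fin] zero_notin_resonance_vectors k1 k2 by (auto simp: S_def)
  have nr: "nonresonant I k1 Q \<and> nonresonant I k2 Q" if "\<And>m. m \<in> S \<Longrightarrow> Q \<bullet> m \<noteq> 0" for Q
    using that by (auto simp: S_def intro: nonresonant_off_hyperplanes)
  obtain w where "\<forall>m\<in>S. w \<bullet> m \<noteq> 0" using exists_off_hyperplanes[OF S] by blast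
  then have a: "a1 = a2" using same_value_second_coeff(1)[OF fin same] nr[of w] by blast
  have "\<exists>j\<in>I. parallel (k1 i) (k2 j) \<and> A1 i = A2 j" if i: "i \<in> I" for i
  proof -
    define u where "u = k1 i"
    have u: "u \<noteq> 0" using k1 i by (auto simp: frequencies_def u_def)
    have fin': "finite {m \<in> S. \<not> parallel u m}" using S by simp
    have "\<exists>Q. Q \<bullet> u = 0 \<and> (\<forall>m\<in>{m \<in> S. \<not> parallel u m}. Q \<bullet> m \<noteq> 0)"
      by (rule exists_in_hyperplane_off_hyperplanes[OF fin' u]) simp
    then obtain Q where Q: "Q \<bullet> u = 0" "\<And>m. m \<in> S \<Longrightarrow> \<not> parallel u m \<Longrightarrow> Q \<bullet> m \<noteq> 0"
      by auto
    have "\<forall>\<^sub>F s in at 0. (Q + s *\<^sub>R u) \<bullet> m \<noteq> 0" if m: "m \<in> S" for m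
    proof (rule eventually_inner_neq_0)
      show "Q \<bullet> m \<noteq> 0 \<or> u \<bullet> m \<noteq> 0"
      proof (cases "parallel u m")
        case True
        then obtain c where "m = c *\<^sub>R u" using parallel_iff_scaleR[OF u] by blast
        moreover have "m \<noteq> 0" using m S by auto
        ultimately show ?thesis using u by auto
      qed (use Q(2) m in auto)
    qed
    then have "\<forall>\<^sub>F s in at 0. \<forall>m\<in>S. (Q + s *\<^sub>R u) \<bullet> m \<noteq> 0" using S(1) by (simp add: eventually_ball_finite)
    then have eq: "\<forall>\<^sub>F s in at 0. s\<^sup>2 * second_coeff I A1 k1 (Q + s *\<^sub>R u) = s\<^sup>2 * second_coeff I A2 k2 (Q + s *\<^sub>R u)"
      by eventually_elim (use same_value_second_coeff(2)[OF fin same] nr in simp)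
    have in_S: "k1 j \<in> S" "k2 j \<in> S" if "j \<in> I" for j using that by (auto simp: S_def resonance_vectors_def)
    have l1: "((\<lambda>s. s\<^sup>2 * second_coeff I A1 k1 (Q + s *\<^sub>R u)) \<longlongrightarrow>
      (\<Sum>j\<in>I. if parallel u (k1 j) then (A1 j)\<^sup>2 / (4 * (norm u)\<^sup>2) else 0)) (at 0)"
      by (rule second_coeff_pole[OF u Q(1)]) (use k1 Q(2) in_S in \<open>auto simp: frequencies_def\<close>)
    have l2: "((\<lambda>s. s\<^sup>2 * second_coeff I A2 k2 (Q + s *\<^sub>R u)) \<longlongrightarrow>
      (\<Sum>j\<in>I. if parallel u (k2 j) then (A2 j)\<^sup>2 / (4 * (norm u)\<^sup>2) else 0)) (at 0)"
      by (rule second_coeff_pole[OF u Q(1)]) (use k2 Q(2) in_S in \<open>auto simp: frequencies_def\<close>)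
    have l2': "((\<lambda>s. s\<^sup>2 * second_coeff I A1 k1 (Q + s *\<^sub>R u)) \<longlongrightarrow>
      (\<Sum>j\<in>I. if parallel u (k2 j) then (A2 j)\<^sup>2 / (4 * (norm u)\<^sup>2) else 0)) (at 0)"
    proof (rule Lim_transform_eventually[OF l2])
      show "\<forall>\<^sub>F s in at 0. s\<^sup>2 * second_coeff I A2 k2 (Q + s *\<^sub>R u) = s\<^sup>2 * second_coeff I A1 k1 (Q + s *\<^sub>R u)"
        using eq by (rule eventually_mono) (rule sym)
    qed
    have sums: "(\<Sum>j\<in>I. if parallel u (k1 j) then (A1 j)\<^sup>2 / (4 * (norm u)\<^sup>2) else 0) =
      (\<Sum>j\<in>I. if parallel u (k2 j) then (A2 j)\<^sup>2 / (4 * (norm u)\<^sup>2) else 0)"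
      by (rule tendsto_unique[OF _ l1 l2']) simp
    have "(\<Sum>j\<in>I. if parallel u (k1 j) then (A1 j)\<^sup>2 / (4 * (norm u)\<^sup>2) else 0) =
      (\<Sum>j\<in>I. if j = i then (A1 j)\<^sup>2 / (4 * (norm u)\<^sup>2) else 0)"
    proof (intro sum.cong refl)
      fix j assume "j \<in> I"
      moreover have "parallel u u" using parallel_iff_scaleR[OF u] by (metis scaleR_one)
      ultimately show "(if parallel u (k1 j) then (A1 j)\<^sup>2 / (4 * (norm u)\<^sup>2) else 0) = (if j = i then (A1 j)\<^sup>2 / (4 * (norm u)\<^sup>2) else 0)"
        using k1 i unfolding frequencies_def u_def by auto
    qed
    also have "\<dots> = (A1 i)\<^sup>2 / (4 * (norm u)\<^sup>2)" using fin i by (simp add: sum.delta)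
    finally have lhs: "(\<Sum>j\<in>I. if parallel u (k2 j) then (A2 j)\<^sup>2 / (4 * (norm u)\<^sup>2) else 0) = (A1 i)\<^sup>2 / (4 * (norm u)\<^sup>2)"
      using sums by simp
    have pos: "(A1 i)\<^sup>2 / (4 * (norm u)\<^sup>2) > 0" using A(1)[OF i] u by simp
    have "\<exists>j\<in>I. parallel u (k2 j)"
    proof (rule ccontr)
      assume "\<not> ?thesis"
      then have "(\<Sum>j\<in>I. if parallel u (k2 j) then (A2 j)\<^sup>2 / (4 * (norm u)\<^sup>2) else 0) = 0" by (intro sum.neutral) auto
      then show False using lhs pos by linarith
    qed
    then obtain j where j: "j \<in> I" "parallel u (k2 j)" by blast
    have "(\<Sum>l\<in>I. if parallel u (k2 l) then (A2 l)\<^sup>2 / (4 * (norm u)\<^sup>2) else 0) =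
      (\<Sum>l\<in>I. if l = j then (A2 l)\<^sup>2 / (4 * (norm u)\<^sup>2) else 0)"
    proof (intro sum.cong refl)
      fix l assume l: "l \<in> I"
      have lj: "l = j" if "parallel u (k2 l)"
      proof (rule ccontr)
        assume "l \<noteq> j"
        then have "\<not> parallel (k2 l) (k2 j)" using k2 l j(1) unfolding frequencies_def by blast
        then show False
          using parallel_common[OF parallel_sym[OF that] parallel_sym[OF j(2)] u] by blast
      qed
      show "(if parallel u (k2 l) then (A2 l)\<^sup>2 / (4 * (norm u)\<^sup>2) else 0) = (if l = j then (A2 l)\<^sup>2 / (4 * (norm u)\<^sup>2) else 0)"
      proof (cases "l = j")
        case True
        then show ?thesis using j(2) by simp
      next
        case False
        then have "\<not> parallel u (k2 l)" using lj by blast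
        then show ?thesis using False by simp
      qed
    qed
    also have "\<dots> = (A2 j)\<^sup>2 / (4 * (norm u)\<^sup>2)" using fin j by (simp add: sum.delta)
    finally have "(A2 j)\<^sup>2 / (4 * (norm u)\<^sup>2) = (A1 i)\<^sup>2 / (4 * (norm u)\<^sup>2)" using lhs by linarith
    then have "(A2 j)\<^sup>2 = (A1 i)\<^sup>2" using u by simp
    then have "A1 i = A2 j" using A(1)[OF i] A(2)[OF j(1)] using power2_eq_iff_nonneg[of "A2 j" "A1 i"] by simp
    then show ?thesis using j unfolding u_def by blast
  qed
  then have "\<forall>i\<in>I. \<exists>j. j \<in> I \<and> parallel (k1 i) (k2 j) \<and> A1 i = A2 j" by blast
  from bchoice[OF this] obtain f where f: "\<And>i. i \<in> I \<Longrightarrow> f i \<in> I \<and> parallel (k1 i) (k2 (f i)) \<and> A1 i = A2 (f i)"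
    by blast
  have "inj_on f I"
  proof (rule inj_onI, rule ccontr)
    fix i j assume ij: "i \<in> I" "j \<in> I" "f i = f j" "i \<noteq> j"
    have p: "parallel (k1 i) (k2 (f i))" "parallel (k1 j) (k2 (f i))" "k2 (f i) \<noteq> 0"
      using f[OF ij(1)] f[OF ij(2)] ij(3) k2 unfolding frequencies_def by auto
    have "parallel (k1 i) (k1 j)" by (rule parallel_common[OF p])
    then show False using k1 ij unfolding frequencies_def by blast
  qed
  then show ?thesis using a f by blast
qed

section \<open>Proportions detected by degenerate triangles\<close>

text \<open>Coplanar frequencies satisfy \<open>\<alpha>1 *\<^sub>R k1 + \<alpha>2 *\<^sub>R k2 + \<alpha>3 *\<^sub>R k3 = 0\<close>. The triples of numbers
\<open>rj = \<bar>\<alpha>j * (Q \<bullet> kj)\<bar>\<close> attained by momenta \<open>Q\<close> are the degenerate triangles, and with \<open>xj = \<bar>\<alpha>j\<bar>\<close> the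
pair \<open>i\<close>, \<open>j\<close> satisfies \<open>\<bar>Q \<bullet> ki\<bar> = \<bar>Q \<bullet> kj\<bar>\<close> if and only if \<open>xj * ri = xi * rj\<close>. The flags tell which pairs
are not orthogonal. The predicate says that every momentum at which exactly one pair of the triple \<open>x\<close> resonates is
resonant for some pair of the triple \<open>y\<close>.\<close>

definition transfers :: "bool \<Rightarrow> bool \<Rightarrow> bool \<Rightarrow> real \<Rightarrow> real \<Rightarrow> real \<Rightarrow> real \<Rightarrow> real \<Rightarrow> real \<Rightarrow> bool" where
  "transfers e12 e13 e23 x1 x2 x3 y1 y2 y3 \<longleftrightarrow>
    (\<forall>r1 r2 r3. r1 > 0 \<longrightarrow> r2 > 0 \<longrightarrow> r3 > 0 \<longrightarrow> (r1 = r2 + r3 \<or> r2 = r1 + r3 \<or> r3 = r1 + r2) \<longrightarrow>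
      (e12 \<and> x2 * r1 = x1 * r2 \<and> \<not> (e13 \<and> x3 * r1 = x1 * r3) \<and> \<not> (e23 \<and> x3 * r2 = x2 * r3) \<or>
       \<not> (e12 \<and> x2 * r1 = x1 * r2) \<and> (e13 \<and> x3 * r1 = x1 * r3) \<and> \<not> (e23 \<and> x3 * r2 = x2 * r3) \<or>
       \<not> (e12 \<and> x2 * r1 = x1 * r2) \<and> \<not> (e13 \<and> x3 * r1 = x1 * r3) \<and> (e23 \<and> x3 * r2 = x2 * r3)) \<longrightarrow>
      e12 \<and> y2 * r1 = y1 * r2 \<or> e13 \<and> y3 * r1 = y1 * r3 \<or> e23 \<and> y3 * r2 = y2 * r3)"

lemma transfersD:
  assumes "transfers e12 e13 e23 x1 x2 x3 y1 y2 y3" "r1 > 0" "r2 > 0" "r3 > 0" "r1 = r2 + r3 \<or> r2 = r1 + r3 \<or> r3 = r1 + r2"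
  shows "e12 \<Longrightarrow> x2 * r1 = x1 * r2 \<Longrightarrow> \<not> (e13 \<and> x3 * r1 = x1 * r3) \<Longrightarrow> \<not> (e23 \<and> x3 * r2 = x2 * r3) \<Longrightarrow>
      e12 \<and> y2 * r1 = y1 * r2 \<or> e13 \<and> y3 * r1 = y1 * r3 \<or> e23 \<and> y3 * r2 = y2 * r3"
    "\<not> (e12 \<and> x2 * r1 = x1 * r2) \<Longrightarrow> e13 \<Longrightarrow> x3 * r1 = x1 * r3 \<Longrightarrow> \<not> (e23 \<and> x3 * r2 = x2 * r3) \<Longrightarrow>
      e12 \<and> y2 * r1 = y1 * r2 \<or> e13 \<and> y3 * r1 = y1 * r3 \<or> e23 \<and> y3 * r2 = y2 * r3"
    "\<not> (e12 \<and> x2 * r1 = x1 * r2) \<Longrightarrow> \<not> (e13 \<and> x3 * r1 = x1 * r3) \<Longrightarrow> e23 \<Longrightarrow> x3 * r2 = x2 * r3 \<Longrightarrow>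
      e12 \<and> y2 * r1 = y1 * r2 \<or> e13 \<and> y3 * r1 = y1 * r3 \<or> e23 \<and> y3 * r2 = y2 * r3"
  using assms(1)[unfolded transfers_def, rule_format, OF assms(2-5)] by blast+

lemma transfers_swap12:
  assumes "transfers e12 e13 e23 x1 x2 x3 y1 y2 y3"
  shows "transfers e12 e23 e13 x2 x1 x3 y2 y1 y3"
  unfolding transfers_def
proof (intro allI impI)
  fix r1 r2 r3 :: real
  assume pos: "r1 > 0" "r2 > 0" "r3 > 0" and deg: "r1 = r2 + r3 \<or> r2 = r1 + r3 \<or> r3 = r1 + r2"
    and h: "e12 \<and> x1 * r1 = x2 * r2 \<and> \<not> (e23 \<and> x3 * r1 = x2 * r3) \<and> \<not> (e13 \<and> x3 * r2 = x1 * r3) \<or>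
       \<not> (e12 \<and> x1 * r1 = x2 * r2) \<and> (e23 \<and> x3 * r1 = x2 * r3) \<and> \<not> (e13 \<and> x3 * r2 = x1 * r3) \<or>
       \<not> (e12 \<and> x1 * r1 = x2 * r2) \<and> \<not> (e23 \<and> x3 * r1 = x2 * r3) \<and> (e13 \<and> x3 * r2 = x1 * r3)"
  have deg': "r2 = r1 + r3 \<or> r1 = r2 + r3 \<or> r3 = r2 + r1" using deg by auto
  have sym: "(x2 * r2 = x1 * r1) = (x1 * r1 = x2 * r2)" "(y2 * r2 = y1 * r1) = (y1 * r1 = y2 * r2)" by auto
  show "e12 \<and> y1 * r1 = y2 * r2 \<or> e23 \<and> y3 * r1 = y2 * r3 \<or> e13 \<and> y3 * r2 = y1 * r3"
    using assms[unfolded transfers_def, rule_format, OF pos(2,1,3) deg'] h unfolding sym by blast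
qed

lemma transfers_swap23:
  assumes "transfers e12 e13 e23 x1 x2 x3 y1 y2 y3"
  shows "transfers e13 e12 e23 x1 x3 x2 y1 y3 y2"
  unfolding transfers_def
proof (intro allI impI)
  fix r1 r2 r3 :: real
  assume pos: "r1 > 0" "r2 > 0" "r3 > 0" and deg: "r1 = r2 + r3 \<or> r2 = r1 + r3 \<or> r3 = r1 + r2"
    and h: "e13 \<and> x3 * r1 = x1 * r2 \<and> \<not> (e12 \<and> x2 * r1 = x1 * r3) \<and> \<not> (e23 \<and> x2 * r2 = x3 * r3) \<or>
       \<not> (e13 \<and> x3 * r1 = x1 * r2) \<and> (e12 \<and> x2 * r1 = x1 * r3) \<and> \<not> (e23 \<and> x2 * r2 = x3 * r3) \<or>
       \<not> (e13 \<and> x3 * r1 = x1 * r2) \<and> \<not> (e12 \<and> x2 * r1 = x1 * r3) \<and> (e23 \<and> x2 * r2 = x3 * r3)"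
  have deg': "r1 = r3 + r2 \<or> r3 = r1 + r2 \<or> r2 = r1 + r3" using deg by auto
  have sym: "(x3 * r3 = x2 * r2) = (x2 * r2 = x3 * r3)" "(y3 * r3 = y2 * r2) = (y2 * r2 = y3 * r3)" by auto
  show "e13 \<and> y3 * r1 = y1 * r2 \<or> e12 \<and> y2 * r1 = y1 * r3 \<or> e23 \<and> y2 * r2 = y3 * r3"
    using assms[unfolded transfers_def, rule_format, OF pos(1,3,2) deg'] h unfolding sym by blast
qed

lemma transfers_scale:
  assumes s: "s \<noteq> 0"
  shows "transfers e12 e13 e23 x1 x2 x3 (s * y1) (s * y2) (s * y3) = transfers e12 e13 e23 x1 x2 x3 y1 y2 y3"
    "transfers e12 e13 e23 (s * y1) (s * y2) (s * y3) x1 x2 x3 = transfers e12 e13 e23 y1 y2 y3 x1 x2 x3"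
  using s unfolding transfers_def mult.assoc by simp_all

text \<open>Two pairs can resonate, 13 and 23, and both triples are scaled to have the third entry \<open>s\<close>. The triangle
\<open>(x1, x1 + s, s)\<close> makes the pair 13 resonant and \<open>(x2 + s, x2, s)\<close> the pair 23. Unless the respective
other pair resonates as well, each of them forces an equation on the other triple. The four
equations so obtained, two in each direction, are incompatible with \<open>x1 \<noteq> y1\<close>.\<close>

lemma ratio_rigidity_path_half:
  assumes pos: "x1 > 0" "x2 > 0" "s > 0" "y1 > 0" "y2 > 0"
    and T: "transfers False True True x1 x2 s y1 y2 s" "transfers False True True y1 y2 s x1 x2 s"
  shows "x1 = y1"
proof (rule ccontr)
  assume ne: "x1 \<noteq> y1"
  have c2: "z2 = x1' + s" if t: "transfers False True True x1' x2' s z1 z2 s" and p: "x1' > 0" and n: "x2' \<noteq> x1' + s" "x1' \<noteq> z1"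
    for x1' x2' z1 z2
    using transfersD(2)[OF t, of x1' "x1' + s" s] p n pos by (auto simp: mult.commute[of _ s])
  have c1: "z1 = x2' + s" if t: "transfers False True True x1' x2' s z1 z2 s" and p: "x2' > 0" and n: "x1' \<noteq> x2' + s" "x2' \<noteq> z2"
    for x1' x2' z1 z2
    using transfersD(3)[OF t, of "x2' + s" x2' s] p n pos by (auto simp: mult.commute[of _ s])
  show False
  proof (cases "x2 = x1 + s")
    case True
    have y2: "y2 = y1 + s"
    proof (rule ccontr)
      assume "y2 \<noteq> y1 + s"
      from c2[OF T(2) pos(4) this ne[symmetric]] show False using True ne by simp
    qed
    have n: "x1 \<noteq> x2 + s" "y1 \<noteq> y2 + s" "x2 \<noteq> y2" using True y2 ne pos by auto
    have "y1 = x2 + s" by (rule c1[OF T(1) pos(2) n(1,3)])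
    moreover have "x1 = y2 + s" by (rule c1[OF T(2) pos(5) n(2) n(3)[symmetric]])
    ultimately show False using True y2 pos by linarith
  next
    case False
    have y2: "y2 = x1 + s" by (rule c2[OF T(1) pos(1) False ne])
    then have "y2 \<noteq> y1 + s" using ne by simp
    then have x2: "x2 = y1 + s" by (rule c2[OF T(2) pos(4) _ ne[symmetric]])
    have n: "x2 \<noteq> y2" using x2 y2 ne by simp
    have "x1 = x2 + s"
    proof (rule ccontr)
      assume "x1 \<noteq> x2 + s"
      from c1[OF T(1) pos(2) this n] show False using x2 pos by simp
    qed
    moreover have "y1 = y2 + s"
    proof (rule ccontr)
      assume "y1 \<noteq> y2 + s"
      from c1[OF T(2) pos(5) this n[symmetric]] show False using y2 pos by simp
    qed
    ultimately show False using x2 y2 pos by linarith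
  qed
qed

lemma ratio_rigidity_path:
  assumes pos: "x1 > 0" "x2 > 0" "x3 > 0" "y1 > 0" "y2 > 0" "y3 > 0"
    and T: "transfers False True True x1 x2 x3 y1 y2 y3" "transfers False True True y1 y2 y3 x1 x2 x3"
  shows "y1 / x1 = y3 / x3" "y2 / x2 = y3 / x3"
proof -
  define s where "s = x3 / y3"
  have s: "s > 0" "s * y3 = x3" using pos by (auto simp: s_def)
  have T': "transfers False True True x1 x2 x3 (s * y1) (s * y2) x3" "transfers False True True (s * y1) (s * y2) x3 x1 x2 x3"
    using T transfers_scale(1)[of s False True True x1 x2 x3 y1 y2 y3]
      transfers_scale(2)[of s False True True y1 y2 y3 x1 x2 x3] s by simp_all
  have "x1 = s * y1" by (rule ratio_rigidity_path_half[OF _ _ _ _ _ T']) (use pos s in auto)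
  moreover have "x2 = s * y2"
    by (rule ratio_rigidity_path_half[OF _ _ _ _ _ transfers_swap12[OF T'(1)] transfers_swap12[OF T'(2)]]) (use pos s in auto)
  ultimately show "y1 / x1 = y3 / x3" "y2 / x2 = y3 / x3" using pos s by (auto simp: s_def divide_simps mult.commute)
qed

text \<open>All three pairs can resonate. With third entries scaled to \<open>s\<close> and the quotients \<open>y1 / x1 \<le> y2 / x2 \<le> 1\<close> in order,
suppose \<open>y1 < x1\<close>. The triangles \<open>(x1, x1 + s, s)\<close>, \<open>(x2 + s, x2, s)\<close> and \<open>(x2 - s, x2, s)\<close> for the pairs 13 and 23,
and \<open>(x1, x2, x2 - x1)\<close> and \<open>(x1, x2, x1 + x2)\<close> for the pair 12, together with the counterparts of the first
and the last for \<open>y\<close>, leave a few equations, and the order of the quotients excludes every one of their combinations.\<close>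

lemma ratio_rigidity_triangle_ordered:
  assumes pos: "x1 > 0" "x2 > 0" "s > 0" "y1 > 0" "y2 > 0"
    and ord: "y1 * x2 \<le> y2 * x1" "y2 \<le> x2"
    and T: "transfers True True True x1 x2 s y1 y2 s" "transfers True True True y1 y2 s x1 x2 s"
  shows "y1 = x1" "y2 = x2"
proof -
  have "y1 * x2 \<le> x2 * x1" using ord pos by (meson mult_right_mono less_imp_le order_trans)
  then have le: "y1 \<le> x1" using pos by (simp add: mult.commute)
  have "False" if less: "y1 < x1"
  proof -
    have cancel: "s * a = b * s \<longleftrightarrow> a = b" "a * s = b * s \<longleftrightarrow> a = b" for a b using pos by auto
    have A: "y2 * x1 = y1 * (x1 + s) \<or> y2 = x1 + s" if n: "x2 \<noteq> x1 + s"
    proof -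
      have "x2 * x1 \<noteq> x1 * (x1 + s)" "s * (x1 + s) \<noteq> x2 * s" using n pos by auto
      then show ?thesis
        using transfersD(2)[OF T(1), of x1 "x1 + s" s] pos less by (auto simp: cancel)
    qed
    have A': "x2 * y1 = x1 * (y1 + s) \<or> x2 = y1 + s" if n: "y2 \<noteq> y1 + s"
    proof -
      have "y2 * y1 \<noteq> y1 * (y1 + s)" "s * (y1 + s) \<noteq> y2 * s" using n pos by auto
      then show ?thesis
        using transfersD(2)[OF T(2), of y1 "y1 + s" s] pos less by (auto simp: cancel)
    qed
    show False
    proof (cases "x2 = x1 + s"; cases "y2 = y1 + s")
      assume d: "x2 = x1 + s" "y2 = y1 + s"
      have "y2 * (x2 + s) = y1 * x2 \<or> s * (x2 + s) = y1 * s \<or> s * x2 = y2 * s"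
      proof -
        have "x2 * (x2 + s) \<noteq> x1 * x2" "s * (x2 + s) \<noteq> x1 * s" using d pos by auto
        then show ?thesis using transfersD(3)[OF T(1), of "x2 + s" x2 s] pos by (auto simp: mult.commute)
      qed
      moreover have "y2 * (x2 + s) > y1 * x2" using d pos by (intro mult_strict_mono) auto
      ultimately show False using d less pos by (auto simp: cancel)
    next
      assume d: "x2 = x1 + s" "y2 \<noteq> y1 + s"
      then show False using A' less pos by (auto simp: algebra_simps)
    next
      assume d: "x2 \<noteq> x1 + s" "y2 = y1 + s"
      then show False using A less pos by (auto simp: algebra_simps)
    next
      assume d: "x2 \<noteq> x1 + s" "y2 \<noteq> y1 + s"
      show False using A'[OF d(2)]
      proof
        assume C: "x2 * y1 = x1 * (y1 + s)"
        show False using A[OF d(1)]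
        proof
          assume "y2 * x1 = y1 * (x1 + s)"
          then have "x1 * (y1 + s) \<le> y1 * (x1 + s)" using C ord by (simp add: mult.commute)
          then show False using less pos by (simp add: algebra_simps)
        next
          assume B': "y2 = x1 + s"
          then have gt: "x2 > x1 + s" using ord(2) d(1) by simp
          have n: "x2 * (x2 - s) \<noteq> x1 * x2" "s * (x2 - s) \<noteq> x1 * s" using gt pos by auto
          have "y2 * (x2 - s) = y1 * x2 \<or> s * (x2 - s) = y1 * s \<or> s * x2 = y2 * s"
            using transfersD(3)[OF T(1), of "x2 - s" x2 s] n pos gt by (auto simp: mult.commute)
          moreover have "y2 * (x2 - s) > y1 * x2"
          proof -
            have "y2 * (x2 - s) = x1 * x2 + s * (x2 - x1 - s)" unfolding B' by (simp add: algebra_simps)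
            moreover have "s * (x2 - x1 - s) > 0" using gt pos by simp
            moreover have "y1 * x2 < x1 * x2" using less pos by simp
            ultimately show ?thesis by linarith
          qed
          ultimately show False using gt B' less pos by (auto simp: cancel)
        qed
      next
        assume B: "x2 = y1 + s"
        have C': "y2 * x1 = y1 * (x1 + s)" using A[OF d(1)] ord(2) B less by auto
        have x21: "x2 \<le> x1"
        proof (rule ccontr)
          assume gt: "\<not> x2 \<le> x1"
          have n: "s * x1 \<noteq> x1 * (x2 - x1)" "s * x2 \<noteq> x2 * (x2 - x1)" using d(1) pos by auto
          have "y2 * x1 = y1 * x2 \<or> s * x1 = y1 * (x2 - x1) \<or> s * x2 = y2 * (x2 - x1)"
            using transfersD(1)[OF T(1), of x1 x2 "x2 - x1"] n pos gt by (auto simp: mult.commute)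
          moreover have "y2 * x1 \<noteq> y1 * x2" using C' d(1) pos by auto
          moreover have "s * x1 \<noteq> y1 * (x2 - x1)"
          proof
            assume "s * x1 = y1 * (x2 - x1)"
            then have "(x1 - y1) * (s + y1) = 0" unfolding B by (simp add: algebra_simps)
            then show False using less pos by simp
          qed
          moreover have "y2 * (x2 - x1) < s * x2"
          proof -
            have "y2 * (x2 - x1) \<le> x2 * (x2 - x1)" using ord(2) gt by (intro mult_right_mono) auto
            also have "\<dots> < x2 * s" using B less pos by (intro mult_strict_left_mono) auto
            finally show ?thesis by (simp add: mult.commute)
          qed
          ultimately show False by linarith
        qed
        have y12: "y1 < y2"
        proof -
          have "y1 * x1 < y2 * x1" unfolding C' using pos by simp
          then show ?thesis using pos by simp
        qed
        have sx: "s < x2" using B pos by simp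
        have nC: "y2 * x1 \<noteq> y1 * x2" using C' d(1) pos by auto
        have "s = y1 + y2"
        proof (rule ccontr)
          assume ne: "s \<noteq> y1 + y2"
          have n: "s * y1 \<noteq> y1 * (y1 + y2)" "s * y2 \<noteq> y2 * (y1 + y2)" using ne pos by auto
          have "x2 * y1 = x1 * y2 \<or> s * y1 = x1 * (y1 + y2) \<or> s * y2 = x2 * (y1 + y2)"
            using transfersD(1)[OF T(2), of y1 y2 "y1 + y2"] n pos by (auto simp: mult.commute)
          moreover have "x2 * y1 < x1 * y2" using nC ord(1) by (simp add: mult.commute)
          moreover have "s * y1 < x1 * (y1 + y2)" using sx x21 pos by (intro mult_strict_mono) auto
          moreover have "s * y2 < x2 * (y1 + y2)" using sx pos by (intro mult_strict_mono) auto
          ultimately show False by linarith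
        qed
        have n: "s * x1 \<noteq> x1 * (x1 + x2)" "s * x2 \<noteq> x2 * (x1 + x2)" using sx pos by auto
        have "y2 * x1 = y1 * x2 \<or> s * x1 = y1 * (x1 + x2) \<or> s * x2 = y2 * (x1 + x2)"
          using transfersD(1)[OF T(1), of x1 x2 "x1 + x2"] n pos by (auto simp: mult.commute)
        then show False using nC unfolding \<open>s = y1 + y2\<close> by (auto simp: algebra_simps)
      qed
    qed
  qed
  then show y1: "y1 = x1" using le by force
  show "y2 = x2" using ord pos unfolding y1 by (simp add: mult.commute)
qed

text \<open>The statement is symmetric in the three indices, so the quotients may be taken in increasing order.\<close>

lemma ratio_rigidity_triangle:
  assumes pos: "x1 > 0" "x2 > 0" "x3 > 0" "y1 > 0" "y2 > 0" "y3 > 0"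
    and T: "transfers True True True x1 x2 x3 y1 y2 y3" "transfers True True True y1 y2 y3 x1 x2 x3"
  shows "y1 / x1 = y3 / x3 \<and> y2 / x2 = y3 / x3"
proof -
  have main: "v1 / u1 = v3 / u3 \<and> v2 / u2 = v3 / u3"
    if p: "u1 > 0" "u2 > 0" "u3 > 0" "v1 > 0" "v2 > 0" "v3 > 0" and o: "v1 / u1 \<le> v2 / u2" "v2 / u2 \<le> v3 / u3"
      and t: "transfers True True True u1 u2 u3 v1 v2 v3" "transfers True True True v1 v2 v3 u1 u2 u3" for u1 u2 u3 v1 v2 v3
  proof -
    define s where "s = u3 / v3"
    have s: "s > 0" "s * v3 = u3" using p by (auto simp: s_def)
    have t': "transfers True True True u1 u2 u3 (s * v1) (s * v2) u3" "transfers True True True (s * v1) (s * v2) u3 u1 u2 u3"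
      using t transfers_scale(1)[of s True True True u1 u2 u3 v1 v2 v3]
        transfers_scale(2)[of s True True True v1 v2 v3 u1 u2 u3] s by simp_all
    have "v1 * u2 \<le> v2 * u1" "v2 * u3 \<le> v3 * u2" using o p by (simp_all add: divide_simps mult.commute)
    then have o': "s * v1 * u2 \<le> s * v2 * u1" "s * v2 \<le> u2" using s p by (simp_all add: s_def field_simps)
    have "s * v1 = u1" "s * v2 = u2"
      by (rule ratio_rigidity_triangle_ordered[OF _ _ _ _ _ o' t']; use p s in simp)+
    then show ?thesis using p s by (auto simp: s_def divide_simps mult.commute)
  qed
  note s12 = transfers_swap12 and s23 = transfers_swap23
  define a b c where "a = y1 / x1" and "b = y2 / x2" and "c = y3 / x3"
  have "a \<le> b \<and> b \<le> c \<or> a \<le> c \<and> c \<le> b \<or> b \<le> a \<and> a \<le> c \<or> b \<le> c \<and> c \<le> a \<or> c \<le> a \<and> a \<le> b \<or> c \<le> b \<and> b \<le> a"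
    by linarith
  then show ?thesis
  proof (elim disjE conjE)
    assume "a \<le> b" "b \<le> c"
    then show ?thesis using main[OF pos(1,2,3,4,5,6) _ _ T] by (simp add: a_def b_def c_def)
  next
    assume "a \<le> c" "c \<le> b"
    then show ?thesis using main[OF pos(1,3,2,4,6,5) _ _ s23[OF T(1)] s23[OF T(2)]] by (simp add: a_def b_def c_def)
  next
    assume "b \<le> a" "a \<le> c"
    then show ?thesis using main[OF pos(2,1,3,5,4,6) _ _ s12[OF T(1)] s12[OF T(2)]] by (simp add: a_def b_def c_def)
  next
    assume "b \<le> c" "c \<le> a"
    then show ?thesis using main[OF pos(2,3,1,5,6,4) _ _ s23[OF s12[OF T(1)]] s23[OF s12[OF T(2)]]] by (simp add: a_def b_def c_def)
  next
    assume "c \<le> a" "a \<le> b"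
    then show ?thesis using main[OF pos(3,1,2,6,4,5) _ _ s12[OF s23[OF T(1)]] s12[OF s23[OF T(2)]]] by (simp add: a_def b_def c_def)
  next
    assume "c \<le> b" "b \<le> a"
    then show ?thesis using main[OF pos(3,2,1,6,5,4) _ _ s12[OF s23[OF s12[OF T(1)]]] s12[OF s23[OF s12[OF T(2)]]]]
      by (simp add: a_def b_def c_def)
  qed
qed

section \<open>Lengths of the frequencies\<close>

lemma parallel_zero: "parallel u 0" "parallel 0 u"
proof -
  show "parallel u 0" unfolding parallel_def by (rule exI[of _ 0], rule exI[of _ 1]) simp
  then show "parallel 0 u" by (rule parallel_sym)
qed

lemma exists_inner_two:
  fixes u w :: "'a::euclidean_space"
  assumes np: "\<not> parallel u w"
  shows "\<exists>Q. Q \<bullet> u = a \<and> Q \<bullet> w = b"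
proof -
  have 0: "u \<noteq> 0" "w \<noteq> 0" using np parallel_zero by auto
  have np': "\<not> parallel w u" using np parallel_sym by blast
  obtain Q1 where Q1: "Q1 \<bullet> w = 0" "Q1 \<bullet> u \<noteq> 0"
    using exists_in_hyperplane_off_hyperplanes[of "{u}" w] np' 0 by auto
  obtain Q2 where Q2: "Q2 \<bullet> u = 0" "Q2 \<bullet> w \<noteq> 0"
    using exists_in_hyperplane_off_hyperplanes[of "{w}" u] np 0 by auto
  have "((a / (Q1 \<bullet> u)) *\<^sub>R Q1 + (b / (Q2 \<bullet> w)) *\<^sub>R Q2) \<bullet> u = a"
    "((a / (Q1 \<bullet> u)) *\<^sub>R Q1 + (b / (Q2 \<bullet> w)) *\<^sub>R Q2) \<bullet> w = b"
    using Q1 Q2 by (simp_all add: inner_add_left)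
  then show ?thesis by blast
qed

lemma exists_inner_three:
  fixes u w z :: "'a::euclidean_space"
  assumes np: "\<not> parallel u w" and z: "\<And>\<alpha> \<beta>. z \<noteq> \<alpha> *\<^sub>R u + \<beta> *\<^sub>R w"
  shows "\<exists>Q. Q \<bullet> u = a \<and> Q \<bullet> w = b \<and> Q \<bullet> z = c"
proof -
  have u0: "u \<noteq> 0" using np parallel_zero by auto
  define \<gamma> where "\<gamma> = (w \<bullet> u) / (u \<bullet> u)"
  define w' where "w' = w - \<gamma> *\<^sub>R u"
  have w'0: "w' \<noteq> 0"
  proof
    assume "w' = 0"
    then have "w = \<gamma> *\<^sub>R u" by (simp add: w'_def)
    then show False using np parallel_iff_scaleR[OF u0] by blast
  qed
  have uw': "u \<bullet> w' = 0" using u0 by (simp add: w'_def \<gamma>_def inner_diff_right inner_commute)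
  define z' where "z' = z - ((z \<bullet> u) / (u \<bullet> u)) *\<^sub>R u - ((z \<bullet> w') / (w' \<bullet> w')) *\<^sub>R w'"
  have w'u: "w' \<bullet> u = 0" using uw' by (simp only: inner_commute)
  have "z' \<bullet> u = 0" using u0 w'u by (simp add: z'_def inner_diff_left)
  moreover have zw': "z' \<bullet> w' = 0" using w'0 uw' by (simp add: z'_def inner_diff_left)
  ultimately have zu: "z' \<bullet> u = 0" and zw: "z' \<bullet> w = 0" by (simp_all add: w'_def inner_diff_right)
  have "z' \<noteq> 0"
  proof
    assume "z' = 0"
    then have "z = ((z \<bullet> u) / (u \<bullet> u) - ((z \<bullet> w') / (w' \<bullet> w')) * \<gamma>) *\<^sub>R u + ((z \<bullet> w') / (w' \<bullet> w')) *\<^sub>R w"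
      unfolding z'_def w'_def by (simp add: algebra_simps)
    then show False using z by blast
  qed
  moreover have "z' \<bullet> z = z' \<bullet> z'"
  proof -
    have "z' \<bullet> z' = z' \<bullet> z - ((z \<bullet> u) / (u \<bullet> u)) * (z' \<bullet> u) - ((z \<bullet> w') / (w' \<bullet> w')) * (z' \<bullet> w')"
      by (subst (2) z'_def) (simp add: inner_diff_right)
    then show ?thesis using zu zw' by simp
  qed
  ultimately have zz: "z' \<bullet> z \<noteq> 0" by simp
  obtain Q where Q: "Q \<bullet> u = a" "Q \<bullet> w = b" using exists_inner_two[OF np] by blast
  have "(Q + ((c - Q \<bullet> z) / (z' \<bullet> z)) *\<^sub>R z') \<bullet> u = a" "(Q + ((c - Q \<bullet> z) / (z' \<bullet> z)) *\<^sub>R z') \<bullet> w = b"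
    "(Q + ((c - Q \<bullet> z) / (z' \<bullet> z)) *\<^sub>R z') \<bullet> z = c"
    using Q zu zw zz by (simp_all add: inner_add_left)
  then show ?thesis by blast
qed

lemma second_coeff_rescale:
  assumes "\<And>j. j \<in> I \<Longrightarrow> c j \<noteq> 0"
  shows "second_coeff I A (\<lambda>j. c j *\<^sub>R k j) Q = second_coeff I A k Q"
  unfolding second_coeff_def
proof (intro sum.cong refl)
  fix j assume "j \<in> I"
  then have "c j \<noteq> 0" by (rule assms)
  then show "(A j)\<^sup>2 * (norm (c j *\<^sub>R k j))\<^sup>2 / (4 * (Q \<bullet> c j *\<^sub>R k j)\<^sup>2) = (A j)\<^sup>2 * (norm (k j))\<^sup>2 / (4 * (Q \<bullet> k j)\<^sup>2)"
    by (simp add: power_mult_distrib)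
qed

text \<open>Independence allows a momentum at which the pair \<open>i\<close>, \<open>j\<close> resonates and \<open>l\<close> resonates with neither, before or after
the stretching. The resonance required by \<open>resonance_transfer\<close> is then again that of \<open>i\<close> and \<open>j\<close>.\<close>

lemma equal_ratio_independent:
  fixes k :: "'i \<Rightarrow> 'a::euclidean_space"
  assumes I: "I = {i, j, l}" "i \<noteq> j" "i \<noteq> l" "j \<noteq> l"
    and same: "same_value (cos_potential a I A k \<theta>1) (cos_potential a I A (\<lambda>i. c i *\<^sub>R k i) \<theta>2)"
    and A: "\<And>j. j \<in> I \<Longrightarrow> A j \<noteq> 0" and c: "\<And>j. j \<in> I \<Longrightarrow> c j > 0"
    and ij: "k i \<bullet> k j \<noteq> 0" "\<not> parallel (k i) (k j)" and l: "\<And>\<alpha> \<beta>. k l \<noteq> \<alpha> *\<^sub>R k i + \<beta> *\<^sub>R k j"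
  shows "c i = c j"
proof (rule ccontr)
  assume ne: "c i \<noteq> c j"
  have cp: "c i > 0" "c j > 0" "c l > 0" using c I(1) by auto
  \<comment> \<open>\<open>z > 1\<close> excludes resonances of \<open>l\<close> for the given frequencies, and \<open>c l * z > c i, c j\<close> for the stretched ones.\<close>
  define z where "z = 2 + c i / c l + c j / c l"
  have z: "z > 1" using cp by (simp add: z_def add_pos_pos)
  have clz: "c l * z = 2 * c l + c i + c j" using cp by (simp add: z_def algebra_simps)
  obtain Q where Q: "Q \<bullet> k i = 1" "Q \<bullet> k j = 1" "Q \<bullet> k l = z"
    using exists_inner_three[OF ij(2) l] by blast
  have "\<exists>i'\<in>I. \<exists>j'\<in>I. i' \<noteq> j' \<and> (c i' *\<^sub>R k i') \<bullet> (c j' *\<^sub>R k j') \<noteq> 0 \<and> \<bar>Q \<bullet> (c i' *\<^sub>R k i')\<bar> = \<bar>Q \<bullet> (c j' *\<^sub>R k j')\<bar>"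
  proof (rule resonance_transfer[OF _ same])
    show "finite I" using I by simp
    show "second_coeff I A k Q = second_coeff I A (\<lambda>i. c i *\<^sub>R k i) Q"
      by (rule second_coeff_rescale[symmetric]) (use c in force)
    show "A j \<noteq> 0" if "j \<in> I" for j using A that .
    show "Q \<bullet> k j \<noteq> 0" if "j \<in> I" for j using that Q z I(1) by auto
    show "Q \<bullet> c j *\<^sub>R k j \<noteq> 0" if "j \<in> I" for j using that Q z I(1) cp by auto
    show "i \<in> I" "j \<in> I" "i \<noteq> j" "k i \<bullet> k j \<noteq> 0" "\<not> parallel (k i) (k j)" using I ij by auto
    show "\<bar>Q \<bullet> k i\<bar> = \<bar>Q \<bullet> k j\<bar>" using Q by simp
    show "{i', j'} = {i, j}" if "i' \<in> I" "j' \<in> I" "i' \<noteq> j'" "\<bar>Q \<bullet> k i'\<bar> = \<bar>Q \<bullet> k j'\<bar>" for i' j'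
      using that Q z I(1) by auto
  qed
  then obtain i' j' where ij': "i' \<in> I" "j' \<in> I" "i' \<noteq> j'" "\<bar>c i' * (Q \<bullet> k i')\<bar> = \<bar>c j' * (Q \<bullet> k j')\<bar>"
    by auto
  have "\<bar>c i * (Q \<bullet> k i)\<bar> = c i" "\<bar>c j * (Q \<bullet> k j)\<bar> = c j" "\<bar>c l * (Q \<bullet> k l)\<bar> = 2 * c l + c i + c j"
    using Q cp clz by auto
  then show False using ij' ne cp unfolding I(1) by auto
qed

lemma signed_degenerate_triple:
  fixes r1 r2 r3 :: real
  assumes "r1 > 0" "r2 > 0" "r3 > 0" "r1 = r2 + r3 \<or> r2 = r1 + r3 \<or> r3 = r1 + r2"
  shows "\<exists>p1 p2 p3. \<bar>p1\<bar> = r1 \<and> \<bar>p2\<bar> = r2 \<and> \<bar>p3\<bar> = r3 \<and> p1 + p2 + p3 = 0"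
  using assms(4)
proof (elim disjE)
  assume "r1 = r2 + r3"
  then show ?thesis using assms(1-3) by - (rule exI[of _ "- r1"], rule exI[of _ r2], rule exI[of _ r3], simp)
next
  assume "r2 = r1 + r3"
  then show ?thesis using assms(1-3) by - (rule exI[of _ r1], rule exI[of _ "- r2"], rule exI[of _ r3], simp)
next
  assume "r3 = r1 + r2"
  then show ?thesis using assms(1-3) by - (rule exI[of _ r1], rule exI[of _ r2], rule exI[of _ "- r3"], simp)
qed

text \<open>Every signed triple with \<open>p1 + p2 + p3 = 0\<close> is realised by a momentum with \<open>Q \<bullet> k j = p j / \<alpha> j\<close>, since the
first two equations can be solved and imply the third.\<close>

lemma transfers_of_same_value:
  fixes k :: "nat \<Rightarrow> 'a::euclidean_space"
  defines "I \<equiv> {1, 2, 3 :: nat}"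
  assumes same: "same_value (cos_potential a I A k \<theta>1) (cos_potential a I A k2 \<theta>2)"
    and A: "\<And>j. j \<in> I \<Longrightarrow> A j \<noteq> 0" and c: "\<And>j. j \<in> I \<Longrightarrow> c j > 0" and k2: "\<And>j. j \<in> I \<Longrightarrow> k2 j = c j *\<^sub>R k j"
    and k: "frequencies I k" and \<alpha>: "\<alpha> 1 *\<^sub>R k 1 + \<alpha> 2 *\<^sub>R k 2 + \<alpha> 3 *\<^sub>R k 3 = 0" "\<And>j. j \<in> I \<Longrightarrow> \<alpha> j \<noteq> 0"
  shows "transfers (k 1 \<bullet> k 2 \<noteq> 0) (k 1 \<bullet> k 3 \<noteq> 0) (k 2 \<bullet> k 3 \<noteq> 0) \<bar>\<alpha> 1\<bar> \<bar>\<alpha> 2\<bar> \<bar>\<alpha> 3\<bar>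
    (\<bar>\<alpha> 1\<bar> / c 1) (\<bar>\<alpha> 2\<bar> / c 2) (\<bar>\<alpha> 3\<bar> / c 3)"
  unfolding transfers_def
proof (intro allI impI)
  fix r1 r2 r3 :: real
  assume pos: "r1 > 0" "r2 > 0" "r3 > 0" and deg: "r1 = r2 + r3 \<or> r2 = r1 + r3 \<or> r3 = r1 + r2"
  assume single: "k 1 \<bullet> k 2 \<noteq> 0 \<and> \<bar>\<alpha> 2\<bar> * r1 = \<bar>\<alpha> 1\<bar> * r2 \<and> \<not> (k 1 \<bullet> k 3 \<noteq> 0 \<and> \<bar>\<alpha> 3\<bar> * r1 = \<bar>\<alpha> 1\<bar> * r3) \<and> \<not> (k 2 \<bullet> k 3 \<noteq> 0 \<and> \<bar>\<alpha> 3\<bar> * r2 = \<bar>\<alpha> 2\<bar> * r3) \<or>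
    \<not> (k 1 \<bullet> k 2 \<noteq> 0 \<and> \<bar>\<alpha> 2\<bar> * r1 = \<bar>\<alpha> 1\<bar> * r2) \<and> (k 1 \<bullet> k 3 \<noteq> 0 \<and> \<bar>\<alpha> 3\<bar> * r1 = \<bar>\<alpha> 1\<bar> * r3) \<and> \<not> (k 2 \<bullet> k 3 \<noteq> 0 \<and> \<bar>\<alpha> 3\<bar> * r2 = \<bar>\<alpha> 2\<bar> * r3) \<or>
    \<not> (k 1 \<bullet> k 2 \<noteq> 0 \<and> \<bar>\<alpha> 2\<bar> * r1 = \<bar>\<alpha> 1\<bar> * r2) \<and> \<not> (k 1 \<bullet> k 3 \<noteq> 0 \<and> \<bar>\<alpha> 3\<bar> * r1 = \<bar>\<alpha> 1\<bar> * r3) \<and> (k 2 \<bullet> k 3 \<noteq> 0 \<and> \<bar>\<alpha> 3\<bar> * r2 = \<bar>\<alpha> 2\<bar> * r3)"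
  obtain p1 p2 p3 where p: "\<bar>p1\<bar> = r1" "\<bar>p2\<bar> = r2" "\<bar>p3\<bar> = r3" "p1 + p2 + p3 = 0"
    using signed_degenerate_triple[OF pos deg] by blast
  have in_I: "1 \<in> I" "2 \<in> I" "3 \<in> I" by (simp_all add: I_def)
  have \<alpha>0: "\<alpha> 1 \<noteq> 0" "\<alpha> 2 \<noteq> 0" "\<alpha> 3 \<noteq> 0" using \<alpha>(2) in_I by blast+
  have c0: "c 1 > 0" "c 2 > 0" "c 3 > 0" using c in_I by blast+
  have np: "\<not> parallel (k 1) (k 2)" "\<not> parallel (k 1) (k 3)" "\<not> parallel (k 2) (k 3)"
  proof -
    have "\<not> parallel (k i) (k j)" if "i \<in> I" "j \<in> I" "i \<noteq> j" for i j
      using k that unfolding frequencies_def by blast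
    then show "\<not> parallel (k 1) (k 2)" "\<not> parallel (k 1) (k 3)" "\<not> parallel (k 2) (k 3)" using in_I by auto
  qed
  obtain Q where Q12: "Q \<bullet> k 1 = p1 / \<alpha> 1" "Q \<bullet> k 2 = p2 / \<alpha> 2" using exists_inner_two[OF np(1)] by blast
  have "Q \<bullet> (\<alpha> 1 *\<^sub>R k 1 + \<alpha> 2 *\<^sub>R k 2 + \<alpha> 3 *\<^sub>R k 3) = 0" unfolding \<alpha>(1) by simp
  then have "\<alpha> 1 * (p1 / \<alpha> 1) + \<alpha> 2 * (p2 / \<alpha> 2) + \<alpha> 3 * (Q \<bullet> k 3) = 0"
    unfolding inner_add_right inner_scaleR_right Q12 .
  then have "p1 + p2 + \<alpha> 3 * (Q \<bullet> k 3) = 0" using \<alpha>0 by simp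
  then have "\<alpha> 3 * (Q \<bullet> k 3) = p3" using p(4) by linarith
  then have Q3: "Q \<bullet> k 3 = p3 / \<alpha> 3" using \<alpha>0 by (simp add: field_simps)
  have aQ: "\<bar>Q \<bullet> k 1\<bar> = r1 / \<bar>\<alpha> 1\<bar>" "\<bar>Q \<bullet> k 2\<bar> = r2 / \<bar>\<alpha> 2\<bar>" "\<bar>Q \<bullet> k 3\<bar> = r3 / \<bar>\<alpha> 3\<bar>"
    unfolding Q12 Q3 abs_divide p(1-3) by (rule refl)+
  have aQ2: "\<bar>Q \<bullet> k2 1\<bar> = c 1 * (r1 / \<bar>\<alpha> 1\<bar>)" "\<bar>Q \<bullet> k2 2\<bar> = c 2 * (r2 / \<bar>\<alpha> 2\<bar>)" "\<bar>Q \<bullet> k2 3\<bar> = c 3 * (r3 / \<bar>\<alpha> 3\<bar>)"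
    using c0 aQ k2 in_I by (simp_all add: abs_mult)
  have cross: "r / \<bar>s\<bar> = r' / \<bar>s'\<bar> \<longleftrightarrow> \<bar>s'\<bar> * r = \<bar>s\<bar> * r'" if "s \<noteq> 0" "s' \<noteq> 0" for r s r' s' :: real
    using that by (simp add: frac_eq_eq mult.commute)
  have cross2: "d * (r / \<bar>s\<bar>) = d' * (r' / \<bar>s'\<bar>) \<longleftrightarrow> \<bar>s'\<bar> / d' * r = \<bar>s\<bar> / d * r'" if "s \<noteq> 0" "s' \<noteq> 0" "d > 0" "d' > 0" for r s r' s' d d' :: real
    using that by (simp add: frac_eq_eq field_simps)
  define e where "e = (\<lambda>i j. k i \<bullet> k j \<noteq> 0 \<and> \<bar>Q \<bullet> k i\<bar> = \<bar>Q \<bullet> k j\<bar>)"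
  have e: "e 1 2 \<longleftrightarrow> k 1 \<bullet> k 2 \<noteq> 0 \<and> \<bar>\<alpha> 2\<bar> * r1 = \<bar>\<alpha> 1\<bar> * r2" "e 1 3 \<longleftrightarrow> k 1 \<bullet> k 3 \<noteq> 0 \<and> \<bar>\<alpha> 3\<bar> * r1 = \<bar>\<alpha> 1\<bar> * r3"
     "e 2 3 \<longleftrightarrow> k 2 \<bullet> k 3 \<noteq> 0 \<and> \<bar>\<alpha> 3\<bar> * r2 = \<bar>\<alpha> 2\<bar> * r3"
    unfolding e_def aQ using cross \<alpha>0 by simp_all
  have e_sym: "e 2 1 = e 1 2" "e 3 1 = e 1 3" "e 3 2 = e 2 3" unfolding e_def by (auto simp: inner_commute)
  have Q0: "Q \<bullet> k j \<noteq> 0" if "j \<in> I" for j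
  proof -
    have "\<bar>Q \<bullet> k j\<bar> > 0" using that aQ pos \<alpha>0 unfolding I_def by auto
    then show ?thesis by simp
  qed
  have Q20: "Q \<bullet> k2 j \<noteq> 0" if "j \<in> I" for j
    using Q0[OF that] c[OF that] by (simp add: k2[OF that])
  have coeff: "second_coeff I A k Q = second_coeff I A k2 Q"
  proof -
    have "second_coeff I A k2 Q = second_coeff I A (\<lambda>j. c j *\<^sub>R k j) Q"
      unfolding second_coeff_def by (intro sum.cong refl) (simp add: k2)
    then show ?thesis using second_coeff_rescale[of I c A k Q] c by force
  qed
  have "\<exists>i\<in>I. \<exists>j\<in>I. i \<noteq> j \<and> k2 i \<bullet> k2 j \<noteq> 0 \<and> \<bar>Q \<bullet> k2 i\<bar> = \<bar>Q \<bullet> k2 j\<bar>"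
  proof -
    have main: ?thesis if h: "i0 \<in> I" "j0 \<in> I" "i0 \<noteq> j0" "e i0 j0" "\<And>i j. i \<in> I \<Longrightarrow> j \<in> I \<Longrightarrow> i \<noteq> j \<Longrightarrow> e i j \<Longrightarrow> {i, j} = {i0, j0}" for i0 j0
    proof (rule resonance_transfer[OF _ same coeff A Q0 Q20 h(1-3)])
      show "finite I" by (simp add: I_def)
      show "k i0 \<bullet> k j0 \<noteq> 0" "\<bar>Q \<bullet> k i0\<bar> = \<bar>Q \<bullet> k j0\<bar>" using h(4) by (auto simp: e_def)
      show "\<not> parallel (k i0) (k j0)" using k h(1-3) unfolding frequencies_def by blast
      show "{i, j} = {i0, j0}" if "i \<in> I" "j \<in> I" "i \<noteq> j" "k i \<bullet> k j \<noteq> 0" "\<bar>Q \<bullet> k i\<bar> = \<bar>Q \<bullet> k j\<bar>" for i j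
        using h(5)[OF that(1-3)] that(4,5) by (simp add: e_def)
    qed
    consider "e 1 2" "\<not> e 1 3" "\<not> e 2 3" | "\<not> e 1 2" "e 1 3" "\<not> e 2 3" | "\<not> e 1 2" "\<not> e 1 3" "e 2 3"
      using single unfolding e by blast
    then show ?thesis
    proof cases
      case 1 then show ?thesis by (intro main[of 1 2]) (auto simp: I_def e_sym simp del: One_nat_def)
    next
      case 2 then show ?thesis by (intro main[of 1 3]) (auto simp: I_def e_sym simp del: One_nat_def)
    next
      case 3 then show ?thesis by (intro main[of 2 3]) (auto simp: I_def e_sym simp del: One_nat_def)
    qed
  qed
  then obtain i j where ij: "i \<in> I" "j \<in> I" "i \<noteq> j" "k2 i \<bullet> k2 j \<noteq> 0" "\<bar>Q \<bullet> k2 i\<bar> = \<bar>Q \<bullet> k2 j\<bar>" by blast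
  have kij: "k i \<bullet> k j \<noteq> 0" using ij(4) by (simp add: k2[OF ij(1)] k2[OF ij(2)])
  have sym: "k 2 \<bullet> k 1 = k 1 \<bullet> k 2" "k 3 \<bullet> k 1 = k 1 \<bullet> k 3" "k 3 \<bullet> k 2 = k 2 \<bullet> k 3" by (simp_all add: inner_commute)
  from ij(1-3) consider "i = 1" "j = 2" | "i = 2" "j = 1" | "i = 1" "j = 3" | "i = 3" "j = 1" | "i = 2" "j = 3" | "i = 3" "j = 2"
    unfolding I_def by auto
  then show "k 1 \<bullet> k 2 \<noteq> 0 \<and> \<bar>\<alpha> 2\<bar> / c 2 * r1 = \<bar>\<alpha> 1\<bar> / c 1 * r2 \<or> k 1 \<bullet> k 3 \<noteq> 0 \<and> \<bar>\<alpha> 3\<bar> / c 3 * r1 = \<bar>\<alpha> 1\<bar> / c 1 * r3 \<or>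
    k 2 \<bullet> k 3 \<noteq> 0 \<and> \<bar>\<alpha> 3\<bar> / c 3 * r2 = \<bar>\<alpha> 2\<bar> / c 2 * r3"
    using kij ij(5) cross2[OF \<alpha>0(1,2) c0(1,2), of r1 r2] cross2[OF \<alpha>0(1,3) c0(1,3), of r1 r3] cross2[OF \<alpha>0(2,3) c0(2,3), of r2 r3]
    by cases (simp_all only: aQ2 sym simp_thms eq_commute[of "c 2 * _" "c 1 * _"] eq_commute[of "c 3 * _" "c 1 * _"] eq_commute[of "c 3 * _" "c 2 * _"])
qed

text \<open>Two non-orthogonal pairs connect the three indices. Independent frequencies are handled pair by pair, coplanar
ones by the rigidity of proportions, applied to \<open>\<bar>\<alpha> j\<bar>\<close> and \<open>\<bar>\<alpha> j\<bar> / c j\<close>.\<close>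

lemma equal_ratios:
  fixes k :: "nat \<Rightarrow> 'a::euclidean_space"
  defines "I \<equiv> {1, 2, 3 :: nat}"
  assumes same: "same_value (cos_potential a I A k \<theta>1) (cos_potential a I A (\<lambda>i. c i *\<^sub>R k i) \<theta>2)"
    and same': "same_value (cos_potential a I A (\<lambda>i. c i *\<^sub>R k i) \<theta>2) (cos_potential a I A k \<theta>1)"
    and A: "\<And>j. j \<in> I \<Longrightarrow> A j \<noteq> 0" and c: "\<And>j. j \<in> I \<Longrightarrow> c j > 0" and k: "frequencies I k"
    and edges: "k 1 \<bullet> k 2 \<noteq> 0 \<and> k 1 \<bullet> k 3 \<noteq> 0 \<or> k 1 \<bullet> k 2 \<noteq> 0 \<and> k 2 \<bullet> k 3 \<noteq> 0 \<or> k 1 \<bullet> k 3 \<noteq> 0 \<and> k 2 \<bullet> k 3 \<noteq> 0"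
  shows "c 1 = c 3 \<and> c 2 = c 3"
proof -
  have in_I: "1 \<in> I" "2 \<in> I" "3 \<in> I" by (simp_all add: I_def)
  have c0: "c 1 > 0" "c 2 > 0" "c 3 > 0" using c in_I by blast+
  have np: "\<not> parallel (k i) (k j)" if "i \<in> I" "j \<in> I" "i \<noteq> j" for i j
    using k that unfolding frequencies_def by blast
  have np3: "\<not> parallel (k 1) (k 2)" "\<not> parallel (k 1) (k 3)" "\<not> parallel (k 2) (k 3)" using np in_I by auto
  have k0: "k 1 \<noteq> 0" "k 2 \<noteq> 0" "k 3 \<noteq> 0" using k in_I unfolding frequencies_def by blast+
  show ?thesis
  proof (cases "\<exists>\<alpha> \<beta>. k 3 = \<alpha> *\<^sub>R k 1 + \<beta> *\<^sub>R k 2")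
    case False
    then have i3: "k 3 \<noteq> \<alpha> *\<^sub>R k 1 + \<beta> *\<^sub>R k 2" for \<alpha> \<beta> by blast
    have i2: "k 2 \<noteq> \<alpha> *\<^sub>R k 1 + \<beta> *\<^sub>R k 3" for \<alpha> \<beta>
    proof
      assume e: "k 2 = \<alpha> *\<^sub>R k 1 + \<beta> *\<^sub>R k 3"
      have "\<beta> \<noteq> 0" using e np3(1) parallel_iff_scaleR[OF k0(1)] by auto
      then have "k 3 = (- \<alpha> / \<beta>) *\<^sub>R k 1 + (1 / \<beta>) *\<^sub>R k 2" unfolding e by (simp add: algebra_simps)
      then show False using i3 by blast
    qed
    have i1: "k 1 \<noteq> \<alpha> *\<^sub>R k 2 + \<beta> *\<^sub>R k 3" for \<alpha> \<beta>
    proof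
      assume e: "k 1 = \<alpha> *\<^sub>R k 2 + \<beta> *\<^sub>R k 3"
      have "\<not> parallel (k 2) (k 1)" using np3(1) parallel_sym by blast
      then have "\<beta> \<noteq> 0" using e parallel_iff_scaleR[OF k0(2)] by auto
      then have "k 3 = (1 / \<beta>) *\<^sub>R k 1 + (- \<alpha> / \<beta>) *\<^sub>R k 2" unfolding e by (simp add: algebra_simps)
      then show False using i3 by blast
    qed
    have 12: "c 1 = c 2" if "k 1 \<bullet> k 2 \<noteq> 0"
      by (rule equal_ratio_independent[of I 1 2 3, OF _ _ _ _ same A c that np3(1) i3]) (auto simp: I_def)
    have 13: "c 1 = c 3" if "k 1 \<bullet> k 3 \<noteq> 0"
      by (rule equal_ratio_independent[of I 1 3 2, OF _ _ _ _ same A c that np3(2) i2]) (auto simp: I_def)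
    have 23: "c 2 = c 3" if "k 2 \<bullet> k 3 \<noteq> 0"
      by (rule equal_ratio_independent[of I 2 3 1, OF _ _ _ _ same A c that np3(3) i1]) (auto simp: I_def)
    show ?thesis using edges 12 13 23 by auto
  next
    case True
    then obtain \<alpha>1 \<alpha>2 where e: "k 3 = \<alpha>1 *\<^sub>R k 1 + \<alpha>2 *\<^sub>R k 2" by blast
    define \<alpha> :: "nat \<Rightarrow> real" where "\<alpha> = (\<lambda>j. if j = 1 then \<alpha>1 else if j = 2 then \<alpha>2 else - 1)"
    have \<alpha>v: "\<alpha> 1 = \<alpha>1" "\<alpha> 2 = \<alpha>2" "\<alpha> 3 = - 1" by (simp_all add: \<alpha>_def)
    have "\<alpha>2 \<noteq> 0" using e np3(2) parallel_iff_scaleR[OF k0(1)] by auto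
    moreover have "\<alpha>1 \<noteq> 0" using e np3(3) parallel_iff_scaleR[OF k0(2)] by auto
    ultimately have \<alpha>0: "\<alpha> j \<noteq> 0" if "j \<in> I" for j by (simp add: \<alpha>_def)
    have rel: "\<alpha> 1 *\<^sub>R k 1 + \<alpha> 2 *\<^sub>R k 2 + \<alpha> 3 *\<^sub>R k 3 = 0" unfolding \<alpha>v e by simp
    have T1: "transfers (k 1 \<bullet> k 2 \<noteq> 0) (k 1 \<bullet> k 3 \<noteq> 0) (k 2 \<bullet> k 3 \<noteq> 0) \<bar>\<alpha> 1\<bar> \<bar>\<alpha> 2\<bar> \<bar>\<alpha> 3\<bar>
      (\<bar>\<alpha> 1\<bar> / c 1) (\<bar>\<alpha> 2\<bar> / c 2) (\<bar>\<alpha> 3\<bar> / c 3)"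
      by (rule transfers_of_same_value[OF same[unfolded I_def]]) (use A c k rel \<alpha>0 in \<open>auto simp: I_def\<close>)
    have k': "frequencies I (\<lambda>i. c i *\<^sub>R k i)"
      unfolding frequencies_def
    proof (intro conjI ballI impI)
      show "c i *\<^sub>R k i \<noteq> 0" if "i \<in> I" for i using k c[OF that] that by (auto simp: frequencies_def)
      fix i j assume ij: "i \<in> I" "j \<in> I" "i \<noteq> j"
      show "\<not> parallel (c i *\<^sub>R k i) (c j *\<^sub>R k j)"
      proof
        assume "parallel (c i *\<^sub>R k i) (c j *\<^sub>R k j)"
        then obtain s t where st: "s \<noteq> 0 \<or> t \<noteq> 0" "s *\<^sub>R c i *\<^sub>R k i + t *\<^sub>R c j *\<^sub>R k j = 0" unfolding parallel_def by blast
        have "(s * c i \<noteq> 0 \<or> t * c j \<noteq> 0) \<and> (s * c i) *\<^sub>R k i + (t * c j) *\<^sub>R k j = 0"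
          using st c[OF ij(1)] c[OF ij(2)] by simp
        then have "parallel (k i) (k j)" unfolding parallel_def by blast
        then show False using np[OF ij] by blast
      qed
    qed
    have T2: "transfers ((c 1 *\<^sub>R k 1) \<bullet> (c 2 *\<^sub>R k 2) \<noteq> 0) ((c 1 *\<^sub>R k 1) \<bullet> (c 3 *\<^sub>R k 3) \<noteq> 0) ((c 2 *\<^sub>R k 2) \<bullet> (c 3 *\<^sub>R k 3) \<noteq> 0)
      \<bar>\<alpha> 1 / c 1\<bar> \<bar>\<alpha> 2 / c 2\<bar> \<bar>\<alpha> 3 / c 3\<bar> (\<bar>\<alpha> 1 / c 1\<bar> / (1 / c 1)) (\<bar>\<alpha> 2 / c 2\<bar> / (1 / c 2)) (\<bar>\<alpha> 3 / c 3\<bar> / (1 / c 3))"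
    proof (rule transfers_of_same_value[OF same'[unfolded I_def], where c = "\<lambda>j. 1 / c j" and \<alpha> = "\<lambda>j. \<alpha> j / c j"])
      show "(\<alpha> 1 / c 1) *\<^sub>R c 1 *\<^sub>R k 1 + (\<alpha> 2 / c 2) *\<^sub>R c 2 *\<^sub>R k 2 + (\<alpha> 3 / c 3) *\<^sub>R c 3 *\<^sub>R k 3 = 0"
        using c0 rel by simp
    next
      show "frequencies {1, 2, 3} (\<lambda>i. c i *\<^sub>R k i)" using k' by (simp add: I_def)
    next
      fix j :: nat assume j: "j \<in> {1, 2, 3}"
      then have jI: "j \<in> I" by (simp add: I_def)
      have cj: "c j > 0" by (rule c[OF jI])
      show "A j \<noteq> 0" by (rule A[OF jI])
      show "1 / c j > 0" using cj by simp
      show "k j = (1 / c j) *\<^sub>R c j *\<^sub>R k j" using cj by simp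
      show "\<alpha> j / c j \<noteq> 0" using cj \<alpha>0[OF jI] by simp
    qed
    define x where "x = (\<lambda>j. \<bar>\<alpha> j\<bar>)"
    define y where "y = (\<lambda>j. \<bar>\<alpha> j\<bar> / c j)"
    have xy: "x 1 > 0" "x 2 > 0" "x 3 > 0" "y 1 > 0" "y 2 > 0" "y 3 > 0" using \<alpha>0 in_I c0 by (auto simp: x_def y_def)
    define e12 e13 e23 where "e12 = (k 1 \<bullet> k 2 \<noteq> 0)" and "e13 = (k 1 \<bullet> k 3 \<noteq> 0)" and "e23 = (k 2 \<bullet> k 3 \<noteq> 0)"
    have t1: "transfers e12 e13 e23 (x 1) (x 2) (x 3) (y 1) (y 2) (y 3)" using T1 by (simp add: x_def y_def e12_def e13_def e23_def)
    have t2: "transfers e12 e13 e23 (y 1) (y 2) (y 3) (x 1) (x 2) (x 3)"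
      using T2 c0 by (simp add: x_def y_def e12_def e13_def e23_def)
    have ratio: "y j / x j = 1 / c j" if "j \<in> I" for j using \<alpha>0[OF that] by (simp add: x_def y_def)
    have "y 1 / x 1 = y 3 / x 3 \<and> y 2 / x 2 = y 3 / x 3"
    proof -
      from edges consider "e12" "e13" "e23" | "\<not> e12" "e13" "e23" | "e12" "\<not> e13" "e23" | "e12" "e13" "\<not> e23"
        unfolding e12_def e13_def e23_def by blast
      then show ?thesis
      proof cases
        case 1
        then show ?thesis using ratio_rigidity_triangle[OF xy] t1 t2 by simp
      next
        case 2
        then show ?thesis using ratio_rigidity_path[OF xy] t1 t2 by simp
      next
        case 3
        have "transfers False True True (x 1) (x 3) (x 2) (y 1) (y 3) (y 2)" "transfers False True True (y 1) (y 3) (y 2) (x 1) (x 3) (x 2)"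
          using transfers_swap23[OF t1] transfers_swap23[OF t2] 3 by simp_all
        then show ?thesis using ratio_rigidity_path[OF xy(1,3,2,4,6,5)] by simp
      next
        case 4
        have "transfers False True True (x 2) (x 3) (x 1) (y 2) (y 3) (y 1)" "transfers False True True (y 2) (y 3) (y 1) (x 2) (x 3) (x 1)"
          using transfers_swap23[OF transfers_swap12[OF t1]] transfers_swap23[OF transfers_swap12[OF t2]] 4 by simp_all
        then show ?thesis using ratio_rigidity_path[OF xy(2,3,1,5,6,4)] by simp
      qed
    qed
    then show ?thesis using ratio in_I by simp
  qed
qed

section \<open>Phases\<close>

text \<open>For integer coefficients the constraint is \<open>2 * pi\<close>-periodic in each variable, so a compact cube suffices.\<close>

lemma constrained_cos_maximum:
  fixes A1 A2 A3 \<gamma> z1 z2 z3 :: real and n1 n2 n3 :: int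
  assumes ex: "cos (n1 * z1 + n2 * z2 + n3 * z3) = \<gamma>"
  shows "\<exists>(y1::real) (y2::real) (y3::real). \<bar>y1\<bar> \<le> pi \<and> \<bar>y2\<bar> \<le> pi \<and> \<bar>y3\<bar> \<le> pi \<and> cos (n1 * y1 + n2 * y2 + n3 * y3) = \<gamma> \<and>
    (\<forall>(w1::real) (w2::real) (w3::real). cos (n1 * w1 + n2 * w2 + n3 * w3) = \<gamma> \<longrightarrow>
      A1 * cos w1 + A2 * cos w2 + A3 * cos w3 \<le> A1 * cos y1 + A2 * cos y2 + A3 * cos y3)"
proof -
  define K where "K = ({-pi..pi} \<times> {-pi..pi} \<times> {-pi..pi}) \<inter> {y. cos (n1 * fst y + n2 * fst (snd y) + n3 * snd (snd y)) = \<gamma>}"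
  define F where "F = (\<lambda>y. A1 * cos (fst y) + A2 * cos (fst (snd y)) + A3 * cos (snd (snd y)))"
  have red: "\<exists>y\<in>K. F y = A1 * cos w1 + A2 * cos w2 + A3 * cos w3"
    if w: "cos (n1 * w1 + n2 * w2 + n3 * w3) = \<gamma>" for w1 w2 w3 :: real
  proof -
    define m where "m = (\<lambda>w :: real. \<lfloor>(w + pi) / (2 * pi)\<rfloor>)"
    define r where "r = (\<lambda>w. w - 2 * pi * of_int (m w))"
    have rb: "r w \<in> {-pi..pi}" for w
    proof -
      have "of_int (m w) \<le> (w + pi) / (2 * pi)" "(w + pi) / (2 * pi) < of_int (m w) + 1" unfolding m_def by linarith+
      then have "of_int (m w) * (2 * pi) \<le> w + pi" "w + pi < (of_int (m w) + 1) * (2 * pi)"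
        by (simp_all add: pos_le_divide_eq pos_divide_less_eq)
      then show ?thesis unfolding r_def by (simp add: algebra_simps)
    qed
    have per: "cos (x - 2 * pi * of_int l) = cos x" for x and l :: int
      using cos_int_2pin[of l] sin_int_2pin[of l] by (simp add: cos_diff)
    have rc: "cos (r w) = cos w" for w unfolding r_def by (rule per)
    have e: "n1 * r w1 + n2 * r w2 + n3 * r w3 = (n1 * w1 + n2 * w2 + n3 * w3) - 2 * pi * of_int (n1 * m w1 + n2 * m w2 + n3 * m w3)"
      unfolding r_def by (simp add: algebra_simps)
    have "cos (n1 * r w1 + n2 * r w2 + n3 * r w3) = \<gamma>" unfolding e per by (rule w)
    then have "(r w1, r w2, r w3) \<in> K" unfolding K_def using rb by simp
    moreover have "F (r w1, r w2, r w3) = A1 * cos w1 + A2 * cos w2 + A3 * cos w3" unfolding F_def by (simp add: rc)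
    ultimately show ?thesis by blast
  qed
  have "compact ({-pi..pi} \<times> {-pi..pi} \<times> {-pi..pi} :: (real \<times> real \<times> real) set)" by (intro compact_Times compact_Icc)
  moreover have "closed {y :: real \<times> real \<times> real. cos (n1 * fst y + n2 * fst (snd y) + n3 * snd (snd y)) = \<gamma>}"
    by (intro closed_Collect_eq continuous_intros)
  ultimately have "compact K" unfolding K_def by (rule compact_Int_closed)
  moreover have "K \<noteq> {}" using red[OF ex] by blast
  moreover have "continuous_on K F" unfolding F_def by (intro continuous_intros)
  ultimately obtain y where y: "y \<in> K" "\<forall>w\<in>K. F w \<le> F y" using continuous_attains_sup by blast
  show ?thesis
  proof (rule exI[of _ "fst y"], rule exI[of _ "fst (snd y)"], rule exI[of _ "snd (snd y)"], intro conjI allI impI)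
    show "\<bar>fst y\<bar> \<le> pi" "\<bar>fst (snd y)\<bar> \<le> pi" "\<bar>snd (snd y)\<bar> \<le> pi" "cos (n1 * fst y + n2 * fst (snd y) + n3 * snd (snd y)) = \<gamma>"
      using y(1) unfolding K_def by (auto simp: abs_le_iff)
    fix w1 w2 w3 :: real assume "cos (n1 * w1 + n2 * w2 + n3 * w3) = \<gamma>"
    then obtain w where w: "w \<in> K" "F w = A1 * cos w1 + A2 * cos w2 + A3 * cos w3" using red by blast
    have "F w \<le> F y" using y(2) w(1) by blast
    then show "A1 * cos w1 + A2 * cos w2 + A3 * cos w3 \<le> A1 * cos (fst y) + A2 * cos (fst (snd y)) + A3 * cos (snd (snd y))"
      unfolding w(2) unfolding F_def .
  qed
qed

lemma cos_shrink:
  fixes y t :: real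
  assumes "\<bar>y\<bar> \<le> pi" "0 \<le> t" "t < 1"
  shows "cos y \<le> cos (t * y)" "y \<noteq> 0 \<Longrightarrow> cos y < cos (t * y)"
proof -
  have "t * \<bar>y\<bar> = \<bar>t * y\<bar>" using assms(2) by (simp add: abs_mult)
  then have e: "cos (t * y) = cos (t * \<bar>y\<bar>)" "cos y = cos \<bar>y\<bar>" by (simp_all only: cos_abs_real)
  show 1: "cos y < cos (t * y)" if "y \<noteq> 0"
  proof -
    have "t * \<bar>y\<bar> < 1 * \<bar>y\<bar>" using assms(3) that by (intro mult_strict_right_mono) auto
    then show ?thesis unfolding e using assms by (intro cos_monotone_0_pi) auto
  qed
  show "cos y \<le> cos (t * y)" using 1 by (cases "y = 0") auto
qed

text \<open>Shrinking the point towards the origin increases every cosine, while the constraint takes all values up to \<open>cos 0 = 1\<close>.\<close>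

lemma constrained_cos_increase:
  fixes A1 A2 A3 m y1 y2 y3 \<gamma> n1 n2 n3 :: real
  assumes A: "A1 > 0" "A2 > 0" "A3 > 0" and y: "\<bar>y1\<bar> \<le> pi" "\<bar>y2\<bar> \<le> pi" "\<bar>y3\<bar> \<le> pi"
    and \<gamma>: "cos (n1 * y1 + n2 * y2 + n3 * y3) < \<gamma>" "\<gamma> \<le> 1"
  shows "\<exists>z1 z2 z3. cos (n1 * z1 + n2 * z2 + n3 * z3) = \<gamma> \<and>
    A1 * cos y1 + A2 * cos y2 + A3 * cos y3 < A1 * cos z1 + A2 * cos z2 + A3 * cos z3"
proof -
  define s where "s = n1 * y1 + n2 * y2 + n3 * y3"
  have "continuous_on {0..1} (\<lambda>t. cos (t * s))" by (intro continuous_intros)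
  then have "\<exists>t. 0 \<le> t \<and> t \<le> 1 \<and> cos (t * s) = \<gamma>"
    using IVT2'[of "\<lambda>t. cos (t * s)" 1 \<gamma> 0] \<gamma> unfolding s_def[symmetric] by auto
  then obtain t where t: "0 \<le> t" "t \<le> 1" "cos (t * s) = \<gamma>" by blast
  have t1: "t < 1" using t \<gamma>(1) unfolding s_def[symmetric] by (cases "t = 1") auto
  have nz: "y1 \<noteq> 0 \<or> y2 \<noteq> 0 \<or> y3 \<noteq> 0" using \<gamma> by auto
  have le: "A1 * cos y1 \<le> A1 * cos (t * y1)" "A2 * cos y2 \<le> A2 * cos (t * y2)" "A3 * cos y3 \<le> A3 * cos (t * y3)"
    using cos_shrink(1)[OF _ t(1) t1] y A by auto
  have lt: "y1 \<noteq> 0 \<Longrightarrow> A1 * cos y1 < A1 * cos (t * y1)" "y2 \<noteq> 0 \<Longrightarrow> A2 * cos y2 < A2 * cos (t * y2)" "y3 \<noteq> 0 \<Longrightarrow> A3 * cos y3 < A3 * cos (t * y3)"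
    using cos_shrink(2)[OF _ t(1) t1] y A by auto
  show ?thesis
  proof (rule exI[of _ "t * y1"], rule exI[of _ "t * y2"], rule exI[of _ "t * y3"], intro conjI)
    show "cos (n1 * (t * y1) + n2 * (t * y2) + n3 * (t * y3)) = \<gamma>" using t(3) by (simp add: s_def algebra_simps)
    show "A1 * cos y1 + A2 * cos y2 + A3 * cos y3 < A1 * cos (t * y1) + A2 * cos (t * y2) + A3 * cos (t * y3)"
      using nz le lt by linarith
  qed
qed

lemma cos_potential_three: "cos_potential a {1, 2, 3 :: nat} A k \<theta> x =
    a + (A 1 * cos (k 1 \<bullet> x + \<theta> 1) + A 2 * cos (k 2 \<bullet> x + \<theta> 2) + A 3 * cos (k 3 \<bullet> x + \<theta> 3))"
  by (simp add: cos_potential_def)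

text \<open>The relation between coplanar frequencies is the only restriction on the phases attained at a point.\<close>

lemma exists_point_with_phases:
  fixes k :: "nat \<Rightarrow> 'a::euclidean_space" and n1 n2 n3 :: real
  assumes np: "\<not> parallel (k 1) (k 2)" and rel: "n1 *\<^sub>R k 1 + n2 *\<^sub>R k 2 + n3 *\<^sub>R k 3 = 0" "n3 \<noteq> 0"
    and y: "n1 * y1 + n2 * y2 + n3 * y3 = n1 * \<theta> 1 + n2 * \<theta> 2 + n3 * \<theta> (3::nat)"
  shows "\<exists>x. k 1 \<bullet> x + \<theta> 1 = y1 \<and> k 2 \<bullet> x + \<theta> 2 = y2 \<and> k 3 \<bullet> x + \<theta> 3 = y3"
proof -
  obtain x where x: "x \<bullet> k 1 = y1 - \<theta> 1" "x \<bullet> k 2 = y2 - \<theta> 2"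
    using exists_inner_two[OF np, of "y1 - \<theta> 1" "y2 - \<theta> 2"] by blast
  have "x \<bullet> (n1 *\<^sub>R k 1 + n2 *\<^sub>R k 2 + n3 *\<^sub>R k 3) = 0" unfolding rel by simp
  then have "n1 * (y1 - \<theta> 1) + n2 * (y2 - \<theta> 2) + n3 * (x \<bullet> k 3) = 0"
    unfolding inner_add_right inner_scaleR_right x .
  then have "n3 * (x \<bullet> k 3) = n3 * (y3 - \<theta> 3)" using y by (simp add: algebra_simps)
  then have "x \<bullet> k 3 = y3 - \<theta> 3" using rel(2) by simp
  then have "k 1 \<bullet> x + \<theta> 1 = y1 \<and> k 2 \<bullet> x + \<theta> 2 = y2 \<and> k 3 \<bullet> x + \<theta> 3 = y3"
    using x inner_commute[of "k 1" x] inner_commute[of "k 2" x] inner_commute[of "k 3" x] by linarith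
  then show ?thesis by blast
qed

lemma cos_add_int_2pi: "cos (x + 2 * pi * of_int l) = cos x"
  using cos_int_2pin[of l] sin_int_2pin[of l] by (simp add: cos_add)

lemma cos_sign_mult:
  fixes \<sigma> x :: real
  assumes "\<sigma> = 1 \<or> \<sigma> = - 1"
  shows "cos (\<sigma> * x) = cos x"
  using assms by auto

text \<open>The values of the potential are \<open>A 1 * cos w1 + A 2 * cos w2 + A 3 * cos w3\<close> on the plane
\<open>n1 * w1 + n2 * w2 + n3 * w3 = \<Theta>\<close>. Changing the sign of all \<open>wj\<close> or adding multiples of \<open>2 * pi\<close> leaves these values alone,
so the plane may be replaced by the larger set \<open>cos (n1 * w1 + n2 * w2 + n3 * w3) = cos \<Theta>\<close>, on which the maximum
is attained and increases strictly with \<open>cos \<Theta>\<close>.\<close>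

lemma phase_cos_le:
  fixes k :: "nat \<Rightarrow> 'a::euclidean_space" and n1 n2 n3 z1 z2 z3 :: int and A :: "nat \<Rightarrow> real" and a :: real
  defines "V \<equiv> \<lambda>\<theta>. cos_potential a {1, 2, 3 :: nat} A k \<theta>"
    and "\<Theta> \<equiv> \<lambda>\<theta> :: nat \<Rightarrow> real. of_int n1 * \<theta> 1 + of_int n2 * \<theta> 2 + of_int n3 * \<theta> 3"
  assumes A: "A 1 > 0" "A 2 > 0" "A 3 > 0" and np: "\<not> parallel (k 1) (k 2)"
    and rel: "of_int n1 *\<^sub>R k 1 + of_int n2 *\<^sub>R k 2 + of_int n3 *\<^sub>R k 3 = 0" "n3 \<noteq> 0"
    and bez: "n1 * z1 + n2 * z2 + n3 * z3 = 1"
    and sup: "\<And>M. (\<forall>x. V \<theta>1 x \<le> M) \<Longrightarrow> (\<forall>x. V \<theta>2 x \<le> M)"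
  shows "cos (\<Theta> \<theta>2) \<le> cos (\<Theta> \<theta>1)"
proof (rule ccontr)
  assume "\<not> ?thesis"
  then have less: "cos (\<Theta> \<theta>1) < cos (\<Theta> \<theta>2)" by simp
  obtain y1 y2 y3 :: real where y: "\<bar>y1\<bar> \<le> pi" "\<bar>y2\<bar> \<le> pi" "\<bar>y3\<bar> \<le> pi" "cos (n1 * y1 + n2 * y2 + n3 * y3) = cos (\<Theta> \<theta>1)"
    and ymax: "\<And>(w1::real) (w2::real) (w3::real). cos (n1 * w1 + n2 * w2 + n3 * w3) = cos (\<Theta> \<theta>1) \<Longrightarrow>
      A 1 * cos w1 + A 2 * cos w2 + A 3 * cos w3 \<le> A 1 * cos y1 + A 2 * cos y2 + A 3 * cos y3"
  proof -
    have "cos (n1 * \<theta>1 1 + n2 * \<theta>1 2 + n3 * \<theta>1 3) = cos (\<Theta> \<theta>1)" unfolding \<Theta>_def ..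
    from constrained_cos_maximum[OF this, of "A 1" "A 2" "A 3"] show thesis by (elim exE conjE) (rule that, blast+)
  qed
  have "V \<theta>1 x \<le> a + (A 1 * cos y1 + A 2 * cos y2 + A 3 * cos y3)" for x
  proof -
    have "(of_int n1 *\<^sub>R k 1 + of_int n2 *\<^sub>R k 2 + of_int n3 *\<^sub>R k 3) \<bullet> x = 0" unfolding rel by simp
    then have "n1 * (k 1 \<bullet> x + \<theta>1 1) + n2 * (k 2 \<bullet> x + \<theta>1 2) + n3 * (k 3 \<bullet> x + \<theta>1 3) = \<Theta> \<theta>1"
      unfolding \<Theta>_def inner_add_left inner_scaleR_left by (simp add: distrib_left)
    from ymax[OF arg_cong[OF this]] show ?thesis unfolding V_def cos_potential_three by simp
  qed
  then have V2: "V \<theta>2 x \<le> a + (A 1 * cos y1 + A 2 * cos y2 + A 3 * cos y3)" for x using sup by blast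
  obtain w1 w2 w3 :: real where w: "cos (n1 * w1 + n2 * w2 + n3 * w3) = cos (\<Theta> \<theta>2)"
    "A 1 * cos y1 + A 2 * cos y2 + A 3 * cos y3 < A 1 * cos w1 + A 2 * cos w2 + A 3 * cos w3"
  proof -
    have "cos (n1 * y1 + n2 * y2 + n3 * y3) < cos (\<Theta> \<theta>2)" using less y(4) by simp
    from constrained_cos_increase[OF A y(1-3) this cos_le_one] show thesis by (elim exE conjE) (rule that)
  qed
  obtain l :: int where l: "n1 * w1 + n2 * w2 + n3 * w3 = \<Theta> \<theta>2 + 2 * pi * l \<or> n1 * w1 + n2 * w2 + n3 * w3 = - \<Theta> \<theta>2 + 2 * pi * l"
  proof -
    have "\<exists>n\<in>\<int>. n1 * w1 + n2 * w2 + n3 * w3 = \<Theta> \<theta>2 + 2 * n * pi \<or> n1 * w1 + n2 * w2 + n3 * w3 = - \<Theta> \<theta>2 + 2 * n * pi"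
      using w(1) unfolding cos_eq by blast
    then obtain n where n: "n \<in> \<int>" "n1 * w1 + n2 * w2 + n3 * w3 = \<Theta> \<theta>2 + 2 * n * pi \<or> n1 * w1 + n2 * w2 + n3 * w3 = - \<Theta> \<theta>2 + 2 * n * pi" by blast
    from n(1) obtain l where "n = of_int l" by (rule Ints_cases)
    then show thesis using n(2) by (intro that[of l]) (simp add: mult.commute mult.left_commute)
  qed
  \<comment> \<open>The Bezout coefficients distribute the multiple \<open>2 * pi * l\<close> over the three phases in integer portions.\<close>
  have bez': "of_int n1 * of_int z1 + of_int n2 * of_int z2 + of_int n3 * of_int z3 = (1::real)"
    using arg_cong[OF bez, of real_of_int] by simp
  define \<sigma> :: real where "\<sigma> = (if n1 * w1 + n2 * w2 + n3 * w3 = \<Theta> \<theta>2 + 2 * pi * l then 1 else - 1)"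
  have \<sigma>: "\<sigma> = 1 \<or> \<sigma> = - 1" "\<sigma> * (n1 * w1 + n2 * w2 + n3 * w3) = \<Theta> \<theta>2 + \<sigma> * (2 * pi * l)" using l by (auto simp: \<sigma>_def)
  have sum: "n1 * (\<sigma> * (w1 - 2 * pi * l * z1)) + n2 * (\<sigma> * (w2 - 2 * pi * l * z2)) + n3 * (\<sigma> * (w3 - 2 * pi * l * z3)) = \<Theta> \<theta>2"
  proof -
    have "n1 * (\<sigma> * (w1 - 2 * pi * l * z1)) + n2 * (\<sigma> * (w2 - 2 * pi * l * z2)) + n3 * (\<sigma> * (w3 - 2 * pi * l * z3))
      = \<sigma> * (n1 * w1 + n2 * w2 + n3 * w3) - \<sigma> * (2 * pi * l) * (of_int n1 * of_int z1 + of_int n2 * of_int z2 + of_int n3 * of_int z3)"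
      by (simp add: algebra_simps)
    then show ?thesis unfolding bez' \<sigma>(2) by simp
  qed
  obtain x where x: "k 1 \<bullet> x + \<theta>2 1 = \<sigma> * (w1 - 2 * pi * l * z1)" "k 2 \<bullet> x + \<theta>2 2 = \<sigma> * (w2 - 2 * pi * l * z2)"
    "k 3 \<bullet> x + \<theta>2 3 = \<sigma> * (w3 - 2 * pi * l * z3)"
  proof -
    have n3: "real_of_int n3 \<noteq> 0" using rel(2) by simp
    obtain x' where "k 1 \<bullet> x' + \<theta>2 1 = \<sigma> * (w1 - 2 * pi * l * z1) \<and> k 2 \<bullet> x' + \<theta>2 2 = \<sigma> * (w2 - 2 * pi * l * z2) \<and>
        k 3 \<bullet> x' + \<theta>2 3 = \<sigma> * (w3 - 2 * pi * l * z3)"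
      using exists_point_with_phases[OF np rel(1) n3 sum[unfolded \<Theta>_def]] by blast
    then show thesis using that by blast
  qed
  have cw: "cos (\<sigma> * (w - 2 * pi * l * z)) = cos w" for w :: real and z :: int
  proof -
    have "cos (\<sigma> * (w - 2 * pi * l * z)) = cos (w - 2 * pi * l * z)" by (rule cos_sign_mult[OF \<sigma>(1)])
    also have "\<dots> = cos (w + 2 * pi * of_int (- l * z))" by (simp add: mult.assoc)
    finally show ?thesis unfolding cos_add_int_2pi .
  qed
  have "V \<theta>2 x = a + (A 1 * cos w1 + A 2 * cos w2 + A 3 * cos w3)"
    unfolding V_def cos_potential_three x cw ..
  then show False using V2[of x] w(2) by simp
qed

text \<open>Equal maxima give \<open>\<Theta>1 = \<Theta>2\<close> or \<open>\<Theta>1 = - \<Theta>2\<close> modulo \<open>2 * pi\<close>. In the first case the phases differ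
by those of a translation, in the second by a translation after the reflection of space.\<close>

lemma phases_match:
  fixes k :: "nat \<Rightarrow> 'a::euclidean_space" and n1 n2 n3 z1 z2 z3 :: int and A :: "nat \<Rightarrow> real" and a :: real
  defines "V \<equiv> \<lambda>\<theta>. cos_potential a {1, 2, 3 :: nat} A k \<theta>"
  assumes A: "A 1 > 0" "A 2 > 0" "A 3 > 0" and np: "\<not> parallel (k 1) (k 2)"
    and rel: "of_int n1 *\<^sub>R k 1 + of_int n2 *\<^sub>R k 2 + of_int n3 *\<^sub>R k 3 = 0" "n3 \<noteq> 0"
    and bez: "n1 * z1 + n2 * z2 + n3 * z3 = 1"
    and sup: "\<And>M. (\<forall>x. V \<theta>1 x \<le> M) \<longleftrightarrow> (\<forall>x. V \<theta>2 x \<le> M)"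
  shows "\<exists>\<sigma> x0. (\<sigma> = 1 \<or> \<sigma> = - 1) \<and> (\<forall>x. V \<theta>1 x = V \<theta>2 (\<sigma> *\<^sub>R x + x0))"
proof -
  define \<Theta> where "\<Theta> = (\<lambda>\<theta> :: nat \<Rightarrow> real. of_int n1 * \<theta> 1 + of_int n2 * \<theta> 2 + of_int n3 * \<theta> 3)"
  have "cos (\<Theta> \<theta>2) \<le> cos (\<Theta> \<theta>1)" unfolding \<Theta>_def
    by (rule phase_cos_le[where a = a, OF A np rel bez]) (use sup in \<open>unfold V_def, blast\<close>)
  moreover have "cos (\<Theta> \<theta>1) \<le> cos (\<Theta> \<theta>2)" unfolding \<Theta>_def
    by (rule phase_cos_le[where a = a, OF A np rel bez]) (use sup in \<open>unfold V_def, blast\<close>)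
  ultimately have "cos (\<Theta> \<theta>1) = cos (\<Theta> \<theta>2)" by simp
  then have "\<exists>n\<in>\<int>. \<Theta> \<theta>1 = \<Theta> \<theta>2 + 2 * n * pi \<or> \<Theta> \<theta>1 = - \<Theta> \<theta>2 + 2 * n * pi" unfolding cos_eq by blast
  then obtain n where n: "n \<in> \<int>" "\<Theta> \<theta>1 = \<Theta> \<theta>2 + 2 * n * pi \<or> \<Theta> \<theta>1 = - \<Theta> \<theta>2 + 2 * n * pi" by blast
  from n(1) obtain l where nl: "n = of_int l" by (rule Ints_cases)
  define \<sigma> :: real where "\<sigma> = (if \<Theta> \<theta>1 = \<Theta> \<theta>2 + 2 * n * pi then 1 else - 1)"
  have \<sigma>: "\<sigma> = 1 \<or> \<sigma> = - 1" "\<sigma> * \<Theta> \<theta>1 = \<Theta> \<theta>2 + \<sigma> * (2 * n * pi)" using n(2) by (auto simp: \<sigma>_def)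
  have bez': "of_int n1 * of_int z1 + of_int n2 * of_int z2 + of_int n3 * of_int z3 = (1::real)"
    using arg_cong[OF bez, of real_of_int] by simp
  have sum: "n1 * (\<sigma> * (\<theta>1 1 - 2 * pi * l * z1)) + n2 * (\<sigma> * (\<theta>1 2 - 2 * pi * l * z2)) + n3 * (\<sigma> * (\<theta>1 3 - 2 * pi * l * z3)) = \<Theta> \<theta>2"
  proof -
    have "n1 * (\<sigma> * (\<theta>1 1 - 2 * pi * l * z1)) + n2 * (\<sigma> * (\<theta>1 2 - 2 * pi * l * z2)) + n3 * (\<sigma> * (\<theta>1 3 - 2 * pi * l * z3))
      = \<sigma> * \<Theta> \<theta>1 - \<sigma> * (2 * l * pi) * (of_int n1 * of_int z1 + of_int n2 * of_int z2 + of_int n3 * of_int z3)"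
      unfolding \<Theta>_def by (simp add: algebra_simps)
    then show ?thesis unfolding bez' \<sigma>(2) nl by simp
  qed
  obtain x0 where x0: "k 1 \<bullet> x0 + \<theta>2 1 = \<sigma> * (\<theta>1 1 - 2 * pi * l * z1)" "k 2 \<bullet> x0 + \<theta>2 2 = \<sigma> * (\<theta>1 2 - 2 * pi * l * z2)"
    "k 3 \<bullet> x0 + \<theta>2 3 = \<sigma> * (\<theta>1 3 - 2 * pi * l * z3)"
  proof -
    have n3: "real_of_int n3 \<noteq> 0" using rel(2) by simp
    obtain x' where "k 1 \<bullet> x' + \<theta>2 1 = \<sigma> * (\<theta>1 1 - 2 * pi * l * z1) \<and> k 2 \<bullet> x' + \<theta>2 2 = \<sigma> * (\<theta>1 2 - 2 * pi * l * z2) \<and>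
        k 3 \<bullet> x' + \<theta>2 3 = \<sigma> * (\<theta>1 3 - 2 * pi * l * z3)"
      using exists_point_with_phases[OF np rel(1) n3 sum[unfolded \<Theta>_def]] by blast
    then show thesis using that by blast
  qed
  have cw: "cos (\<sigma> * s + \<sigma> * (w - 2 * pi * l * z)) = cos (s + w)" for s w :: real and z :: int
  proof -
    have "\<sigma> * s + \<sigma> * (w - 2 * pi * l * z) = \<sigma> * (s + w - 2 * pi * l * z)" by (simp add: algebra_simps)
    then have "cos (\<sigma> * s + \<sigma> * (w - 2 * pi * l * z)) = cos (s + w - 2 * pi * l * z)"
      using cos_sign_mult[OF \<sigma>(1), of "s + w - 2 * pi * l * z"] by (simp only:)
    also have "\<dots> = cos ((s + w) + 2 * pi * of_int (- l * z))" by (simp add: mult.assoc)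
    finally show ?thesis unfolding cos_add_int_2pi .
  qed
  have "V \<theta>1 x = V \<theta>2 (\<sigma> *\<^sub>R x + x0)" for x
    unfolding V_def cos_potential_three inner_add_right inner_scaleR_right add.assoc[of "\<sigma> * _"] x0 cw ..
  then show ?thesis using \<sigma>(1) by blast
qed

lemma phases_match_independent:
  fixes k :: "nat \<Rightarrow> 'a::euclidean_space"
  assumes np: "\<not> parallel (k 1) (k 2)" and ind: "\<And>\<alpha> \<beta>. k 3 \<noteq> \<alpha> *\<^sub>R k 1 + \<beta> *\<^sub>R k 2"
  shows "\<exists>x0. \<forall>x. cos_potential a {1, 2, 3 :: nat} A k \<theta>1 x = cos_potential a {1, 2, 3} A k \<theta>2 (x + x0)"
proof -
  obtain x0 where x0: "x0 \<bullet> k 1 = \<theta>1 1 - \<theta>2 1" "x0 \<bullet> k 2 = \<theta>1 2 - \<theta>2 2" "x0 \<bullet> k 3 = \<theta>1 3 - \<theta>2 3"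
    using exists_inner_three[OF np ind, of "\<theta>1 1 - \<theta>2 1" "\<theta>1 2 - \<theta>2 2" "\<theta>1 3 - \<theta>2 3"] by blast
  have "cos_potential a {1, 2, 3 :: nat} A k \<theta>1 x = cos_potential a {1, 2, 3} A k \<theta>2 (x + x0)" for x
  proof -
    have "k 1 \<bullet> x0 = \<theta>1 1 - \<theta>2 1" "k 2 \<bullet> x0 = \<theta>1 2 - \<theta>2 2" "k 3 \<bullet> x0 = \<theta>1 3 - \<theta>2 3"
      using x0 inner_commute[of "k 1" x0] inner_commute[of "k 2" x0] inner_commute[of "k 3" x0] by linarith+
    then show ?thesis unfolding cos_potential_three inner_add_right by simp
  qed
  then show ?thesis by blast
qed

section \<open>Lattice-periodic potentials\<close>

lemma lattice_approx: "\<exists>a\<in>integer_lattice. norm (x - a) \<le> real CARD('n)" for x :: "real ^ 'n"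
proof -
  define a :: "real ^ 'n" where "a = (\<chi> i. of_int \<lfloor>x $ i\<rfloor>)"
  have a: "a \<in> integer_lattice" by (simp add: integer_lattice_def a_def)
  have n1: "norm (x - a) \<le> (\<Sum>i\<in>UNIV. \<bar>(x - a) $ i\<bar>)" by (rule norm_le_l1_cart)
  have n2: "(\<Sum>i\<in>UNIV. \<bar>(x - a) $ i\<bar>) \<le> (\<Sum>i\<in>(UNIV :: 'n set). 1)"
  proof (rule sum_mono)
    fix i show "\<bar>(x - a) $ i\<bar> \<le> 1"
    proof -
      have "(x - a) $ i = x $ i - of_int \<lfloor>x $ i\<rfloor>" by (simp add: a_def)
      then show ?thesis using of_int_floor_le[of "x $ i"] real_of_int_floor_add_one_gt[of "x $ i"] by linarith
    qed
  qed
  have "norm (x - a) \<le> real CARD('n)" using order_trans[OF n1 n2] by simp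
  then show ?thesis using a by blast
qed

lemma lattice_uminus: "a \<in> integer_lattice \<Longrightarrow> - a \<in> integer_lattice"
  by (simp add: integer_lattice_def)

lemma lattice_periodic_cocompact:
  fixes V :: "real ^ 'n \<Rightarrow> real"
  assumes "lattice_periodic V"
  shows "\<exists>a. (\<forall>y. V (y + a) = V y) \<and> norm (x - a) \<le> real CARD('n)"
  using lattice_approx[of x] assms unfolding lattice_periodic_def by blast

lemma lattice_periodic_bounded:
  fixes v :: "real ^ 'n \<Rightarrow> real"
  assumes p: "lattice_periodic v" and c: "continuous_on UNIV v"
  shows "bounded (range v)"
proof -
  have "range v \<subseteq> v ` cball 0 (real CARD('n))"
  proof
    fix y assume "y \<in> range v"
    then obtain x where x: "y = v x" by blast
    obtain a where a: "a \<in> integer_lattice" "norm (x - a) \<le> real CARD('n)" using lattice_approx by blast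
    have "v (x - a) = v (x - a + a)" using p a(1) unfolding lattice_periodic_def by metis
    then have "y = v (x - a)" using x by simp
    then show "y \<in> v ` cball 0 (real CARD('n))" using a(2) by auto
  qed
  moreover have "bounded (v ` cball 0 (real CARD('n)))"
    by (intro compact_imp_bounded compact_continuous_image continuous_on_subset[OF c]) auto
  ultimately show ?thesis using bounded_subset by blast
qed

text \<open>The constructed solution has the periods of the potential, and a periodic continuous solution is bounded, so the
constants of periodic and of bounded solutions coincide.\<close>

lemma cell_value_effective_hamiltonian:
  fixes V :: "real ^ 'n \<Rightarrow> real"
  assumes V: "buc V" and per: "lattice_periodic V"
  shows "cell_value V p (effective_hamiltonian V p)"
proof -
  obtain \<mu> v where v: "bounded (range v)" "viscosity_solution (cell V p \<mu>) v"
    "\<forall>a. (\<forall>y. V (y + a) = V y) \<longrightarrow> (\<forall>x. v (x + a) = v x)"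
    using cell_solution_exists[OF V lattice_periodic_cocompact[OF per], where p = p] by metis
  have vp: "lattice_periodic v" using per v(3) unfolding lattice_periodic_def by blast
  have cv: "cell_value V p \<mu>" using v(1,2) unfolding cell_value_def by blast
  have "effective_hamiltonian V p = \<mu>"
    unfolding effective_hamiltonian_def
  proof (rule the_equality)
    show "\<exists>v. lattice_periodic v \<and> viscosity_solution (cell V p \<mu>) v" using vp v(2) by blast
    fix \<nu> assume "\<exists>v. lattice_periodic v \<and> viscosity_solution (cell V p \<nu>) v"
    then obtain w where w: "lattice_periodic w" "viscosity_solution (cell V p \<nu>) w" by blast
    have "bounded (range w)" using w lattice_periodic_bounded unfolding viscosity_solution_def by blast
    then have "cell_value V p \<nu>" using w(2) unfolding cell_value_def by blast
    then show "\<nu> = \<mu>" using cell_value_unique[OF V _ cv] by blast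
  qed
  then show ?thesis using cv by simp
qed

lemma effective_hamiltonian_eq_iff:
  fixes V W :: "real ^ 'n \<Rightarrow> real"
  assumes "buc V" "lattice_periodic V" "buc W" "lattice_periodic W"
  shows "effective_hamiltonian V = effective_hamiltonian W \<longleftrightarrow> same_value V W"
proof
  assume e: "effective_hamiltonian V = effective_hamiltonian W"
  show "same_value V W"
    unfolding same_value_def
  proof
    fix p
    have "cell_value V p (effective_hamiltonian V p) \<and> cell_value W p (effective_hamiltonian V p)"
      using cell_value_effective_hamiltonian[OF assms(1,2), of p] cell_value_effective_hamiltonian[OF assms(3,4), of p] e by simp
    then show "\<exists>\<mu>. cell_value V p \<mu> \<and> cell_value W p \<mu>" by blast
  qed
next
  assume s: "same_value V W"
  show "effective_hamiltonian V = effective_hamiltonian W"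
  proof
    fix p
    obtain \<mu> where \<mu>: "cell_value V p \<mu>" "cell_value W p \<mu>" using s unfolding same_value_def by blast
    show "effective_hamiltonian V p = effective_hamiltonian W p"
      using cell_value_unique[OF assms(1) cell_value_effective_hamiltonian[OF assms(1,2)] \<mu>(1)]
        cell_value_unique[OF assms(3) cell_value_effective_hamiltonian[OF assms(3,4)] \<mu>(2)] by simp
  qed
qed

lemma same_value_sym: "same_value V W \<Longrightarrow> same_value W V"
  unfolding same_value_def by blast

definition lattice_waves :: "'i set \<Rightarrow> ('i \<Rightarrow> real ^ 'n) \<Rightarrow> bool" where
  "lattice_waves I k \<longleftrightarrow> (\<forall>j\<in>I. \<exists>m\<in>integer_lattice. k j = (2 * pi) *\<^sub>R m)"

lemma inner_integer_lattice:
  assumes "a \<in> integer_lattice" "b \<in> integer_lattice"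
  shows "a \<bullet> b \<in> \<int>"
  using assms unfolding inner_vec_def integer_lattice_def by (auto intro!: Ints_sum Ints_mult)

lemma lattice_periodic_cos_potential:
  fixes k :: "'i \<Rightarrow> real ^ 'n"
  assumes "lattice_waves I k"
  shows "lattice_periodic (cos_potential a I A k \<theta>)"
  unfolding lattice_periodic_def
proof (intro allI ballI)
  fix x b :: "real ^ 'n" assume b: "b \<in> integer_lattice"
  have "cos (k j \<bullet> (x + b) + \<theta> j) = cos (k j \<bullet> x + \<theta> j)" if j: "j \<in> I" for j
  proof -
    obtain m where m: "m \<in> integer_lattice" "k j = (2 * pi) *\<^sub>R m" using assms j unfolding lattice_waves_def by blast
    have "m \<bullet> b \<in> \<int>" using m(1) b by (rule inner_integer_lattice)
    then obtain l where l: "m \<bullet> b = of_int l" by (rule Ints_cases)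
    have "k j \<bullet> (x + b) + \<theta> j = (k j \<bullet> x + \<theta> j) + 2 * pi * of_int l"
      unfolding inner_add_right by (simp add: m(2) l)
    then show ?thesis by (simp only: cos_add_int_2pi)
  qed
  then show "cos_potential a I A k \<theta> (x + b) = cos_potential a I A k \<theta> x"
    unfolding cos_potential_def by (intro arg_cong2[where f = "(+)"] refl sum.cong) simp
qed

lemma cell_value_cos_potential_exists:
  fixes k :: "'i \<Rightarrow> real ^ 'n"
  assumes "lattice_waves I k"
  shows "\<exists>\<mu>. cell_value (cos_potential a I A k \<theta>) p \<mu>"
  using cell_value_effective_hamiltonian[OF buc_cos_potential lattice_periodic_cos_potential[OF assms]] by blast

text \<open>\<open>P\<close> is the orthogonal projection onto the line of \<open>k i\<close>: the wave \<open>i\<close> lives on this line, the others on its complement.\<close>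

lemma cos_potential_insert_value:
  fixes k :: "'i \<Rightarrow> real ^ 'n"
  assumes J: "finite J" "i \<notin> J" and ki: "k i \<noteq> 0" and orth: "\<And>j. j \<in> J \<Longrightarrow> k i \<bullet> k j = 0"
    and lw: "lattice_waves (insert i J) k"
  defines "P \<equiv> \<lambda>x. ((k i \<bullet> x) / (k i \<bullet> k i)) *\<^sub>R k i"
  assumes cv: "cell_value (cos_potential 0 {i} A k \<theta>) (P p) \<mu>1" "cell_value (cos_potential a J A k \<theta>) (p - P p) \<mu>2"
    "cell_value (cos_potential a (insert i J) A k \<theta>) p \<mu>"
  shows "\<mu> = \<mu>1 + \<mu>2"
proof (rule cell_value_orthogonal_sum)
  have lw': "lattice_waves {i} k" "lattice_waves J k" using lw by (auto simp: lattice_waves_def)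
  have sum: "cos_potential a (insert i J) A k \<theta> = (\<lambda>x. cos_potential 0 {i} A k \<theta> x + cos_potential a J A k \<theta> x)"
    using J by (simp add: fun_eq_iff cos_potential_def)
  show "linear P" unfolding P_def by (rule linearI) (simp_all add: inner_add_right add_divide_distrib scaleR_add_left)
  show "P x \<bullet> y = x \<bullet> P y" for x y unfolding P_def by (simp add: inner_commute)
  show "P (P x) = P x" for x unfolding P_def using ki by simp
  show "buc (cos_potential 0 {i} A k \<theta>)" "buc (cos_potential a J A k \<theta>)"
    "buc (\<lambda>x. cos_potential 0 {i} A k \<theta> x + cos_potential a J A k \<theta> x)"
    using buc_cos_potential[of a "insert i J" A k \<theta>] unfolding sum by (simp_all add: buc_cos_potential)
  show "cos_potential 0 {i} A k \<theta> (x + (z - P z)) = cos_potential 0 {i} A k \<theta> x" for x z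
  proof -
    have "k i \<bullet> (z - P z) = 0" unfolding P_def using ki by (simp add: inner_diff_right)
    then show ?thesis unfolding cos_potential_def by (simp add: inner_add_right)
  qed
  show "cos_potential a J A k \<theta> (x + P z) = cos_potential a J A k \<theta> x" for x z
  proof -
    have "k j \<bullet> P z = 0" if "j \<in> J" for j using orth[OF that] unfolding P_def by (simp add: inner_commute)
    then show ?thesis unfolding cos_potential_def by (simp add: inner_add_right)
  qed
  show "\<exists>b. (\<forall>y. cos_potential 0 {i} A k \<theta> (y + b) = cos_potential 0 {i} A k \<theta> y) \<and> norm (x - b) \<le> real CARD('n)" for x
    by (rule lattice_periodic_cocompact[OF lattice_periodic_cos_potential[OF lw'(1)]])
  show "\<exists>b. (\<forall>y. cos_potential a J A k \<theta> (y + b) = cos_potential a J A k \<theta> y) \<and> norm (x - b) \<le> real CARD('n)" for x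
    by (rule lattice_periodic_cocompact[OF lattice_periodic_cos_potential[OF lw'(2)]])
  show "cell_value (cos_potential 0 {i} A k \<theta>) (P p) \<mu>1" "cell_value (cos_potential a J A k \<theta>) (p - P p) \<mu>2" by (fact cv)+
  show "cell_value (\<lambda>x. cos_potential 0 {i} A k \<theta> x + cos_potential a J A k \<theta> x) p \<mu>" using cv(3) unfolding sum .
qed

lemma same_value_insert:
  fixes k k' :: "'i \<Rightarrow> real ^ 'n"
  assumes J: "finite J" "i \<notin> J" and ki: "k i \<noteq> 0" "c \<noteq> 0" "k' i = c *\<^sub>R k i"
    and orth: "\<And>j. j \<in> J \<Longrightarrow> k i \<bullet> k j = 0" "\<And>j. j \<in> J \<Longrightarrow> k' i \<bullet> k' j = 0"
    and lw: "lattice_waves (insert i J) k" "lattice_waves (insert i J) k'"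
    and same: "same_value (cos_potential 0 {i} A k \<theta>) (cos_potential 0 {i} A k' \<theta>')"
      "same_value (cos_potential a J A k \<theta>) (cos_potential a J A k' \<theta>')"
  shows "same_value (cos_potential a (insert i J) A k \<theta>) (cos_potential a (insert i J) A k' \<theta>')"
  unfolding same_value_def
proof
  fix p
  define q where "q = ((k i \<bullet> p) / (k i \<bullet> k i)) *\<^sub>R k i"
  have q': "((k' i \<bullet> p) / (k' i \<bullet> k' i)) *\<^sub>R k' i = q" unfolding q_def ki(3) using ki(2) by simp
  obtain \<mu>1 where \<mu>1: "cell_value (cos_potential 0 {i} A k \<theta>) q \<mu>1" "cell_value (cos_potential 0 {i} A k' \<theta>') q \<mu>1"
    using same(1) unfolding same_value_def by blast
  obtain \<mu>2 where \<mu>2: "cell_value (cos_potential a J A k \<theta>) (p - q) \<mu>2" "cell_value (cos_potential a J A k' \<theta>') (p - q) \<mu>2"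
    using same(2) unfolding same_value_def by blast
  obtain \<mu> where \<mu>: "cell_value (cos_potential a (insert i J) A k \<theta>) p \<mu>" using cell_value_cos_potential_exists[OF lw(1)] by blast
  obtain \<mu>' where \<mu>': "cell_value (cos_potential a (insert i J) A k' \<theta>') p \<mu>'" using cell_value_cos_potential_exists[OF lw(2)] by blast
  have k'0: "k' i \<noteq> 0" using ki by simp
  have "\<mu> = \<mu>1 + \<mu>2"
    by (rule cos_potential_insert_value[where k = k, OF J ki(1) orth(1) lw(1) _ _ \<mu>]) (use \<mu>1(1) \<mu>2(1) in \<open>simp_all add: q_def\<close>)
  moreover have "\<mu>' = \<mu>1 + \<mu>2"
    by (rule cos_potential_insert_value[where k = k', OF J k'0 orth(2) lw(2) _ _ \<mu>']) (use \<mu>1(2) \<mu>2(2) in \<open>simp_all only: q'\<close>)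
  ultimately show "\<exists>\<mu>. cell_value (cos_potential a (insert i J) A k \<theta>) p \<mu> \<and> cell_value (cos_potential a (insert i J) A k' \<theta>') p \<mu>"
    using \<mu> \<mu>' by blast
qed

lemma same_value_of_dilation:
  fixes V W :: "real ^ 'n \<Rightarrow> real"
  assumes V: "buc V" "lattice_periodic V" and W: "buc W" "lattice_periodic W"
    and c: "c \<noteq> 0" and eq: "\<And>x. V x = W ((1 / c) *\<^sub>R x + x0)"
  shows "same_value V W"
  unfolding same_value_def
proof
  fix p
  have v: "cell_value V p (effective_hamiltonian V p)" "cell_value W p (effective_hamiltonian W p)"
    using cell_value_effective_hamiltonian V W by blast+
  have "effective_hamiltonian V p = effective_hamiltonian W p"
    by (rule cell_value_dilation[OF V(1) c eq v])
  then show "\<exists>\<mu>. cell_value V p \<mu> \<and> cell_value W p \<mu>" using v by auto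
qed

lemma same_value_cos_dilation:
  fixes k k' :: "'i \<Rightarrow> real ^ 'n"
  assumes lw: "lattice_waves J k" "lattice_waves J k'" and c: "c \<noteq> 0" "\<And>j. j \<in> J \<Longrightarrow> k' j = c *\<^sub>R k j"
    and y: "\<And>j. j \<in> J \<Longrightarrow> y \<bullet> k j = \<theta> j - \<theta>' j"
  shows "same_value (cos_potential a J A k \<theta>) (cos_potential a J A k' \<theta>')"
proof (rule same_value_of_dilation[OF buc_cos_potential lattice_periodic_cos_potential[OF lw(1)]
      buc_cos_potential lattice_periodic_cos_potential[OF lw(2)] c(1)])
  fix x
  have "k' j \<bullet> ((1 / c) *\<^sub>R x + (1 / c) *\<^sub>R y) + \<theta>' j = k j \<bullet> x + \<theta> j" if "j \<in> J" for j
    using y[OF that] c(1) by (simp add: c(2)[OF that] inner_add_right inner_commute[of "k j" y])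
  then show "cos_potential a J A k \<theta> x = cos_potential a J A k' \<theta>' ((1 / c) *\<^sub>R x + (1 / c) *\<^sub>R y)"
    unfolding cos_potential_def by simp
qed

text \<open>Cramer's rule with the Gram determinant of \<open>k1\<close> and \<open>k2\<close> gives integer coefficients, which are then
made coprime.\<close>

lemma integer_relation:
  fixes k1 k2 k3 :: "real ^ 'n"
  assumes lat: "k1 \<in> integer_lattice" "k2 \<in> integer_lattice" "k3 \<in> integer_lattice" and np: "\<not> parallel k1 k2"
    and k3: "k3 = \<alpha> *\<^sub>R k1 + \<beta> *\<^sub>R k2"
  shows "\<exists>n1 n2 n3 z1 z2 z3 :: int. of_int n1 *\<^sub>R k1 + of_int n2 *\<^sub>R k2 + of_int n3 *\<^sub>R k3 = 0 \<and> n3 \<noteq> 0 \<and>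
    n1 * z1 + n2 * z2 + n3 * z3 = 1"
proof -
  define d where "d = (k1 \<bullet> k1) * (k2 \<bullet> k2) - (k1 \<bullet> k2) * (k1 \<bullet> k2)"
  have k10: "k1 \<noteq> 0" using np parallel_zero by auto
  have d0: "d \<noteq> 0"
  proof
    assume d: "d = 0"
    define w where "w = (k1 \<bullet> k1) *\<^sub>R k2 - (k1 \<bullet> k2) *\<^sub>R k1"
    have "w \<bullet> w = (k1 \<bullet> k1) * d"
      unfolding w_def d_def by (simp add: inner_diff_left inner_diff_right inner_commute[of k2 k1] algebra_simps)
    then have "w = 0" using d by simp
    then have "(- (k1 \<bullet> k2)) *\<^sub>R k1 + (k1 \<bullet> k1) *\<^sub>R k2 = 0" by (simp add: w_def)
    moreover have "k1 \<bullet> k1 \<noteq> 0" using k10 by simp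
    ultimately show False using np unfolding parallel_def by blast
  qed
  have e1: "k3 \<bullet> k1 = \<alpha> * (k1 \<bullet> k1) + \<beta> * (k1 \<bullet> k2)" and e2: "k3 \<bullet> k2 = \<alpha> * (k1 \<bullet> k2) + \<beta> * (k2 \<bullet> k2)"
    unfolding k3 by (simp_all add: inner_add_left inner_commute[of k2 k1])
  have "\<alpha> * d = (k3 \<bullet> k1) * (k2 \<bullet> k2) - (k3 \<bullet> k2) * (k1 \<bullet> k2)" unfolding e1 e2 d_def by (simp add: algebra_simps)
  moreover have "\<beta> * d = (k3 \<bullet> k2) * (k1 \<bullet> k1) - (k3 \<bullet> k1) * (k1 \<bullet> k2)" unfolding e1 e2 d_def by (simp add: algebra_simps)
  ultimately have "\<alpha> * d \<in> \<int>" "\<beta> * d \<in> \<int>" "d \<in> \<int>"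
    unfolding d_def using lat by (simp_all only: Ints_diff Ints_mult inner_integer_lattice)
  then obtain N1 N2 N3 :: int where N: "\<alpha> * d = of_int N1" "\<beta> * d = of_int N2" "d = of_int N3" by (metis Ints_cases)
  have N3: "N3 \<noteq> 0" using d0 N(3) by auto
  define g where "g = gcd N1 (gcd N2 N3)"
  have g: "g \<noteq> 0" "g dvd N1" "g dvd N2" "g dvd N3" using N3 unfolding g_def by (auto intro: dvd_trans)
  obtain n1 n2 n3 where n: "N1 = g * n1" "N2 = g * n2" "N3 = g * n3" using g(2-4) unfolding dvd_def by blast
  obtain u v where uv: "u * N2 + v * N3 = gcd N2 N3" using bezout_int by blast
  obtain s t where st: "s * N1 + t * gcd N2 N3 = g" unfolding g_def using bezout_int by blast
  have "g * (n1 * s + n2 * (t * u) + n3 * (- t * (- v))) = s * N1 + t * (u * N2 + v * N3)"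
    unfolding n by (simp add: algebra_simps)
  then have "g * (n1 * s + n2 * (t * u) + n3 * (- t * (- v))) = g * 1" unfolding uv st by simp
  then have bez: "n1 * s + n2 * (t * u) + (- n3) * (- (t * v)) = 1" using g(1) by simp
  have "of_int N1 *\<^sub>R k1 + of_int N2 *\<^sub>R k2 + of_int (- N3) *\<^sub>R k3 = 0"
    unfolding k3 by (simp flip: N add: scaleR_add_right mult.commute)
  then have "of_int g *\<^sub>R (of_int n1 *\<^sub>R k1 + of_int n2 *\<^sub>R k2 + of_int (- n3) *\<^sub>R k3) = 0"
    by (simp only: n of_int_mult of_int_minus scaleR_add_right scaleR_scaleR mult_minus_right)
  then have rel: "of_int n1 *\<^sub>R k1 + of_int n2 *\<^sub>R k2 + of_int (- n3) *\<^sub>R k3 = 0" using g(1) by (simp only: scaleR_eq_0_iff of_int_eq_0_iff simp_thms)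
  have "- n3 \<noteq> 0" using N3 n(3) by auto
  then show ?thesis using rel bez by blast
qed

lemma trig_potential_eq_cos_potential:
  "trig_potential a lam k = cos_potential a {1, 2, 3} (\<lambda>j. 2 * cmod (lam j)) (\<lambda>j. (2 * pi) *\<^sub>R k j) (\<lambda>j. Arg (lam j))"
proof
  fix x
  have "Re (lam j * exp (\<i> * of_real (2 * pi * (k j \<bullet> x))) + cnj (lam j) * exp (- \<i> * of_real (2 * pi * (k j \<bullet> x))))
     = 2 * cmod (lam j) * cos ((2 * pi) *\<^sub>R k j \<bullet> x + Arg (lam j))" for j
  proof -
    have l: "Re (lam j) = cmod (lam j) * cos (Arg (lam j))" "Im (lam j) = cmod (lam j) * sin (Arg (lam j))"
      using rcis_cmod_Arg[of "lam j"] by (metis Re_rcis, metis Im_rcis)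
    show ?thesis
      by (simp add: Re_exp Im_exp cos_add l algebra_simps)
  qed
  moreover have "{1..3} = {1, 2, 3 :: nat}" by auto
  ultimately show "trig_potential a lam k x = cos_potential a {1, 2, 3} (\<lambda>j. 2 * cmod (lam j)) (\<lambda>j. (2 * pi) *\<^sub>R k j) (\<lambda>j. Arg (lam j)) x"
    unfolding trig_potential_def cos_potential_def Re_sum by simp
qed

section \<open>Frequencies along common directions\<close>

(* The index 1 has to stay a numeral for the hypotheses on j \<in> {1, 2, 3} to apply. *)
declare One_nat_def [simp del]

lemma parallel_scaleD:
  assumes "parallel (a *\<^sub>R u) (b *\<^sub>R w)" "a \<noteq> 0" "b \<noteq> 0"
  shows "parallel u w"
proof -
  obtain s t where st: "s \<noteq> 0 \<or> t \<noteq> 0" "s *\<^sub>R a *\<^sub>R u + t *\<^sub>R b *\<^sub>R w = 0" using assms(1) unfolding parallel_def by blast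
  have "(s * a \<noteq> 0 \<or> t * b \<noteq> 0) \<and> (s * a) *\<^sub>R u + (t * b) *\<^sub>R w = 0" using st assms(2,3) by simp
  then show ?thesis unfolding parallel_def by blast
qed

lemma atLeastAtMost_1_3: "{1..3} = {1, 2, 3 :: nat}" by auto

lemma admissible_dataD:
  assumes "admissible_data lam k"
  shows "\<And>j. j \<in> {1, 2, 3} \<Longrightarrow> lam j \<noteq> 0" "\<And>j. j \<in> {1, 2, 3} \<Longrightarrow> k j \<in> integer_lattice"
    "\<And>j. j \<in> {1, 2, 3} \<Longrightarrow> k j \<noteq> 0"
    "\<And>i j. i \<in> {1, 2, 3} \<Longrightarrow> j \<in> {1, 2, 3} \<Longrightarrow> i \<noteq> j \<Longrightarrow> \<not> parallel (k i) (k j)"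
  using assms unfolding admissible_data_def atLeastAtMost_1_3 by blast+

lemma admissible_waves:
  assumes "admissible_data lam k"
  shows "frequencies {1, 2, 3} (\<lambda>j. (2 * pi) *\<^sub>R k j)" "lattice_waves {1, 2, 3} (\<lambda>j. (2 * pi) *\<^sub>R k j)"
proof -
  show "frequencies {1, 2, 3} (\<lambda>j. (2 * pi) *\<^sub>R k j)"
    unfolding frequencies_def
  proof (intro conjI ballI impI)
    fix i :: nat assume i: "i \<in> {1, 2, 3}"
    show "(2 * pi) *\<^sub>R k i \<noteq> 0" using admissible_dataD(3)[OF assms i] by simp
    fix j :: nat assume j: "j \<in> {1, 2, 3}" "i \<noteq> j"
    show "\<not> parallel ((2 * pi) *\<^sub>R k i) ((2 * pi) *\<^sub>R k j)"
    proof
      assume "parallel ((2 * pi) *\<^sub>R k i) ((2 * pi) *\<^sub>R k j)"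
      then have "parallel (k i) (k j)" by (rule parallel_scaleD) simp_all
      then show False using admissible_dataD(4)[OF assms i j] by blast
    qed
  qed
  show "lattice_waves {1, 2, 3} (\<lambda>j. (2 * pi) *\<^sub>R k j)"
    unfolding lattice_waves_def using admissible_dataD(2)[OF assms] by blast
qed

lemma rational_ratio:
  fixes k :: "real ^ 'n"
  assumes "k \<in> integer_lattice" "c *\<^sub>R k \<in> integer_lattice" "k \<noteq> 0"
  shows "c \<in> \<rat>"
proof -
  obtain i where i: "k $ i \<noteq> 0" using assms(3) by (auto simp: vec_eq_iff)
  have "k $ i \<in> \<rat>" "(c *\<^sub>R k) $ i \<in> \<rat>" using assms(1,2) Ints_subset_Rats unfolding integer_lattice_def by blast+
  then have "(c *\<^sub>R k) $ i / k $ i \<in> \<rat>" by (intro Rats_divide)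
  then show ?thesis using i by simp
qed

lemma cos_potential_cong:
  assumes "\<And>j. j \<in> I \<Longrightarrow> A j = A' j" "\<And>j. j \<in> I \<Longrightarrow> k j = k' j"
  shows "cos_potential a I A k \<theta> = cos_potential a I A' k' \<theta>"
  using assms by (simp add: fun_eq_iff cos_potential_def)

text \<open>Of the two opposite frequencies of each wave, the relabelling picks the one on the side of \<open>k1 j\<close>, so the ratios are
positive.\<close>

lemma alignment:
  fixes k1 k2 :: "nat \<Rightarrow> real ^ 'n"
  assumes d1: "admissible_data lam1 k1" and d2: "admissible_data lam2 k2"
    and same: "same_value (trig_potential a1 lam1 k1) (trig_potential a2 lam2 k2)"
  shows "a1 = a2 \<and> (\<exists>lam' k' c. relabelling lam2 k2 lam' k' \<and>
    (\<forall>j\<in>{1, 2, 3}. c j > 0 \<and> c j \<in> \<rat> \<and> k' j = c j *\<^sub>R k1 j \<and> cmod (lam1 j) = cmod (lam' j)))"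
proof -
  let ?I = "{1, 2, 3 :: nat}"
  have "a1 = a2 \<and> (\<exists>f. inj_on f ?I \<and> f ` ?I \<subseteq> ?I \<and>
    (\<forall>i\<in>?I. parallel ((2 * pi) *\<^sub>R k1 i) ((2 * pi) *\<^sub>R k2 (f i)) \<and> 2 * cmod (lam1 i) = 2 * cmod (lam2 (f i))))"
    by (rule same_value_directions[OF _ same[unfolded trig_potential_eq_cos_potential] admissible_waves(1)[OF d1] admissible_waves(1)[OF d2]])
      (use admissible_dataD(1)[OF d1] admissible_dataD(1)[OF d2] in auto)
  then obtain f where a: "a1 = a2" and f: "inj_on f ?I" "f ` ?I \<subseteq> ?I"
    and par: "\<And>i. i \<in> ?I \<Longrightarrow> parallel ((2 * pi) *\<^sub>R k1 i) ((2 * pi) *\<^sub>R k2 (f i))"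
    and mods: "\<And>i. i \<in> ?I \<Longrightarrow> 2 * cmod (lam1 i) = 2 * cmod (lam2 (f i))" by blast
  define \<sigma> where "\<sigma> = (\<lambda>j. if j \<in> ?I then f j else j)"
  have fin: "finite ?I" by simp
  have "f ` ?I = ?I" using endo_inj_surj[OF fin f(2,1)] .
  then have "bij_betw f ?I ?I" using f(1) by (simp add: bij_betw_def)
  then have "bij_betw \<sigma> ?I ?I" using bij_betw_cong[of ?I \<sigma> f ?I] by (simp add: \<sigma>_def)
  then have perm: "\<sigma> permutes {1..3}" unfolding atLeastAtMost_1_3
    by (rule bij_imp_permutes) (simp add: \<sigma>_def)
  have fI: "f j \<in> ?I" if "j \<in> ?I" for j using f(2) that by blast
  have "\<exists>d. k2 (\<sigma> j) = d *\<^sub>R k1 j" if j: "j \<in> ?I" for j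
  proof -
    have "parallel (k1 j) (k2 (f j))" using par[OF j] by (rule parallel_scaleD) simp_all
    then obtain d where "k2 (f j) = d *\<^sub>R k1 j" using parallel_iff_scaleR[OF admissible_dataD(3)[OF d1 j]] by blast
    moreover have "\<sigma> j = f j" using j by (simp only: \<sigma>_def if_True)
    ultimately show ?thesis by metis
  qed
  then have "\<forall>j\<in>?I. \<exists>d. k2 (\<sigma> j) = d *\<^sub>R k1 j" by blast
  from bchoice[OF this] obtain d where d: "\<And>j. j \<in> ?I \<Longrightarrow> k2 (\<sigma> j) = d j *\<^sub>R k1 j" by blast
  have \<sigma>I: "\<sigma> j \<in> ?I" "\<sigma> j = f j" if "j \<in> ?I" for j using fI[OF that] that by (simp_all only: \<sigma>_def if_True)
  have d0: "d j \<noteq> 0" if "j \<in> ?I" for j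
    using d[OF that] admissible_dataD(3)[OF d2 \<sigma>I(1)[OF that]] by auto
  define c where "c = (\<lambda>j. \<bar>d j\<bar>)"
  define k' where "k' = (\<lambda>j. if d j > 0 then k2 (\<sigma> j) else - k2 (\<sigma> j))"
  define lam' where "lam' = (\<lambda>j. if d j > 0 then lam2 (\<sigma> j) else cnj (lam2 (\<sigma> j)))"
  have rel: "relabelling lam2 k2 lam' k'"
    unfolding relabelling_def by (rule exI[of _ \<sigma>]) (use perm in \<open>auto simp: k'_def lam'_def\<close>)
  have "c j > 0 \<and> c j \<in> \<rat> \<and> k' j = c j *\<^sub>R k1 j \<and> cmod (lam1 j) = cmod (lam' j)" if j: "j \<in> ?I" for j
  proof (intro conjI)
    show "c j > 0" using d0[OF j] by (simp add: c_def)
    show k'j: "k' j = c j *\<^sub>R k1 j" using d0[OF j] by (simp add: k'_def c_def d[OF j])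
    have "k' j \<in> integer_lattice" using admissible_dataD(2)[OF d2 \<sigma>I(1)[OF j]] by (simp add: k'_def lattice_uminus)
    then show "c j \<in> \<rat>" using rational_ratio[OF admissible_dataD(2)[OF d1 j] _ admissible_dataD(3)[OF d1 j]] k'j by simp
    show "cmod (lam1 j) = cmod (lam' j)" using mods[OF j] \<sigma>I(2)[OF j] by (simp add: lam'_def)
  qed
  then show ?thesis using a rel by blast
qed

lemma relabelled_admissible:
  assumes d: "admissible_data lam k" and r: "relabelling lam k lam' k'" and j: "j \<in> {1, 2, 3}"
  shows "k' j \<in> integer_lattice" "k' j \<noteq> 0"
proof -
  obtain \<sigma> where \<sigma>: "\<sigma> permutes {1..3}" "\<forall>j\<in>{1..3}. k' j = k (\<sigma> j) \<and> lam' j = lam (\<sigma> j) \<or> k' j = - k (\<sigma> j) \<and> lam' j = cnj (lam (\<sigma> j))"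
    using r unfolding relabelling_def by blast
  have "\<sigma> j \<in> {1, 2, 3}" using permutes_in_image[OF \<sigma>(1)] j unfolding atLeastAtMost_1_3 by blast
  note D = admissible_dataD(2,3)[OF d this]
  have "k' j = k (\<sigma> j) \<or> k' j = - k (\<sigma> j)" using \<sigma>(2) j unfolding atLeastAtMost_1_3 by blast
  then show "k' j \<in> integer_lattice" "k' j \<noteq> 0" using D lattice_uminus by auto
qed

text \<open>A single wave may be stretched arbitrarily along its direction: this is why the length of a
frequency orthogonal to all others is lost.\<close>

lemma same_value_single:
  fixes k k' :: "nat \<Rightarrow> real ^ 'n"
  assumes lw: "lattice_waves {j} k" "lattice_waves {j} k'" and k: "k j \<noteq> 0" "c \<noteq> 0" "k' j = c *\<^sub>R k j"
  shows "same_value (cos_potential a {j} A k \<theta>) (cos_potential a {j} A k' \<theta>')"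
proof (rule same_value_cos_dilation[OF lw k(2)])
  show "k' i = c *\<^sub>R k i" if "i \<in> {j}" for i using that k by simp
  show "(((\<theta> j - \<theta>' j) / (k j \<bullet> k j)) *\<^sub>R k j) \<bullet> k i = \<theta> i - \<theta>' i" if "i \<in> {j}" for i using that k by simp
qed

text \<open>Constants are test functions at momentum zero and bound \<open>\<mu>\<close> by the supremum of the potential;
conversely the kinetic energy is non-negative.\<close>

lemma cell_value_zero_iff:
  assumes "buc V" "cell_value V 0 \<mu>"
  shows "(\<forall>x. V x \<le> M) \<longleftrightarrow> \<mu> \<le> M"
  using cell_value_zero_le[OF assms, of M] cell_value_ge_potential[OF assms] by (meson order_trans)

text \<open>The common ratio is undone by a dilation, after which the frequencies and amplitudes agree and only the phases
have to be matched. A reflection of space that this may require becomes the sign of the factor.\<close>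

lemma translate_of_common_ratio:
  fixes k1 k2 :: "nat \<Rightarrow> real ^ 'n"
  assumes d1: "admissible_data lam1 k1" and same: "same_value (trig_potential a lam1 k1) (trig_potential a lam2 k2)"
    and c: "c > 0" "c \<in> \<rat>" and al: "\<And>j. j \<in> {1, 2, 3} \<Longrightarrow> k2 j = c *\<^sub>R k1 j" "\<And>j. j \<in> {1, 2, 3} \<Longrightarrow> cmod (lam1 j) = cmod (lam2 j)"
  shows "\<exists>c\<in>\<rat> - {0}. \<exists>x0. \<forall>x. trig_potential a lam1 k1 x = trig_potential a lam2 k2 ((1 / c) *\<^sub>R x + x0)"
proof -
  let ?I = "{1, 2, 3 :: nat}"
  define A where "A = (\<lambda>j. 2 * cmod (lam1 j))"
  define k where "k = (\<lambda>j. (2 * pi) *\<^sub>R k1 j)"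
  define V1 where "V1 = cos_potential a ?I A k (\<lambda>j. Arg (lam1 j))"
  define W where "W = cos_potential a ?I A k (\<lambda>j. Arg (lam2 j))"
  have V1: "trig_potential a lam1 k1 = V1" unfolding V1_def A_def k_def by (rule trig_potential_eq_cos_potential)
  have V2: "trig_potential a lam2 k2 y = W (c *\<^sub>R y)" for y
  proof -
    have "trig_potential a lam2 k2 = cos_potential a ?I A (\<lambda>j. c *\<^sub>R k j) (\<lambda>j. Arg (lam2 j))"
      unfolding trig_potential_eq_cos_potential
      by (rule cos_potential_cong) (use al in \<open>auto simp: A_def k_def\<close>)
    then show ?thesis unfolding W_def cos_potential_def by simp
  qed
  have fr: "frequencies ?I k" unfolding k_def by (rule admissible_waves(1)[OF d1])
  have np: "\<not> parallel (k 1) (k 2)" using fr unfolding frequencies_def by auto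
  have "\<exists>\<sigma> x0. (\<sigma> = 1 \<or> \<sigma> = - 1) \<and> (\<forall>x. V1 x = W (\<sigma> *\<^sub>R x + x0))"
  proof (cases "\<exists>\<alpha> \<beta>. k1 3 = \<alpha> *\<^sub>R k1 1 + \<beta> *\<^sub>R k1 2")
    case False
    have "k 3 \<noteq> \<alpha> *\<^sub>R k 1 + \<beta> *\<^sub>R k 2" for \<alpha> \<beta>
    proof
      assume "k 3 = \<alpha> *\<^sub>R k 1 + \<beta> *\<^sub>R k 2"
      then have "(2 * pi) *\<^sub>R k1 3 = (2 * pi) *\<^sub>R (\<alpha> *\<^sub>R k1 1 + \<beta> *\<^sub>R k1 2)"
        by (simp add: k_def scaleR_add_right mult.commute)
      then have "k1 3 = \<alpha> *\<^sub>R k1 1 + \<beta> *\<^sub>R k1 2" unfolding scaleR_cancel_left by simp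
      then show False using False by blast
    qed
    from phases_match_independent[where k = k, OF np this] obtain x0 where "\<forall>x. V1 x = W (x + x0)" unfolding V1_def W_def by blast
    then have "(1 = (1::real) \<or> 1 = - (1::real)) \<and> (\<forall>x. V1 x = W (1 *\<^sub>R x + x0))" by simp
    then show ?thesis by blast
  next
    case True
    then obtain \<alpha> \<beta> where e: "k1 3 = \<alpha> *\<^sub>R k1 1 + \<beta> *\<^sub>R k1 2" by blast
    have I: "1 \<in> ?I" "2 \<in> ?I" "3 \<in> ?I" by simp_all
    have np1: "\<not> parallel (k1 1) (k1 2)" by (rule admissible_dataD(4)[OF d1 I(1,2)]) simp
    obtain n1 n2 n3 z1 z2 z3 :: int where n: "of_int n1 *\<^sub>R k1 1 + of_int n2 *\<^sub>R k1 2 + of_int n3 *\<^sub>R k1 3 = 0" "n3 \<noteq> 0"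
      "n1 * z1 + n2 * z2 + n3 * z3 = 1"
      using integer_relation[OF admissible_dataD(2)[OF d1 I(1)] admissible_dataD(2)[OF d1 I(2)] admissible_dataD(2)[OF d1 I(3)] np1 e] by blast
    have rel: "of_int n1 *\<^sub>R k 1 + of_int n2 *\<^sub>R k 2 + of_int n3 *\<^sub>R k 3 = 0"
    proof -
      have "of_int n1 *\<^sub>R k 1 + of_int n2 *\<^sub>R k 2 + of_int n3 *\<^sub>R k 3 =
         (2 * pi) *\<^sub>R (of_int n1 *\<^sub>R k1 1 + of_int n2 *\<^sub>R k1 2 + of_int n3 *\<^sub>R k1 3)"
        unfolding k_def by (simp add: scaleR_add_right mult.commute)
      then show ?thesis unfolding n(1) by simp
    qed
    have A: "A 1 > 0" "A 2 > 0" "A 3 > 0" using admissible_dataD(1)[OF d1] by (simp_all add: A_def)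
    have W_range: "(\<forall>x. W x \<le> M) \<longleftrightarrow> (\<forall>x. trig_potential a lam2 k2 x \<le> M)" for M
    proof
      assume "\<forall>x. W x \<le> M" then show "\<forall>x. trig_potential a lam2 k2 x \<le> M" by (simp add: V2)
    next
      assume r: "\<forall>x. trig_potential a lam2 k2 x \<le> M"
      show "\<forall>x. W x \<le> M"
      proof
        fix x show "W x \<le> M" using r[rule_format, of "(1 / c) *\<^sub>R x"] c by (simp add: V2)
      qed
    qed
    obtain \<mu> where \<mu>: "cell_value (trig_potential a lam1 k1) 0 \<mu>" "cell_value (trig_potential a lam2 k2) 0 \<mu>"
      using same unfolding same_value_def by blast
    have bucs: "buc (trig_potential a lam1 k1)" "buc (trig_potential a lam2 k2)"
      unfolding trig_potential_eq_cos_potential by (rule buc_cos_potential)+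
    have sup: "(\<forall>x. V1 x \<le> M) \<longleftrightarrow> (\<forall>x. W x \<le> M)" for M
      unfolding W_range V1[symmetric] cell_value_zero_iff[OF bucs(1) \<mu>(1)] cell_value_zero_iff[OF bucs(2) \<mu>(2)] ..
    show ?thesis unfolding V1_def W_def
      by (rule phases_match[OF A np rel n(2,3)]) (rule sup[unfolded V1_def W_def])
  qed
  then obtain \<sigma> x0 where \<sigma>: "\<sigma> = 1 \<or> \<sigma> = - 1" "\<And>x. V1 x = W (\<sigma> *\<^sub>R x + x0)" by blast
  have "trig_potential a lam1 k1 x = trig_potential a lam2 k2 ((1 / (\<sigma> * c)) *\<^sub>R x + (1 / c) *\<^sub>R x0)" for x
  proof -
    have "c *\<^sub>R ((1 / (\<sigma> * c)) *\<^sub>R x + (1 / c) *\<^sub>R x0) = \<sigma> *\<^sub>R x + x0"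
      using \<sigma>(1) c(1) by (auto simp: scaleR_add_right)
    then show ?thesis unfolding V1 V2 \<sigma>(2) by simp
  qed
  moreover have "\<sigma> * c \<in> \<rat> - {0}" using \<sigma>(1) c by auto
  ultimately show ?thesis by blast
qed

section \<open>The three cases\<close>

lemma trig_effective_eq_iff:
  fixes k1 k2 :: "nat \<Rightarrow> real ^ 'n"
  assumes d1: "admissible_data lam1 k1" and d2: "admissible_data lam2 k2"
  shows "effective_hamiltonian (trig_potential a1 lam1 k1) = effective_hamiltonian (trig_potential a2 lam2 k2) \<longleftrightarrow>
    same_value (trig_potential a1 lam1 k1) (trig_potential a2 lam2 k2)"
  unfolding trig_potential_eq_cos_potential
  by (intro effective_hamiltonian_eq_iff buc_cos_potential lattice_periodic_cos_potential admissible_waves(2)[OF d1] admissible_waves(2)[OF d2])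

lemma aligned_cos_potential:
  fixes k :: "nat \<Rightarrow> real ^ 'n"
  assumes "\<And>j. j \<in> {1, 2, 3} \<Longrightarrow> k' j = c j *\<^sub>R k j" "\<And>j. j \<in> {1, 2, 3} \<Longrightarrow> cmod (lam j) = cmod (lam' j)"
  shows "trig_potential a lam' k' =
    cos_potential a {1, 2, 3} (\<lambda>j. 2 * cmod (lam j)) (\<lambda>j. c j *\<^sub>R ((2 * pi) *\<^sub>R k j)) (\<lambda>j. Arg (lam' j))"
  unfolding trig_potential_eq_cos_potential by (rule cos_potential_cong) (use assms in auto)

lemma same_value_first_orthogonal:
  fixes k k' :: "nat \<Rightarrow> real ^ 'n"
  assumes lat: "\<And>j. j \<in> {1, 2, 3} \<Longrightarrow> k j \<in> integer_lattice" "\<And>j. j \<in> {1, 2, 3} \<Longrightarrow> k' j \<in> integer_lattice"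
    and k1: "k 1 \<noteq> 0" "k' 1 \<noteq> 0" "parallel (k 1) (k' 1)"
    and orth: "k 1 \<bullet> k 2 = 0" "k 1 \<bullet> k 3 = 0" "k' 1 \<bullet> k' 2 = 0" "k' 1 \<bullet> k' 3 = 0"
    and rest: "same_value (cos_potential a {2, 3} A (\<lambda>j. (2 * pi) *\<^sub>R k j) \<theta>) (cos_potential a {2, 3} A (\<lambda>j. (2 * pi) *\<^sub>R k' j) \<theta>')"
  shows "same_value (cos_potential a {1, 2, 3} A (\<lambda>j. (2 * pi) *\<^sub>R k j) \<theta>) (cos_potential a {1, 2, 3} A (\<lambda>j. (2 * pi) *\<^sub>R k' j) \<theta>')"
proof -
  obtain c where c: "k' 1 = c *\<^sub>R k 1" using k1(3) parallel_iff_scaleR[OF k1(1)] by blast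
  have c0: "c \<noteq> 0" using c k1(2) by auto
  have lw: "lattice_waves {1, 2, 3} (\<lambda>j. (2 * pi) *\<^sub>R k j)" "lattice_waves {1, 2, 3} (\<lambda>j. (2 * pi) *\<^sub>R k' j)"
    unfolding lattice_waves_def using lat by blast+
  have lw1: "lattice_waves {1} (\<lambda>j. (2 * pi) *\<^sub>R k j)" "lattice_waves {1} (\<lambda>j. (2 * pi) *\<^sub>R k' j)"
    using lw unfolding lattice_waves_def by simp_all
  show ?thesis
  proof (rule same_value_insert[where c = c])
    show "same_value (cos_potential 0 {1} A (\<lambda>j. (2 * pi) *\<^sub>R k j) \<theta>) (cos_potential 0 {1} A (\<lambda>j. (2 * pi) *\<^sub>R k' j) \<theta>')"
      by (rule same_value_single[where c = c, OF lw1]) (use k1 c c0 in simp_all)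
    show "(2 * pi) *\<^sub>R k 1 \<bullet> (2 * pi) *\<^sub>R k j = 0" if "j \<in> {2, 3}" for j using that orth by auto
    show "(2 * pi) *\<^sub>R k' 1 \<bullet> (2 * pi) *\<^sub>R k' j = 0" if "j \<in> {2, 3}" for j using that orth by auto
  qed (use lw rest k1 c c0 in simp_all)
qed

text \<open>The waves are split off one at a time, each with its own ratio.\<close>

lemma orthogonal_case:
  fixes k1 k2 :: "nat \<Rightarrow> real ^ 'n"
  assumes d1: "admissible_data lam1 k1" and d2: "admissible_data lam2 k2" and orth: "mutually_orthogonal k1"
    and rel: "relabelling lam2 k2 lam' k'" and al: "\<forall>j\<in>{1..3}. parallel (k1 j) (k' j) \<and> cmod (lam1 j) = cmod (lam' j)"
  shows "same_value (trig_potential a lam1 k1) (trig_potential a lam2 k2)"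
proof -
  have I: "1 \<in> {1, 2, 3 :: nat}" "2 \<in> {1, 2, 3 :: nat}" "3 \<in> {1, 2, 3 :: nat}" by simp_all
  have lat1: "k1 j \<in> integer_lattice" "k1 j \<noteq> 0" if "j \<in> {1, 2, 3}" for j using admissible_dataD(2,3)[OF d1 that] .
  have lat2: "k' j \<in> integer_lattice" "k' j \<noteq> 0" if "j \<in> {1, 2, 3}" for j using relabelled_admissible[OF d2 rel that] .
  have par: "parallel (k1 j) (k' j)" and mods: "cmod (lam1 j) = cmod (lam' j)" if "j \<in> {1, 2, 3}" for j
    using al that unfolding atLeastAtMost_1_3 by blast+
  have "\<forall>j\<in>{1, 2, 3}. \<exists>c. k' j = c *\<^sub>R k1 j" using par parallel_iff_scaleR lat1(2) by blast
  from bchoice[OF this] obtain c where c: "\<And>j. j \<in> {1, 2, 3} \<Longrightarrow> k' j = c j *\<^sub>R k1 j" by blast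
  have c0: "c j \<noteq> 0" if "j \<in> {1, 2, 3}" for j using lat2(2)[OF that] c[OF that] by auto
  have o: "k1 1 \<bullet> k1 2 = 0" "k1 1 \<bullet> k1 3 = 0" "k1 2 \<bullet> k1 3 = 0"
    using orth unfolding mutually_orthogonal_def atLeastAtMost_1_3 orthogonal_def by auto
  have o': "k' 1 \<bullet> k' 2 = 0" "k' 1 \<bullet> k' 3 = 0" "k' 2 \<bullet> k' 3 = 0"
    unfolding c[OF I(1)] c[OF I(2)] c[OF I(3)] using o by simp_all
  define A where "A = (\<lambda>j. 2 * cmod (lam1 j))"
  have V2: "trig_potential a lam2 k2 = cos_potential a {1, 2, 3} A (\<lambda>j. (2 * pi) *\<^sub>R k' j) (\<lambda>j. Arg (lam' j))"
  proof -
    have "trig_potential a lam2 k2 = trig_potential a lam' k'" by (rule trig_potential_relabelling[OF rel, symmetric])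
    also have "\<dots> = cos_potential a {1, 2, 3} A (\<lambda>j. (2 * pi) *\<^sub>R k' j) (\<lambda>j. Arg (lam' j))"
      unfolding trig_potential_eq_cos_potential by (rule cos_potential_cong) (use mods in \<open>simp_all add: A_def\<close>)
    finally show ?thesis .
  qed
  have lw: "lattice_waves {1, 2, 3} (\<lambda>j. (2 * pi) *\<^sub>R k1 j)" "lattice_waves {1, 2, 3} (\<lambda>j. (2 * pi) *\<^sub>R k' j)"
    unfolding lattice_waves_def using lat1 lat2 by blast+
  have sub: "lattice_waves J k" if "lattice_waves {1, 2, 3} k" "J \<subseteq> {1, 2, 3}" for J and k :: "nat \<Rightarrow> real ^ 'n"
    using that unfolding lattice_waves_def by blast
  have single: "same_value (cos_potential b {j} A (\<lambda>j. (2 * pi) *\<^sub>R k1 j) (\<lambda>j. Arg (lam1 j))) (cos_potential b {j} A (\<lambda>j. (2 * pi) *\<^sub>R k' j) (\<lambda>j. Arg (lam' j)))"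
    if j: "j \<in> {1, 2, 3}" for b j
  proof (rule same_value_single[where c = "c j"])
    show "lattice_waves {j} (\<lambda>j. (2 * pi) *\<^sub>R k1 j)" "lattice_waves {j} (\<lambda>j. (2 * pi) *\<^sub>R k' j)"
      using j by (auto intro!: sub lw)
  qed (use lat1(2)[OF j] c0[OF j] c[OF j] in simp_all)
  have "same_value (cos_potential a {2, 3} A (\<lambda>j. (2 * pi) *\<^sub>R k1 j) (\<lambda>j. Arg (lam1 j))) (cos_potential a {2, 3} A (\<lambda>j. (2 * pi) *\<^sub>R k' j) (\<lambda>j. Arg (lam' j)))"
  proof (rule same_value_insert[where c = "c 2"])
    show "lattice_waves {2, 3} (\<lambda>j. (2 * pi) *\<^sub>R k1 j)" "lattice_waves {2, 3} (\<lambda>j. (2 * pi) *\<^sub>R k' j)" by (auto intro!: sub lw)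
    show "(2 * pi) *\<^sub>R k1 2 \<bullet> (2 * pi) *\<^sub>R k1 j = 0" if "j \<in> {3}" for j using that o by simp
    show "(2 * pi) *\<^sub>R k' 2 \<bullet> (2 * pi) *\<^sub>R k' j = 0" if "j \<in> {3}" for j using that o' by simp
  qed (use single I lat1(2)[OF I(2)] c0[OF I(2)] c[OF I(2)] in simp_all)
  from same_value_first_orthogonal[OF lat1(1) lat2(1) lat1(2)[OF I(1)] lat2(2)[OF I(1)] par[OF I(1)] o(1,2) o'(1,2) this]
  show ?thesis unfolding V2 trig_potential_eq_cos_potential[of a lam1 k1] A_def .
qed

text \<open>The first wave is split off. The other two share one ratio, and being independent they have phases that a
translation removes.\<close>

lemma first_orthogonal_case:
  fixes k1 k2 :: "nat \<Rightarrow> real ^ 'n"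
  assumes d1: "admissible_data lam1 k1" and d2: "admissible_data lam2 k2" and orth: "first_orthogonal_only k1"
    and rel: "relabelling lam2 k2 lam' k'" and par: "parallel (k1 1) (k' 1)"
    and c: "c \<noteq> 0" "c *\<^sub>R k1 2 = k' 2" "c *\<^sub>R k1 3 = k' 3" and mods: "\<forall>j\<in>{1..3}. cmod (lam1 j) = cmod (lam' j)"
  shows "same_value (trig_potential a lam1 k1) (trig_potential a lam2 k2)"
proof -
  have I: "1 \<in> {1, 2, 3 :: nat}" "2 \<in> {1, 2, 3 :: nat}" "3 \<in> {1, 2, 3 :: nat}" by simp_all
  have lat1: "k1 j \<in> integer_lattice" "k1 j \<noteq> 0" if "j \<in> {1, 2, 3}" for j using admissible_dataD(2,3)[OF d1 that] .
  have lat2: "k' j \<in> integer_lattice" "k' j \<noteq> 0" if "j \<in> {1, 2, 3}" for j using relabelled_admissible[OF d2 rel that] .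
  have o: "k1 1 \<bullet> k1 2 = 0" "k1 1 \<bullet> k1 3 = 0" using orth unfolding first_orthogonal_only_def orthogonal_def by blast+
  obtain b where b: "k' 1 = b *\<^sub>R k1 1" using par parallel_iff_scaleR[OF lat1(2)[OF I(1)]] by blast
  have o': "k' 1 \<bullet> k' 2 = 0" "k' 1 \<bullet> k' 3 = 0" unfolding b c(2,3)[symmetric] using o by simp_all
  define A where "A = (\<lambda>j. 2 * cmod (lam1 j))"
  have V2: "trig_potential a lam2 k2 = cos_potential a {1, 2, 3} A (\<lambda>j. (2 * pi) *\<^sub>R k' j) (\<lambda>j. Arg (lam' j))"
  proof -
    have "trig_potential a lam2 k2 = trig_potential a lam' k'" by (rule trig_potential_relabelling[OF rel, symmetric])
    also have "\<dots> = cos_potential a {1, 2, 3} A (\<lambda>j. (2 * pi) *\<^sub>R k' j) (\<lambda>j. Arg (lam' j))"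
      unfolding trig_potential_eq_cos_potential by (rule cos_potential_cong) (use mods[unfolded atLeastAtMost_1_3] in \<open>auto simp: A_def\<close>)
    finally show ?thesis .
  qed
  have np: "\<not> parallel ((2 * pi) *\<^sub>R k1 2) ((2 * pi) *\<^sub>R k1 3)"
    using admissible_waves(1)[OF d1] unfolding frequencies_def by auto
  obtain y where y: "y \<bullet> ((2 * pi) *\<^sub>R k1 2) = Arg (lam1 2) - Arg (lam' 2)" "y \<bullet> ((2 * pi) *\<^sub>R k1 3) = Arg (lam1 3) - Arg (lam' 3)"
    using exists_inner_two[OF np, of "Arg (lam1 2) - Arg (lam' 2)" "Arg (lam1 3) - Arg (lam' 3)"] by blast
  have "same_value (cos_potential a {2, 3} A (\<lambda>j. (2 * pi) *\<^sub>R k1 j) (\<lambda>j. Arg (lam1 j))) (cos_potential a {2, 3} A (\<lambda>j. (2 * pi) *\<^sub>R k' j) (\<lambda>j. Arg (lam' j)))"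
  proof (rule same_value_cos_dilation[where c = c and y = y])
    show "lattice_waves {2, 3} (\<lambda>j. (2 * pi) *\<^sub>R k1 j)" "lattice_waves {2, 3} (\<lambda>j. (2 * pi) *\<^sub>R k' j)"
      unfolding lattice_waves_def using lat1(1) lat2(1) by blast+
    show "c \<noteq> 0" by (rule c(1))
    show "(2 * pi) *\<^sub>R k' j = c *\<^sub>R (2 * pi) *\<^sub>R k1 j" if "j \<in> {2, 3}" for j using that c(2,3)[symmetric] by auto
    show "y \<bullet> (2 * pi) *\<^sub>R k1 j = Arg (lam1 j) - Arg (lam' j)" if "j \<in> {2, 3}" for j using that y by auto
  qed
  from same_value_first_orthogonal[OF lat1(1) lat2(1) lat1(2)[OF I(1)] lat2(2)[OF I(1)] par o o' this]
  show ?thesis unfolding V2 trig_potential_eq_cos_potential[of a lam1 k1] A_def .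
qed

text \<open>With at most one non-orthogonal pair, some ordering of the vectors would satisfy one of the excluded conditions.\<close>

lemma two_edges:
  assumes "\<forall>\<sigma>. \<sigma> permutes {1..3} \<longrightarrow> \<not> mutually_orthogonal (k \<circ> \<sigma>) \<and> \<not> first_orthogonal_only (k \<circ> \<sigma>)"
  shows "k 1 \<bullet> k 2 \<noteq> 0 \<and> k 1 \<bullet> k 3 \<noteq> 0 \<or> k 1 \<bullet> k 2 \<noteq> 0 \<and> k 2 \<bullet> k 3 \<noteq> 0 \<or> k 1 \<bullet> k 3 \<noteq> 0 \<and> k 2 \<bullet> k 3 \<noteq> 0"
proof -
  have sym: "k 2 \<bullet> k 1 = k 1 \<bullet> k 2" "k 3 \<bullet> k 1 = k 1 \<bullet> k 3" "k 3 \<bullet> k 2 = k 2 \<bullet> k 3" by (simp_all add: inner_commute)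
  have "id permutes {1..3 :: nat}" by (rule permutes_id)
  then have a: "\<not> mutually_orthogonal k" "\<not> first_orthogonal_only k" using assms by fastforce+
  have "Transposition.transpose 1 2 permutes {1..3 :: nat}" by (rule permutes_swap_id) simp_all
  then have b: "\<not> first_orthogonal_only (k \<circ> Transposition.transpose 1 2)" using assms by blast
  have "Transposition.transpose 1 3 permutes {1..3 :: nat}" by (rule permutes_swap_id) simp_all
  then have c: "\<not> first_orthogonal_only (k \<circ> Transposition.transpose 1 3)" using assms by blast
  have b': "\<not> (k 1 \<bullet> k 2 = 0 \<and> k 2 \<bullet> k 3 = 0 \<and> k 1 \<bullet> k 3 \<noteq> 0)"
    using b unfolding first_orthogonal_only_def orthogonal_def o_def by (simp add: sym Transposition.transpose_def)
  have c': "\<not> (k 2 \<bullet> k 3 = 0 \<and> k 1 \<bullet> k 3 = 0 \<and> k 1 \<bullet> k 2 \<noteq> 0)"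
    using c unfolding first_orthogonal_only_def orthogonal_def o_def by (simp add: sym Transposition.transpose_def)
  have a1: "\<not> (k 1 \<bullet> k 2 = 0 \<and> k 1 \<bullet> k 3 = 0 \<and> k 2 \<bullet> k 3 = 0)"
  proof
    assume h: "k 1 \<bullet> k 2 = 0 \<and> k 1 \<bullet> k 3 = 0 \<and> k 2 \<bullet> k 3 = 0"
    have "mutually_orthogonal k"
      unfolding mutually_orthogonal_def atLeastAtMost_1_3 orthogonal_def using h sym by simp
    then show False using a(1) by blast
  qed
  have a2: "\<not> (k 1 \<bullet> k 2 = 0 \<and> k 1 \<bullet> k 3 = 0 \<and> k 2 \<bullet> k 3 \<noteq> 0)"
    using a(2) unfolding first_orthogonal_only_def orthogonal_def by blast
  show ?thesis using a1 a2 b' c' by blast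
qed

theorem theorem1p2:
  fixes a1 a2 :: real
    and lam1 lam2 :: "nat \<Rightarrow> complex"
    and k1 k2 :: "nat \<Rightarrow> real ^ 'n"
  assumes dim: "CARD('n) \<ge> 3"
    and data1: "admissible_data lam1 k1"
    and data2: "admissible_data lam2 k2"
  shows
    "(mutually_orthogonal k1 \<longrightarrow>
        (effective_hamiltonian (trig_potential a1 lam1 k1) =
           effective_hamiltonian (trig_potential a2 lam2 k2) \<longleftrightarrow>
         a1 = a2 \<and>
         (\<exists>lam2' k2'. relabelling lam2 k2 lam2' k2' \<and>
            (\<forall>j\<in>{1..3}. parallel (k1 j) (k2' j) \<and> cmod (lam1 j) = cmod (lam2' j))))) \<and>
     (first_orthogonal_only k1 \<longrightarrow>
        (effective_hamiltonian (trig_potential a1 lam1 k1) =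
           effective_hamiltonian (trig_potential a2 lam2 k2) \<longleftrightarrow>
         a1 = a2 \<and>
         (\<exists>lam2' k2'. relabelling lam2 k2 lam2' k2' \<and>
            parallel (k1 1) (k2' 1) \<and>
            (\<exists>c\<in>\<rat> - {0}. c *\<^sub>R k1 2 = k2' 2 \<and> c *\<^sub>R k1 3 = k2' 3) \<and>
            (\<forall>j\<in>{1..3}. cmod (lam1 j) = cmod (lam2' j))))) \<and>
     ((\<forall>\<sigma>. \<sigma> permutes {1..3} \<longrightarrow>
          \<not> mutually_orthogonal (k1 \<circ> \<sigma>) \<and> \<not> first_orthogonal_only (k1 \<circ> \<sigma>)) \<longrightarrow>
        (effective_hamiltonian (trig_potential a1 lam1 k1) =
           effective_hamiltonian (trig_potential a2 lam2 k2) \<longleftrightarrow>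
         (\<exists>c\<in>\<rat> - {0}. \<exists>x0. \<forall>x.
            trig_potential a1 lam1 k1 x = trig_potential a2 lam2 k2 ((1 / c) *\<^sub>R x + x0))))"
proof -
  let ?V1 = "trig_potential a1 lam1 k1" and ?V2 = "trig_potential a2 lam2 k2" and ?I = "{1, 2, 3 :: nat}"
  have I: "1 \<in> ?I" "2 \<in> ?I" "3 \<in> ?I" by simp_all
  note eff = trig_effective_eq_iff[OF data1 data2, of a1 a2]
  have k10: "k1 j \<noteq> 0" if "j \<in> ?I" for j by (rule admissible_dataD(3)[OF data1 that])
  define A where "A = (\<lambda>j. 2 * cmod (lam1 j))"
  define \<kappa> where "\<kappa> = (\<lambda>j. (2 * pi) *\<^sub>R k1 j)"
  have A0: "A j \<noteq> 0" if "j \<in> ?I" for j using admissible_dataD(1)[OF data1 that] by (simp add: A_def)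
  have freq: "frequencies ?I \<kappa>" unfolding \<kappa>_def by (rule admissible_waves(1)[OF data1])
  have V1: "?V1 = cos_potential a1 ?I A \<kappa> (\<lambda>j. Arg (lam1 j))"
    unfolding A_def \<kappa>_def by (rule trig_potential_eq_cos_potential)
  have aligned: "a1 = a2 \<and> (\<exists>lam' k' c. relabelling lam2 k2 lam' k' \<and>
      (\<forall>j\<in>?I. c j > 0 \<and> c j \<in> \<rat> \<and> k' j = c j *\<^sub>R k1 j \<and> cmod (lam1 j) = cmod (lam' j)) \<and>
      same_value (cos_potential a1 ?I A \<kappa> (\<lambda>j. Arg (lam1 j))) (cos_potential a1 ?I A (\<lambda>j. c j *\<^sub>R \<kappa> j) (\<lambda>j. Arg (lam' j))))"
    if same: "same_value ?V1 ?V2"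
  proof -
    obtain lam' k' c where a: "a1 = a2" and r: "relabelling lam2 k2 lam' k'"
      and c: "\<forall>j\<in>?I. c j > 0 \<and> c j \<in> \<rat> \<and> k' j = c j *\<^sub>R k1 j \<and> cmod (lam1 j) = cmod (lam' j)"
      using alignment[OF data1 data2 same] by blast
    have "?V2 = cos_potential a1 ?I A (\<lambda>j. c j *\<^sub>R \<kappa> j) (\<lambda>j. Arg (lam' j))"
      unfolding trig_potential_relabelling[OF r, symmetric] A_def \<kappa>_def a
      by (rule aligned_cos_potential) (use c in blast)+
    then have "same_value (cos_potential a1 ?I A \<kappa> (\<lambda>j. Arg (lam1 j))) (cos_potential a1 ?I A (\<lambda>j. c j *\<^sub>R \<kappa> j) (\<lambda>j. Arg (lam' j)))"
      using same unfolding V1 by simp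
    then show ?thesis using a r c by blast
  qed
  have case1: "same_value ?V1 ?V2 \<longleftrightarrow> a1 = a2 \<and> (\<exists>lam2' k2'. relabelling lam2 k2 lam2' k2' \<and>
      (\<forall>j\<in>{1..3}. parallel (k1 j) (k2' j) \<and> cmod (lam1 j) = cmod (lam2' j)))" if orth: "mutually_orthogonal k1"
  proof
    assume "same_value ?V1 ?V2"
    from aligned[OF this] obtain lam' k' c where a: "a1 = a2" and r: "relabelling lam2 k2 lam' k'"
      and c: "\<forall>j\<in>?I. c j > 0 \<and> c j \<in> \<rat> \<and> k' j = c j *\<^sub>R k1 j \<and> cmod (lam1 j) = cmod (lam' j)" by blast
    have "\<forall>j\<in>?I. parallel (k1 j) (k' j) \<and> cmod (lam1 j) = cmod (lam' j)"
      using c parallel_iff_scaleR k10 by blast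
    then show "a1 = a2 \<and> (\<exists>lam2' k2'. relabelling lam2 k2 lam2' k2' \<and>
      (\<forall>j\<in>{1..3}. parallel (k1 j) (k2' j) \<and> cmod (lam1 j) = cmod (lam2' j)))"
      using a r unfolding atLeastAtMost_1_3 by blast
  next
    assume "a1 = a2 \<and> (\<exists>lam2' k2'. relabelling lam2 k2 lam2' k2' \<and>
      (\<forall>j\<in>{1..3}. parallel (k1 j) (k2' j) \<and> cmod (lam1 j) = cmod (lam2' j)))"
    then show "same_value ?V1 ?V2" using orthogonal_case[OF data1 data2 orth] by blast
  qed
  have case2: "same_value ?V1 ?V2 \<longleftrightarrow> a1 = a2 \<and> (\<exists>lam2' k2'. relabelling lam2 k2 lam2' k2' \<and>
            parallel (k1 1) (k2' 1) \<and>
            (\<exists>c\<in>\<rat> - {0}. c *\<^sub>R k1 2 = k2' 2 \<and> c *\<^sub>R k1 3 = k2' 3) \<and>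
            (\<forall>j\<in>{1..3}. cmod (lam1 j) = cmod (lam2' j)))" if orth: "first_orthogonal_only k1"
  proof
    assume "same_value ?V1 ?V2"
    from aligned[OF this] obtain lam' k' c where a: "a1 = a2" and r: "relabelling lam2 k2 lam' k'"
      and c: "\<forall>j\<in>?I. c j > 0 \<and> c j \<in> \<rat> \<and> k' j = c j *\<^sub>R k1 j \<and> cmod (lam1 j) = cmod (lam' j)"
      and same: "same_value (cos_potential a1 ?I A \<kappa> (\<lambda>j. Arg (lam1 j))) (cos_potential a1 ?I A (\<lambda>j. c j *\<^sub>R \<kappa> j) (\<lambda>j. Arg (lam' j)))"
      by blast
    have o: "k1 1 \<bullet> k1 2 = 0" "k1 1 \<bullet> k1 3 = 0" "k1 2 \<bullet> k1 3 \<noteq> 0"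
      using orth unfolding first_orthogonal_only_def orthogonal_def by blast+
    have cp: "c j > 0" if "j \<in> ?I" for j using c that by blast
    have "c 2 = c 3"
    proof (rule equal_ratio_independent[of ?I 2 3 1, OF _ _ _ _ same A0 cp])
      show "?I = {2, 3, 1}" by auto
      show "\<kappa> 2 \<bullet> \<kappa> 3 \<noteq> 0" using o(3) by (simp add: \<kappa>_def)
      show "\<not> parallel (\<kappa> 2) (\<kappa> 3)" using freq unfolding frequencies_def by auto
      \<comment> \<open>A non-zero vector orthogonal to \<open>\<kappa> 2\<close> and \<open>\<kappa> 3\<close> is not in their span.\<close>
      show "\<kappa> 1 \<noteq> \<alpha> *\<^sub>R \<kappa> 2 + \<beta> *\<^sub>R \<kappa> 3" for \<alpha> \<beta>
      proof
        assume "\<kappa> 1 = \<alpha> *\<^sub>R \<kappa> 2 + \<beta> *\<^sub>R \<kappa> 3"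
        then have "\<kappa> 1 \<bullet> \<kappa> 1 = \<kappa> 1 \<bullet> (\<alpha> *\<^sub>R \<kappa> 2 + \<beta> *\<^sub>R \<kappa> 3)" by simp
        also have "\<dots> = 0" unfolding inner_add_right inner_scaleR_right using o by (simp add: \<kappa>_def)
        finally show False using k10[OF I(1)] by (simp add: \<kappa>_def)
      qed
    qed simp_all
    then have "c 2 *\<^sub>R k1 2 = k' 2 \<and> c 2 *\<^sub>R k1 3 = k' 3" using c I by auto
    moreover have "c 2 \<in> \<rat> - {0}" using c I(2) by auto
    moreover have "parallel (k1 1) (k' 1)" using c I(1) parallel_iff_scaleR[OF k10[OF I(1)]] by blast
    ultimately show "a1 = a2 \<and> (\<exists>lam2' k2'. relabelling lam2 k2 lam2' k2' \<and>
            parallel (k1 1) (k2' 1) \<and>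
            (\<exists>c\<in>\<rat> - {0}. c *\<^sub>R k1 2 = k2' 2 \<and> c *\<^sub>R k1 3 = k2' 3) \<and>
            (\<forall>j\<in>{1..3}. cmod (lam1 j) = cmod (lam2' j)))"
      using a r c unfolding atLeastAtMost_1_3 by blast
  next
    assume h: "a1 = a2 \<and> (\<exists>lam2' k2'. relabelling lam2 k2 lam2' k2' \<and>
            parallel (k1 1) (k2' 1) \<and>
            (\<exists>c\<in>\<rat> - {0}. c *\<^sub>R k1 2 = k2' 2 \<and> c *\<^sub>R k1 3 = k2' 3) \<and>
            (\<forall>j\<in>{1..3}. cmod (lam1 j) = cmod (lam2' j)))"
    then obtain lam' k' c where a: "a1 = a2" and r: "relabelling lam2 k2 lam' k'" "parallel (k1 1) (k' 1)"
      and c: "c \<in> \<rat> - {0}" "c *\<^sub>R k1 2 = k' 2" "c *\<^sub>R k1 3 = k' 3" and m: "\<forall>j\<in>{1..3}. cmod (lam1 j) = cmod (lam' j)" by blast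
    have "c \<noteq> 0" using c(1) by simp
    then show "same_value ?V1 ?V2" using first_orthogonal_case[OF data1 data2 orth r _ c(2,3) m] a by blast
  qed
  have case3: "same_value ?V1 ?V2 \<longleftrightarrow> (\<exists>c\<in>\<rat> - {0}. \<exists>x0. \<forall>x. ?V1 x = ?V2 ((1 / c) *\<^sub>R x + x0))"
    if generic: "\<forall>\<sigma>. \<sigma> permutes {1..3} \<longrightarrow> \<not> mutually_orthogonal (k1 \<circ> \<sigma>) \<and> \<not> first_orthogonal_only (k1 \<circ> \<sigma>)"
  proof
    assume same0: "same_value ?V1 ?V2"
    from aligned[OF this] obtain lam' k' c where a: "a1 = a2" and r: "relabelling lam2 k2 lam' k'"
      and c: "\<forall>j\<in>?I. c j > 0 \<and> c j \<in> \<rat> \<and> k' j = c j *\<^sub>R k1 j \<and> cmod (lam1 j) = cmod (lam' j)"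
      and same: "same_value (cos_potential a1 ?I A \<kappa> (\<lambda>j. Arg (lam1 j))) (cos_potential a1 ?I A (\<lambda>j. c j *\<^sub>R \<kappa> j) (\<lambda>j. Arg (lam' j)))"
      by blast
    have cp: "c j > 0" if "j \<in> ?I" for j using c that by blast
    have edges: "\<kappa> 1 \<bullet> \<kappa> 2 \<noteq> 0 \<and> \<kappa> 1 \<bullet> \<kappa> 3 \<noteq> 0 \<or> \<kappa> 1 \<bullet> \<kappa> 2 \<noteq> 0 \<and> \<kappa> 2 \<bullet> \<kappa> 3 \<noteq> 0 \<or> \<kappa> 1 \<bullet> \<kappa> 3 \<noteq> 0 \<and> \<kappa> 2 \<bullet> \<kappa> 3 \<noteq> 0"
      using two_edges[OF generic] by (simp add: \<kappa>_def)
    have cc: "c 1 = c 3 \<and> c 2 = c 3"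
      by (rule equal_ratios[OF same same_value_sym[OF same] A0 cp freq edges])
    have k': "k' j = c 3 *\<^sub>R k1 j" if "j \<in> ?I" for j using c cc that by auto
    have rel: "trig_potential a2 lam2 k2 = trig_potential a1 lam' k'" unfolding trig_potential_relabelling[OF r] a ..
    have "\<exists>c\<in>\<rat> - {0}. \<exists>x0. \<forall>x. trig_potential a1 lam1 k1 x = trig_potential a1 lam' k' ((1 / c) *\<^sub>R x + x0)"
    proof (rule translate_of_common_ratio[OF data1, of a1 lam' k' "c 3"])
      show "same_value (trig_potential a1 lam1 k1) (trig_potential a1 lam' k')" using same0 unfolding rel .
      show "c 3 > 0" "c 3 \<in> \<rat>" using c I(3) by blast+
      show "k' j = c 3 *\<^sub>R k1 j" if "j \<in> ?I" for j by (rule k'[OF that])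
      show "cmod (lam1 j) = cmod (lam' j)" if "j \<in> ?I" for j using c that by blast
    qed
    then show "\<exists>c\<in>\<rat> - {0}. \<exists>x0. \<forall>x. ?V1 x = ?V2 ((1 / c) *\<^sub>R x + x0)" unfolding rel .
  next
    assume "\<exists>c\<in>\<rat> - {0}. \<exists>x0. \<forall>x. ?V1 x = ?V2 ((1 / c) *\<^sub>R x + x0)"
    then obtain c x0 where c: "c \<in> \<rat> - {0}" and eq: "\<And>x. ?V1 x = ?V2 ((1 / c) *\<^sub>R x + x0)" by blast
    have c0: "c \<noteq> 0" using c by simp
    have per: "buc ?V1" "lattice_periodic ?V1" "buc ?V2" "lattice_periodic ?V2"
      unfolding trig_potential_eq_cos_potential
      by (rule buc_cos_potential lattice_periodic_cos_potential admissible_waves(2)[OF data1] admissible_waves(2)[OF data2])+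
    show "same_value ?V1 ?V2" by (rule same_value_of_dilation[OF per c0 eq])
  qed
  show ?thesis unfolding eff using case1 case2 case3 by blast
qed

end
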